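(* For every constant $\alpha>0$, every sufficiently small constant $\epsilon>0$ and every $0<b\le\frac{1}{500\epsilon}$, there exists a constant $c=c(\alpha)>0$ (sufficiently small in terms of $\alpha$) and infinitely many pairs $(d,n)\in\mathbb{N}^2$, with $d=\omega_n(1)$ and $d<n^{1/5}$, such that for each such pair there is a $d$-regular graph $G=(V,E)$ on $n$ vertices satisfying: (Q1) for every $U\subseteq V$ with $|U|\le n/2$, $e_G(U,U^c)\ge b|U|$; (Q2) for every $U\subseteq V$ with $|U|\le c\cdot d\log n$, $|N_G(U)|\ge (1-\alpha)d|U|$; (Q3) for every $U\subseteq V$ with $|U|\le \frac{\alpha}{2}d^2\log n$, $e_G(U,U^c)\ge (1-\alpha)d|U|$; and moreover, with $p=\frac{1+\epsilon}{d}$, with high probability (as $n\to\infty$ along these pairs) $G[V_p]$ contains at least two components each of size at least $\epsilon d\log n$.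
   Context: $V_p\subseteq V$ is the random set obtained by including each vertex independently with probability $p$, and $G[V_p]$ is the induced subgraph. $N_G(U)$ is the external neighborhood of $U$, $U^c=V\setminus U$, and $e_G(U,U^c)$ is the number of edges between $U$ and $U^c$. "$d=\omega_n(1)$" means $d\to\infty$ as $n\to\infty$ along the pairs. Logarithms are natural. *)

theory Defs
  imports "HOL-Probability.Probability" "Graph_Theory.Digraph_Component"
begin

text \<open>
  A finite simple graph is a \<^locale>\<open>pair_graph\<close>: a finite, loop-free, symmetric set of vertex
  pairs, the undirected edge \<open>uv\<close> being represented by the two arcs \<open>(u,v)\<close> and \<open>(v,u)\<close>. Hence the
  degree of a vertex is its out-degree.
\<close>

definition regular_graph :: "nat \<Rightarrow> nat \<Rightarrow> 'a pair_pre_digraph \<Rightarrow> bool" where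
  "regular_graph d n G \<longleftrightarrow>
     pair_graph G \<and> card (pverts G) = n \<and> (\<forall>v \<in> pverts G. out_degree (with_proj G) v = d)"

text \<open>
  For disjoint \<open>A\<close> and \<open>B\<close> every edge between them has exactly one of its two arcs pointing from
  \<open>A\<close> to \<open>B\<close>, so each edge is counted once.
\<close>

definition edges_between :: "'a pair_pre_digraph \<Rightarrow> 'a set \<Rightarrow> 'a set \<Rightarrow> nat" where
  "edges_between G A B = card {(u, v) \<in> parcs G. u \<in> A \<and> v \<in> B}"

definition ext_nbhd :: "'a pair_pre_digraph \<Rightarrow> 'a set \<Rightarrow> 'a set" where
  "ext_nbhd G U = {v \<in> pverts G - U. \<exists>u \<in> U. (u, v) \<in> parcs G}"

text \<open>
  The qualified name selects graph connectivity: unqualified, it would be ambiguous with the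
  topological notion.
\<close>

definition graph_components :: "('a, 'b) pre_digraph \<Rightarrow> ('a, 'b) pre_digraph set" where
  "graph_components H = {C. pre_digraph.max_subgraph H Digraph_Component.connected C}"

definition random_subset_pmf :: "'a set \<Rightarrow> real \<Rightarrow> 'a set pmf" where
  "random_subset_pmf V p =
     map_pmf (\<lambda>f. {v \<in> V. f v}) (Pi_pmf V False (\<lambda>_. bernoulli_pmf p))"

text \<open>
  Limits as \<open>n \<rightarrow> \<infinity>\<close> along the pairs \<open>(d,n)\<close> in \<open>S\<close>. The filter is proper only if \<open>n\<close> is unbounded
  on \<open>S\<close>; this holds when \<open>S\<close> is infinite and \<open>d\<close> is bounded by a function of \<open>n\<close> on \<open>S\<close>.
\<close>

definition along_pairs :: "(nat \<times> nat) set \<Rightarrow> (nat \<times> nat) filter" where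
  "along_pairs S = inf (filtercomap snd at_top) (principal S)"

end

theory Submission
  imports Defs "HOL-Real_Asymp.Real_Asymp"
begin

text \<open>
  The vertex set is divided into parts of \<open>M \<approx> C d\<^sup>2 ln n\<close> vertices. Each part carries a copy of one
  \<open>(d - 4\<beta>)\<close>-regular graph \<open>H\<close>, a random lift of a complete bipartite graph, in which sets of up to
  \<open>c M / d\<close> vertices expand almost losslessly; the parts are the cells of a \<open>q \<times> q\<close> grid, and any two
  parts in a common row or column are joined by a single edge, placed so that these edges form a
  \<open>4\<beta>\<close>-regular graph. (Q2) and (Q3) only need the edges inside the parts. For (Q1) the expansion of
  \<open>H\<close> reduces to unions of parts, where the isoperimetric inequality of the grid applies.

  In a percolated part, an exploration argument yields with positive probability a component of
  \<open>\<ge> \<epsilon> d ln n\<close> vertices, and a comparison with a branching process shows that it has \<open>O(\<epsilon> M / d)\<close>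
  vertices. It has at most \<open>4\<beta>\<close> outside neighbours per vertex and \<open>\<beta> \<epsilon> \<approx> 1 / 500\<close>, so all of these are
  closed with probability at least \<open>n\<close> to a small negative power. The parts on the diagonal of the grid
  behave independently and there are about \<open>n\<close> to the power \<open>1 / 3\<close> of them, so at least two of them
  contain such an isolated component with high probability.
\<close>

section \<open>Images of sets under uniformly random permutations\<close>

text \<open>The origin of 1/500: (Q1) forces about b edges per vertex out of a set as small as a
  part, yet a component of the part must be cut off from all of them. With \<open>l\<close> about 16
  d ln d a part has M about 32 d^2 ln d vertices; a grid side q of about 2 \<beta> M gives n about 4
  \<beta>^2 M^3, so ln n is about 6 ln d. A component of at most 4 \<epsilon> M / d vertices has at
  most 16 \<beta> \<epsilon> M / d outside neighbours, and closing them costs a factor of about exp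
  (- 16 * 32 \<beta> \<epsilon> ln d), where 16 * 32 / 500 = 1.024. A diagonal part therefore
  succeeds with probability at least d^(-6/5) / 10, while there are more than d^2 of them. A lift
  serves as H because its permutations are independent and have explicit exponential moments, strong
  enough for a union bound over all vertex sets. The component size is controlled by Markov's
  inequality for the number of vertices in large components. Only diagonal parts are used since
  parts in a common row or column are adjacent.\<close>

lemma sum_Pow_power_card:
  fixes y :: real
  assumes "finite U"
  shows "(\<Sum>A\<in>Pow U. y ^ card A) = (1 + y) ^ card U"
  using assms
proof (induction U rule: finite_induct)
  case (insert x F)
  have "(\<Sum>A\<in>Pow (insert x F). y ^ card A) = (\<Sum>A\<in>Pow F. y ^ card A) + (\<Sum>A\<in>insert x ` Pow F. y ^ card A)"
    unfolding Pow_insert using insert by (intro sum.union_disjoint) auto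
  also have "(\<Sum>A\<in>insert x ` Pow F. y ^ card A) = (\<Sum>A\<in>Pow F. y ^ card (insert x A))"
    using insert by (subst sum.reindex) (auto simp: inj_on_def)
  also have "\<dots> = (\<Sum>A\<in>Pow F. y * y ^ card A)"
    using insert by (intro sum.cong refl) (auto simp: card_insert_if finite_subset)
  finally show ?case
    using insert by (simp add: sum_distrib_left[symmetric] algebra_simps)
qed simp

text \<open>Cost of a union bound over all nonempty sets when a set of size j fails with probability
  at most y^j: only |U| y has to be small, as large sets pay for their number by their own failure
  probability.\<close>

lemma sum_nonempty_Pow_power_card_le:
  fixes y :: real
  assumes "finite U" "0 \<le> y"
  shows "(\<Sum>A\<in>Pow U - {{}}. y ^ card A) \<le> exp (card U * y) - 1"
proof -
  have "(\<Sum>A\<in>Pow U. y ^ card A) = (\<Sum>A\<in>Pow U - {{}}. y ^ card A) + 1"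
    using assms by (subst sum.remove[of _ "{}"]) auto
  moreover have "(1 + y) ^ card U \<le> exp y ^ card U"
    using assms by (intro power_mono) (auto simp: add_nonneg_nonneg)
  ultimately show ?thesis
    using sum_Pow_power_card[OF assms(1), of y] by (simp add: exp_of_nat_mult)
qed

text \<open>Double counting of pairs (x, \<open>\<sigma>\<close>) with x outside A and A together
  with x mapped into T. Composition with a transposition shows that the choice of x does not matter,
  and a \<open>\<sigma>\<close> mapping A into T sends exactly \<open>card T - card A\<close>
  further points into T.\<close>

lemma card_permutes_image_subset_insert:
  assumes "finite S" "A \<subseteq> S" "a \<in> S - A" "T \<subseteq> S"
  shows "(card S - card A) * card {\<sigma>. \<sigma> permutes S \<and> \<sigma> ` insert a A \<subseteq> T}
       = (card T - card A) * card {\<sigma>. \<sigma> permutes S \<and> \<sigma> ` A \<subseteq> T}"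
proof -
  define P where "P B = {\<sigma>. \<sigma> permutes S \<and> \<sigma> ` B \<subseteq> T}" for B
  have finP: "finite (P B)" for B
    using finite_permutations[OF assms(1)] by (auto simp: P_def)
  have finA: "finite A" using assms finite_subset by blast
  have swap: "card (P (insert x A)) = card (P (insert a A))" if "x \<in> S - A" for x
  proof (rule bij_betw_same_card[of "\<lambda>\<sigma>. \<sigma> \<circ> Transposition.transpose a x"],
      rule bij_betw_byWitness[where f' = "\<lambda>\<sigma>. \<sigma> \<circ> Transposition.transpose a x"])
    have *: "Transposition.transpose a x ` insert x A = insert a A" "Transposition.transpose a x ` insert a A = insert x A"
      using assms that by (auto simp: Transposition.transpose_def image_def)
    have tr: "Transposition.transpose a x permutes S"
      using that assms by (intro permutes_swap_id) auto
    show "(\<lambda>\<sigma>. \<sigma> \<circ> Transposition.transpose a x) ` P (insert x A) \<subseteq> P (insert a A)"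
      "(\<lambda>\<sigma>. \<sigma> \<circ> Transposition.transpose a x) ` P (insert a A) \<subseteq> P (insert x A)"
      using * permutes_compose[OF tr] unfolding P_def
      by (simp_all only: image_subset_iff[of _ "{\<sigma>. _ \<sigma>}"] mem_Collect_eq image_comp[symmetric] simp_thms ball_simps) blast+
  qed (auto simp: fun_eq_iff)
  have "(card S - card A) * card (P (insert a A)) = (\<Sum>x\<in>S - A. card (P (insert x A)))"
  proof -
    have "(\<Sum>x\<in>S - A. card (P (insert x A))) = (\<Sum>x\<in>S - A. card (P (insert a A)))"
      by (intro sum.cong refl swap)
    thus ?thesis using assms finA by (simp add: card_Diff_subset)
  qed
  also have "\<dots> = (\<Sum>x\<in>S - A. \<Sum>\<sigma>\<in>P A. of_bool (\<sigma> x \<in> T))"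
  proof (intro sum.cong refl)
    fix x assume "x \<in> S - A"
    have "P (insert x A) = {\<sigma> \<in> P A. \<sigma> x \<in> T}" by (auto simp: P_def)
    thus "card (P (insert x A)) = (\<Sum>\<sigma>\<in>P A. of_bool (\<sigma> x \<in> T))"
      using finP by (simp add: sum.If_cases of_bool_def Int_def)
  qed
  also have "\<dots> = (\<Sum>\<sigma>\<in>P A. \<Sum>x\<in>S - A. of_bool (\<sigma> x \<in> T))"
    by (rule sum.swap)
  also have "\<dots> = (\<Sum>\<sigma>\<in>P A. card T - card A)"
  proof (intro sum.cong refl)
    fix \<sigma> assume s: "\<sigma> \<in> P A"
    have perm: "\<sigma> permutes S" using s by (auto simp: P_def)
    have "bij_betw \<sigma> {x\<in>S. \<sigma> x \<in> T} T"
      using permutes_bij[OF perm] permutes_image[OF perm] assms(4) permutes_inj_on[OF perm]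
      by (auto simp: bij_betw_def intro: inj_on_subset)
    hence "card {x\<in>S. \<sigma> x \<in> T} = card T" by (rule bij_betw_same_card)
    moreover have "(S - A) \<inter> {x. \<sigma> x \<in> T} = {x\<in>S. \<sigma> x \<in> T} - A" by auto
    moreover have "A \<subseteq> {x\<in>S. \<sigma> x \<in> T}" using s assms by (auto simp: P_def)
    ultimately show "(\<Sum>x\<in>S - A. of_bool (\<sigma> x \<in> T)) = card T - card A"
      using assms finA by (simp add: sum.If_cases of_bool_def card_Diff_subset)
  qed
  finally show ?thesis by (simp add: P_def)
qed

text \<open>The exact count is a quotient of falling factorials, and (t - k) / (s - k) \<le> t / s
  for t \<le> s: a random permutation maps A into T no more often than independent uniform choices
  would.\<close>

lemma card_permutes_image_subset_le:
  assumes "finite S" "A \<subseteq> S" "T \<subseteq> S"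
  shows "real (card {\<sigma>. \<sigma> permutes S \<and> \<sigma> ` A \<subseteq> T}) \<le> fact (card S) * (card T / card S) ^ card A"
proof -
  have "finite A" using assms finite_subset by blast
  thus ?thesis using assms(2)
  proof (induction A rule: finite_induct)
    case empty
    thus ?case using assms by (simp add: card_permutations)
  next
    case (insert a A)
    define s t k where "s = card S" and "t = card T" and "k = card A"
    define X Y where "X = real (card {\<sigma>. \<sigma> permutes S \<and> \<sigma> ` insert a A \<subseteq> T})"
      and "Y = real (card {\<sigma>. \<sigma> permutes S \<and> \<sigma> ` A \<subseteq> T})"
    have IH: "Y \<le> fact s * (t / s) ^ k" using insert by (simp add: s_def t_def k_def Y_def)
    have "card (insert a A) \<le> s" unfolding s_def using insert assms by (intro card_mono) auto
    hence ks: "k < s" using insert by (simp add: k_def)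
    have ts: "t \<le> s" unfolding t_def s_def using assms by (intro card_mono)
    have eq: "(real s - real k) * X = real (t - k) * Y"
    proof -
      have "(s - k) * card {\<sigma>. \<sigma> permutes S \<and> \<sigma> ` insert a A \<subseteq> T} = (t - k) * card {\<sigma>. \<sigma> permutes S \<and> \<sigma> ` A \<subseteq> T}"
        unfolding s_def t_def k_def using insert assms
        by (intro card_permutes_image_subset_insert) auto
      hence "real (s - k) * X = real (t - k) * Y"
        unfolding X_def Y_def of_nat_mult[symmetric] of_nat_eq_iff .
      thus ?thesis using ks by (simp add: of_nat_diff)
    qed
    \<comment> \<open>For k > t the truncated difference is 0 and the bound is trivial.\<close>
    have "real s * real (t - k) \<le> real t * (real s - real k)"
    proof (cases "k \<le> t")
      case True
      have "real k * real t \<le> real k * real s" using ts by (intro mult_left_mono) auto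
      thus ?thesis using True by (simp add: of_nat_diff algebra_simps)
    qed (use ks in auto)
    hence "real s * real (t - k) * Y \<le> real t * (real s - real k) * Y"
      by (intro mult_right_mono) (auto simp: Y_def)
    moreover have "(real s - real k) * (real s * X) = real s * real (t - k) * Y"
      using eq by (simp only: mult.left_commute[of _ "real s"] mult.assoc)
    ultimately have "(real s - real k) * (real s * X) \<le> (real s - real k) * (real t * Y)"
      by (simp only: mult_ac)
    hence "real s * X \<le> real t * Y" using ks by simp
    hence "X \<le> t / s * Y" using ks by (simp add: field_simps)
    also have "\<dots> \<le> t / s * (fact s * (t / s) ^ k)" using IH by (intro mult_left_mono) auto
    finally show ?case using insert
      unfolding X_def by (simp add: s_def t_def k_def mult_ac)
  qed
qed

text \<open>2^N counts the subsets of an N-set, so the exponential moment at base 2 is a sum of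
  containment counts; the bound is the one that independent uniform points would give.\<close>

lemma sum_permutes_two_power_card_le:
  assumes "finite S" "U \<subseteq> S" "T \<subseteq> S"
  shows "(\<Sum>\<sigma> | \<sigma> permutes S. 2 ^ card (\<sigma> ` U \<inter> T)) \<le> fact (card S) * exp (real (card U) * card T / card S)"
proof -
  have finU: "finite U" using assms finite_subset by blast
  have finP: "finite {\<sigma>. \<sigma> permutes S}" using assms by (simp add: finite_permutations)
  have "(\<Sum>\<sigma> | \<sigma> permutes S. (2::real) ^ card (\<sigma> ` U \<inter> T))
      = (\<Sum>\<sigma> | \<sigma> permutes S. \<Sum>A\<in>Pow U. of_bool (\<sigma> ` A \<subseteq> T))"
  proof (intro sum.cong refl)
    fix \<sigma> assume "\<sigma> \<in> {\<sigma>. \<sigma> permutes S}"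
    hence inj: "inj \<sigma>" by (auto dest: permutes_inj)
    have "\<sigma> ` U \<inter> T = \<sigma> ` {x\<in>U. \<sigma> x \<in> T}" by auto
    hence "card (\<sigma> ` U \<inter> T) = card {x\<in>U. \<sigma> x \<in> T}"
      using inj by (metis card_image inj_on_subset subset_UNIV)
    moreover have "Pow U \<inter> {A. \<sigma> ` A \<subseteq> T} = Pow {x\<in>U. \<sigma> x \<in> T}" by auto
    ultimately show "2 ^ card (\<sigma> ` U \<inter> T) = (\<Sum>A\<in>Pow U. of_bool (\<sigma> ` A \<subseteq> T) :: real)"
      using finU by (simp add: of_bool_def sum.If_cases card_Pow)
  qed
  also have "\<dots> = (\<Sum>A\<in>Pow U. \<Sum>\<sigma> | \<sigma> permutes S. of_bool (\<sigma> ` A \<subseteq> T))"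
    by (rule sum.swap)
  also have "\<dots> = (\<Sum>A\<in>Pow U. real (card {\<sigma>. \<sigma> permutes S \<and> \<sigma> ` A \<subseteq> T}))"
    using finP by (intro sum.cong refl) (simp add: of_bool_def sum.If_cases Int_def)
  also have "\<dots> \<le> (\<Sum>A\<in>Pow U. fact (card S) * (card T / card S) ^ card A)"
    using assms by (intro sum_mono card_permutes_image_subset_le) auto
  also have "\<dots> = fact (card S) * (1 + card T / card S) ^ card U"
    using finU by (simp add: sum_distrib_left[symmetric] sum_Pow_power_card)
  also have "\<dots> \<le> fact (card S) * exp (card T / card S) ^ card U"
    by (intro mult_left_mono power_mono) (auto simp: add_nonneg_nonneg)
  finally show ?thesis by (simp add: exp_of_nat_mult[symmetric] mult_ac)
qed

lemma sum_permutes_inv_two_power_card_le: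
  assumes "finite S" "U \<subseteq> S" "T \<subseteq> S"
  shows "(\<Sum>\<sigma> | \<sigma> permutes S. 2 ^ card (inv \<sigma> ` U \<inter> T)) \<le> fact (card S) * exp (real (card U) * card T / card S)"
proof -
  have "(\<Sum>\<sigma> | \<sigma> permutes S. (2::real) ^ card (inv \<sigma> ` U \<inter> T)) = (\<Sum>\<sigma> | \<sigma> permutes S. 2 ^ card (\<sigma> ` U \<inter> T))"
    by (rule sum.reindex_bij_witness[where i = inv and j = inv])
      (auto simp: permutes_inv permutes_inv_inv)
  thus ?thesis using sum_permutes_two_power_card_le[OF assms] by simp
qed

lemma sum_PiE_insert:
  assumes "i \<notin> I"
  shows "(\<Sum>\<pi>\<in>PiE (insert i I) F. f \<pi>) = (\<Sum>g\<in>PiE I F. \<Sum>y\<in>F i. f (g(i := y)))"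
proof -
  have "(\<Sum>\<pi>\<in>PiE (insert i I) F. f \<pi>) = (\<Sum>(y, g)\<in>F i \<times> PiE I F. f (g(i := y)))"
    unfolding PiE_insert_eq using inj_combinator[OF assms]
    by (subst sum.reindex) (auto simp: case_prod_unfold)
  also have "\<dots> = (\<Sum>y\<in>F i. \<Sum>g\<in>PiE I F. f (g(i := y)))"
    by (simp add: sum.cartesian_product)
  also have "\<dots> = (\<Sum>g\<in>PiE I F. \<Sum>y\<in>F i. f (g(i := y)))"
    by (rule sum.swap)
  finally show ?thesis .
qed

text \<open>Revealing the maps one at a time, the factor \<open>2 ^ loss\<close> grows in expectation at most by
  \<open>exp (u * card (U i) / card S)\<close> in each step, since at most \<open>u\<close> points of a column are occupied.\<close>
lemma sum_two_power_overlap_le: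
  fixes h :: "('a \<Rightarrow> 'a) \<Rightarrow> 'a \<Rightarrow> 'a" and col :: "'i \<Rightarrow> 'c"
  assumes "finite I" "finite S"
    and h: "\<And>\<sigma>. \<sigma> permutes S \<Longrightarrow> h \<sigma> permutes S"
    and mgf: "\<And>U T. U \<subseteq> S \<Longrightarrow> T \<subseteq> S \<Longrightarrow>
      (\<Sum>\<sigma> | \<sigma> permutes S. 2 ^ card (h \<sigma> ` U \<inter> T)) \<le> fact (card S) * exp (real (card U) * card T / card S)"
    and U: "\<And>i. i \<in> I \<Longrightarrow> U i \<subseteq> S"
    and col: "\<And>c. (\<Sum>i\<in>{i\<in>I. col i = c}. card (U i)) \<le> u"
  shows "(\<Sum>\<pi>\<in>PiE I (\<lambda>_. {\<sigma>. \<sigma> permutes S}).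
            2 ^ ((\<Sum>i\<in>I. card (U i)) - card (\<Union>i\<in>I. {col i} \<times> h (\<pi> i) ` U i)))
         \<le> fact (card S) ^ card I * exp (real u * (\<Sum>i\<in>I. card (U i)) / card S)"
  using assms(1) U col
proof (induction I rule: finite_induct)
  case (insert i I)
  define P where "P = {\<sigma>. \<sigma> permutes S}"
  define N where "N g = (\<Union>j\<in>I. {col j} \<times> h (g j) ` U j)" for g
  define m where "m = (\<Sum>i\<in>I. card (U i))"
  have finP: "finite P" using assms by (simp add: P_def finite_permutations)
  have finU: "finite (U j)" if "j \<in> insert i I" for j
    using insert.prems(1)[OF that] assms(2) finite_subset by blast
  have finN: "finite (N g)" for g using insert finU by (auto simp: N_def)
  have cardN: "card (N g) \<le> m" for g
  proof -
    have "card (N g) \<le> (\<Sum>j\<in>I. card ({col j} \<times> h (g j) ` U j))"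
      unfolding N_def using insert by (intro card_UN_le) auto
    also have "\<dots> \<le> m" unfolding m_def
      using finU by (intro sum_mono) (auto simp: card_cartesian_product intro!: card_image_le)
    finally show ?thesis .
  qed
  have colI: "(\<Sum>i\<in>{i\<in>I. col i = c}. card (U i)) \<le> u" for c
  proof -
    have "(\<Sum>i\<in>{i\<in>I. col i = c}. card (U i)) \<le> (\<Sum>j\<in>{j\<in>insert i I. col j = c}. card (U j))"
      using insert by (intro sum_mono2) auto
    thus ?thesis using insert.prems(2)[of c] by linarith
  qed
  have inner: "(\<Sum>\<sigma>\<in>P. (2::real) ^ (card (U i) + m - card (N g \<union> {col i} \<times> h \<sigma> ` U i)))
      \<le> 2 ^ (m - card (N g)) * (fact (card S) * exp (real u * card (U i) / card S))"
    if g: "g \<in> PiE I (\<lambda>_. P)" for g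
  proof -
    define T where "T = {y. (col i, y) \<in> N g}"
    have TS: "T \<subseteq> S"
    proof
      fix y assume "y \<in> T"
      then obtain j x where j: "j \<in> I" "y = h (g j) x" "x \<in> U j" by (auto simp: T_def N_def)
      hence "h (g j) permutes S" using g h by (auto simp: P_def)
      thus "y \<in> S" using j insert.prems(1)[of j] by (auto simp: permutes_in_image)
    qed
    have cT: "card T \<le> u"
    proof -
      have "T \<subseteq> (\<Union>j\<in>{j\<in>I. col j = col i}. h (g j) ` U j)" by (auto simp: T_def N_def)
      hence "card T \<le> card (\<Union>j\<in>{j\<in>I. col j = col i}. h (g j) ` U j)"
        using insert finU by (intro card_mono) auto
      also have "\<dots> \<le> (\<Sum>j\<in>{j\<in>I. col j = col i}. card (h (g j) ` U j))"
        using insert by (intro card_UN_le) auto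
      also have "\<dots> \<le> (\<Sum>j\<in>{j\<in>I. col j = col i}. card (U j))"
        using finU by (intro sum_mono card_image_le) auto
      finally show ?thesis using colI[of "col i"] by linarith
    qed
    have "(\<Sum>\<sigma>\<in>P. (2::real) ^ (card (U i) + m - card (N g \<union> {col i} \<times> h \<sigma> ` U i)))
        = (\<Sum>\<sigma>\<in>P. 2 ^ (m - card (N g)) * 2 ^ card (h \<sigma> ` U i \<inter> T))"
    proof (intro sum.cong refl)
      fix \<sigma> assume "\<sigma> \<in> P"
      hence "h \<sigma> permutes S" using h by (auto simp: P_def)
      hence "card (h \<sigma> ` U i) = card (U i)" by (metis card_image inj_on_subset permutes_inj subset_UNIV)
      moreover have "N g \<inter> {col i} \<times> h \<sigma> ` U i = {col i} \<times> (h \<sigma> ` U i \<inter> T)" by (auto simp: T_def)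
      moreover have "card (N g) + card ({col i} \<times> h \<sigma> ` U i)
          = card (N g \<union> {col i} \<times> h \<sigma> ` U i) + card (N g \<inter> {col i} \<times> h \<sigma> ` U i)"
        using finN finU by (intro card_Un_Int) auto
      ultimately have "card (N g) + card (U i) = card (N g \<union> {col i} \<times> h \<sigma> ` U i) + card (h \<sigma> ` U i \<inter> T)"
        by (simp add: card_cartesian_product)
      \<comment> \<open>\<open>cardN\<close> makes the natural subtractions exact, so the new loss
        is precisely the overlap with the points already occupied in the column.\<close>
      hence "card (U i) + m - card (N g \<union> {col i} \<times> h \<sigma> ` U i) = (m - card (N g)) + card (h \<sigma> ` U i \<inter> T)"
        using cardN[of g] by linarith
      thus "(2::real) ^ (card (U i) + m - card (N g \<union> {col i} \<times> h \<sigma> ` U i)) = 2 ^ (m - card (N g)) * 2 ^ card (h \<sigma> ` U i \<inter> T)"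
        by (simp add: power_add)
    qed
    also have "\<dots> = 2 ^ (m - card (N g)) * (\<Sum>\<sigma>\<in>P. 2 ^ card (h \<sigma> ` U i \<inter> T))"
      by (simp add: sum_distrib_left)
    also have "\<dots> \<le> 2 ^ (m - card (N g)) * (fact (card S) * exp (real (card (U i)) * card T / card S))"
      unfolding P_def using insert.prems(1)[of i] TS by (intro mult_left_mono mgf) auto
    also have "\<dots> \<le> 2 ^ (m - card (N g)) * (fact (card S) * exp (real u * card (U i) / card S))"
      using cT by (auto intro!: mult_left_mono divide_right_mono mult_right_mono simp: mult.commute[of "real (card (U i))"])
    finally show ?thesis .
  qed
  have "(\<Sum>\<pi>\<in>PiE (insert i I) (\<lambda>_. P).
      (2::real) ^ ((\<Sum>i\<in>insert i I. card (U i)) - card (\<Union>j\<in>insert i I. {col j} \<times> h (\<pi> j) ` U j)))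
    = (\<Sum>g\<in>PiE I (\<lambda>_. P). \<Sum>\<sigma>\<in>P. 2 ^ (card (U i) + m - card (N g \<union> {col i} \<times> h \<sigma> ` U i)))"
  proof (subst sum_PiE_insert[OF insert(2)], intro sum.cong refl)
    fix g \<sigma> assume "g \<in> PiE I (\<lambda>_. P)"
    have "(\<Union>j\<in>insert i I. {col j} \<times> h ((g(i := \<sigma>)) j) ` U j) = N g \<union> {col i} \<times> h \<sigma> ` U i"
      using insert(2) unfolding N_def by (auto split: if_splits)
    thus "(2::real) ^ ((\<Sum>i\<in>insert i I. card (U i)) - card (\<Union>j\<in>insert i I. {col j} \<times> h ((g(i := \<sigma>)) j) ` U j))
       = 2 ^ (card (U i) + m - card (N g \<union> {col i} \<times> h \<sigma> ` U i))"
      using insert by (simp add: m_def)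
  qed
  also have "\<dots> \<le> (\<Sum>g\<in>PiE I (\<lambda>_. P). 2 ^ (m - card (N g)) * (fact (card S) * exp (real u * card (U i) / card S)))"
    by (intro sum_mono inner)
  also have "\<dots> = (\<Sum>g\<in>PiE I (\<lambda>_. P). 2 ^ (m - card (N g))) * (fact (card S) * exp (real u * card (U i) / card S))"
    by (simp add: sum_distrib_right)
  also have "\<dots> \<le> (fact (card S) ^ card I * exp (real u * m / card S)) * (fact (card S) * exp (real u * card (U i) / card S))"
    using insert.IH[OF insert.prems(1) colI] unfolding P_def N_def m_def
    by (intro mult_right_mono) auto
  also have "\<dots> = fact (card S) ^ card (insert i I) * exp (real u * (\<Sum>i\<in>insert i I. card (U i)) / card S)"
    using insert by (simp add: m_def exp_add[symmetric] add_divide_distrib algebra_simps)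
  finally show ?case unfolding P_def .
qed simp

section \<open>Random lifts of complete bipartite graphs\<close>

text \<open>Lifts of K_{k,k} with fibres of size l: one permutation per pair (a, b) glues the left
  fibre a to the right fibre b. Probabilities are proportions of this finite set.\<close>

definition lift_space :: "nat \<Rightarrow> nat \<Rightarrow> (nat \<times> nat \<Rightarrow> nat \<Rightarrow> nat) set" where
  "lift_space k l = PiE ({..<k} \<times> {..<k}) (\<lambda>_. {\<sigma>. \<sigma> permutes {..<l}})"

definition lift_nbhd :: "bool \<Rightarrow> nat \<Rightarrow> (nat \<times> nat \<Rightarrow> nat \<Rightarrow> nat) \<Rightarrow> (nat \<times> nat) set \<Rightarrow> (nat \<times> nat) set" where
  "lift_nbhd left k \<pi> U = (\<Union>e\<in>{..<k} \<times> {..<k}.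
     if left then {snd e} \<times> \<pi> e ` (U `` {fst e}) else {fst e} \<times> inv (\<pi> e) ` (U `` {snd e}))"

text \<open>The number of edges between U on the left and W on the right. Counting image points per
  pair of fibres puts it in the form of the moment bound for permutations.\<close>

definition lift_cut :: "nat \<Rightarrow> (nat \<times> nat \<Rightarrow> nat \<Rightarrow> nat) \<Rightarrow> (nat \<times> nat) set \<Rightarrow> (nat \<times> nat) set \<Rightarrow> nat" where
  "lift_cut k \<pi> U W = (\<Sum>e\<in>{..<k} \<times> {..<k}. card (\<pi> e ` (U `` {fst e}) \<inter> W `` {snd e}))"

lemma finite_lift_space: "finite (lift_space k l)"
  unfolding lift_space_def by (intro finite_PiE) (auto simp: finite_permutations)

lemma card_lift_space: "real (card (lift_space k l)) = fact l ^ (k * k)"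
  unfolding lift_space_def by (simp add: card_PiE card_permutations)

lemma sum_card_fibers:
  fixes U :: "(nat \<times> nat) set"
  assumes "U \<subseteq> {..<k} \<times> {..<l}"
  shows "(\<Sum>a<k. card (U `` {a})) = card U"
proof -
  have "card U = card (SIGMA a:{..<k}. U `` {a})"
    using assms by (intro arg_cong[of _ _ card]) auto
  also have "\<dots> = (\<Sum>a<k. card (U `` {a}))"
    using assms by (intro card_SigmaI) (auto intro!: finite_subset[of _ "{..<l}"])
  finally show ?thesis by simp
qed

lemma markov_card_le:
  fixes f :: "'a \<Rightarrow> real"
  assumes "finite \<Omega>" "\<And>x. x \<in> \<Omega> \<Longrightarrow> 0 \<le> f x" "(\<Sum>x\<in>\<Omega>. f x) \<le> B"
    and "\<And>x. x \<in> \<Omega> \<Longrightarrow> P x \<Longrightarrow> exp t \<le> f x"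
  shows "real (card {x\<in>\<Omega>. P x}) \<le> B * exp (- t)"
proof -
  have "real (card {x\<in>\<Omega>. P x}) * exp t = (\<Sum>x\<in>{x\<in>\<Omega>. P x}. exp t)" by simp
  also have "\<dots> \<le> (\<Sum>x\<in>{x\<in>\<Omega>. P x}. f x)" using assms by (intro sum_mono) auto
  also have "\<dots> \<le> (\<Sum>x\<in>\<Omega>. f x)" using assms by (intro sum_mono2) auto
  finally show ?thesis using assms(3) by (simp add: exp_minus field_simps)
qed

lemma exp_le_two_power:
  assumes "x \<le> real n"
  shows "exp (2 / 3 * x) \<le> 2 ^ n"
proof -
  have "2 / 3 * x \<le> 2 / 3 * real n" using assms by simp
  also have "\<dots> \<le> ln 2 * real n" using ln2_ge_two_thirds by (intro mult_right_mono) auto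
  finally have "exp (2 / 3 * x) \<le> exp (ln 2 * real n)" by simp
  also have "\<dots> = 2 ^ n" by (simp add: exp_of_nat2_mult)
  finally show ?thesis .
qed

text \<open>Origin of the constant 8/5: with ln 2 \<ge> 2/3, Markov's inequality yields the exponent
  2/3 * 8/5 = 16/15 against a moment exponent of at most 1, in units of
  \<open>\<eta> * (k * u)\<close>, so a surplus of 1/15 remains.\<close>

lemma exp_overlap_le:
  fixes u k l :: nat and \<eta> :: real
  assumes "real u \<le> \<eta> * l" "0 < l"
  shows "exp (real u * (k * u) / l) * exp (- (2 / 3 * (8 / 5 * \<eta> * (k * u)))) \<le> exp (- (\<eta> * k / 15)) ^ u"
proof -
  have "real u / l \<le> \<eta>" using assms by (simp add: field_simps)
  hence "real u / l * (k * u) \<le> \<eta> * (k * u)" by (intro mult_right_mono) auto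
  moreover have "real u * (k * u) / l = real u / l * (k * u)" "real u * (- (\<eta> * k / 15)) = - (\<eta> * (k * u)) / 15"
    by simp_all
  ultimately have "real u * (k * u) / l - 2 / 3 * (8 / 5 * \<eta> * (k * u)) \<le> real u * (- (\<eta> * k / 15))"
    by linarith
  thus ?thesis by (simp add: exp_add[symmetric] exp_of_nat_mult[symmetric])
qed

text \<open>Every vertex of U has one neighbour in each of the k opposite fibres, so a column of the
  overlap bound carries at most \<open>card U\<close> points, out of \<open>k * card U\<close> in
  total.\<close>

lemma sum_two_power_lift_nbhd_le:
  assumes "U \<subseteq> {..<k} \<times> {..<l}"
  shows "(\<Sum>\<pi>\<in>lift_space k l. 2 ^ (k * card U - card (lift_nbhd left k \<pi> U)))
    \<le> fact l ^ (k * k) * exp (real (card U) * (k * card U) / l)"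
proof -
  have sums: "(\<Sum>e\<in>{..<k} \<times> {..<k}. card (U `` {fst e})) = k * card U"
    "(\<Sum>e\<in>{..<k} \<times> {..<k}. card (U `` {snd e})) = k * card U"
    using sum_card_fibers[OF assms]
    by (simp_all add: sum.cartesian_product' mult.commute sum_distrib_left[symmetric])
  have colX: "(\<Sum>e\<in>{e \<in> {..<k} \<times> {..<k}. snd e = c}. card (U `` {fst e})) \<le> card U" for c
  proof -
    have "(\<Sum>e\<in>{e \<in> {..<k} \<times> {..<k}. snd e = c}. card (U `` {fst e})) \<le> (\<Sum>e\<in>{..<k} \<times> {c}. card (U `` {fst e}))"
      by (intro sum_mono2) auto
    also have "\<dots> = card U" using sum_card_fibers[OF assms] by (simp add: sum.cartesian_product')
    finally show ?thesis .
  qed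
  have colY: "(\<Sum>e\<in>{e \<in> {..<k} \<times> {..<k}. fst e = c}. card (U `` {snd e})) \<le> card U" for c
  proof -
    have "(\<Sum>e\<in>{e \<in> {..<k} \<times> {..<k}. fst e = c}. card (U `` {snd e})) \<le> (\<Sum>e\<in>{c} \<times> {..<k}. card (U `` {snd e}))"
      by (intro sum_mono2) auto
    also have "\<dots> = card U" using sum_card_fibers[OF assms] by (simp add: sum.cartesian_product')
    finally show ?thesis .
  qed
  show ?thesis
  proof (cases left)
    case True
    thus ?thesis
      using sum_two_power_overlap_le[of "{..<k} \<times> {..<k}" "{..<l}" "\<lambda>\<sigma>. \<sigma>" "\<lambda>e. U `` {fst e}" snd "card U",
          OF _ _ _ sum_permutes_two_power_card_le _ colX] assms sums(1)
      unfolding lift_space_def lift_nbhd_def by auto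
  next
    case False
    thus ?thesis
      using sum_two_power_overlap_le[of "{..<k} \<times> {..<k}" "{..<l}" inv "\<lambda>e. U `` {snd e}" fst "card U",
          OF _ _ permutes_inv sum_permutes_inv_two_power_card_le _ colY] assms sums(2)
      unfolding lift_space_def lift_nbhd_def by auto
  qed
qed

lemma card_bad_lift_nbhd_le:
  assumes "U \<subseteq> {..<k} \<times> {..<l}" "real (card U) \<le> \<eta> * l" "0 < l"
  shows "real (card {\<pi> \<in> lift_space k l. real (card (lift_nbhd left k \<pi> U)) < (1 - 8 / 5 * \<eta>) * (k * card U)})
    \<le> card (lift_space k l) * exp (- (\<eta> * k / 15)) ^ card U"
proof -
  have "real (card {\<pi> \<in> lift_space k l. real (card (lift_nbhd left k \<pi> U)) < (1 - 8 / 5 * \<eta>) * (k * card U)})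
    \<le> (fact l ^ (k * k) * exp (real (card U) * (k * card U) / l)) * exp (- (2 / 3 * (8 / 5 * \<eta> * (k * card U))))"
  proof (rule markov_card_le[OF finite_lift_space _ sum_two_power_lift_nbhd_le[OF assms(1)]])
    fix \<pi> assume "real (card (lift_nbhd left k \<pi> U)) < (1 - 8 / 5 * \<eta>) * (k * card U)"
    moreover have "real (k * card U) - card (lift_nbhd left k \<pi> U) \<le> real (k * card U - card (lift_nbhd left k \<pi> U))"
      by linarith
    ultimately show "exp (2 / 3 * (8 / 5 * \<eta> * (k * card U))) \<le> 2 ^ (k * card U - card (lift_nbhd left k \<pi> U))"
      by (intro exp_le_two_power) (simp add: algebra_simps)
  qed auto
  also have "\<dots> \<le> fact l ^ (k * k) * exp (- (\<eta> * k / 15)) ^ card U"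
    using exp_overlap_le[OF assms(2,3), of k] by (simp add: mult.assoc)
  finally show ?thesis by (simp add: card_lift_space)
qed

lemma sum_prod_fibers:
  fixes U W :: "(nat \<times> nat) set"
  assumes "U \<subseteq> {..<k} \<times> {..<l}" "W \<subseteq> {..<k} \<times> {..<l}"
  shows "(\<Sum>e\<in>{..<k} \<times> {..<k}. real (card (U `` {fst e})) * card (W `` {snd e})) = real (card U) * card W"
proof -
  have "(\<Sum>e\<in>{..<k} \<times> {..<k}. real (card (U `` {fst e})) * card (W `` {snd e}))
      = (\<Sum>a<k. real (card (U `` {a}))) * (\<Sum>b<k. real (card (W `` {b})))"
    by (simp add: sum.cartesian_product' sum_product)
  thus ?thesis using sum_card_fibers[OF assms(1)] sum_card_fibers[OF assms(2)]
    by (simp only: of_nat_sum[symmetric])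
qed

text \<open>The permutations are independent, so the base-2 moment of the cut factorises over pairs
  of fibres. Since 4 |U| |W| \<le> (|U| + |W|)^2, its exponent is at most half of
  \<open>\<eta> * k * s\<close>, against 2/3 * 4/5 = 8/15 of it from Markov's inequality; the
  difference is 1/30.\<close>

lemma card_bad_lift_cut_le:
  assumes "U \<subseteq> {..<k} \<times> {..<l}" "W \<subseteq> {..<k} \<times> {..<l}" "0 < l"
    and s: "real (card U + card W) \<le> \<eta> * (2 * k * l)"
  shows "real (card {\<pi> \<in> lift_space k l. 8 / 5 * \<eta> * (k * (card U + card W)) < 2 * real (lift_cut k \<pi> U W)})
    \<le> card (lift_space k l) * exp (- (\<eta> * k / 30)) ^ (card U + card W)"
proof -
  define s where "s = card U + card W"
  have "(\<Sum>\<pi>\<in>lift_space k l. (2::real) ^ lift_cut k \<pi> U W)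
      = (\<Sum>\<pi>\<in>lift_space k l. \<Prod>e\<in>{..<k} \<times> {..<k}. 2 ^ card (\<pi> e ` (U `` {fst e}) \<inter> W `` {snd e}))"
    unfolding lift_cut_def by (simp add: power_sum)
  also have "\<dots> = (\<Prod>e\<in>{..<k} \<times> {..<k}. \<Sum>\<sigma> | \<sigma> permutes {..<l}. 2 ^ card (\<sigma> ` (U `` {fst e}) \<inter> W `` {snd e}))"
    unfolding lift_space_def by (subst prod_sum_PiE) (auto simp: finite_permutations)
  also have "\<dots> \<le> (\<Prod>e\<in>{..<k} \<times> {..<k}. fact l * exp (real (card (U `` {fst e})) * card (W `` {snd e}) / l))"
    using assms(1,2)
    by (intro prod_mono conjI sum_nonneg sum_permutes_two_power_card_le[of "{..<l}", simplified]) auto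
  also have "\<dots> = fact l ^ (k * k) * exp (\<Sum>e\<in>{..<k} \<times> {..<k}. real (card (U `` {fst e})) * card (W `` {snd e}) / l)"
    by (simp add: prod.distrib exp_sum)
  also have "\<dots> = fact l ^ (k * k) * exp (real (card U) * card W / l)"
    by (simp add: sum_divide_distrib[symmetric] sum_prod_fibers[OF assms(1,2)])
  finally have sum: "(\<Sum>\<pi>\<in>lift_space k l. (2::real) ^ lift_cut k \<pi> U W) \<le> fact l ^ (k * k) * exp (real (card U) * card W / l)" .
  have "real (card {\<pi> \<in> lift_space k l. 8 / 5 * \<eta> * (k * s) < 2 * real (lift_cut k \<pi> U W)})
    \<le> (fact l ^ (k * k) * exp (real (card U) * card W / l)) * exp (- (2 / 3 * (4 / 5 * \<eta> * (k * s))))"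
  proof (rule markov_card_le[OF finite_lift_space _ sum])
    fix \<pi> assume "8 / 5 * \<eta> * (k * s) < 2 * real (lift_cut k \<pi> U W)"
    thus "exp (2 / 3 * (4 / 5 * \<eta> * (k * s))) \<le> 2 ^ lift_cut k \<pi> U W"
      by (intro exp_le_two_power) simp
  qed auto
  also have "\<dots> = fact l ^ (k * k) * exp (real (card U) * card W / l - 2 / 3 * (4 / 5 * \<eta> * (k * s)))"
    by (simp only: diff_conv_add_uminus exp_add mult.assoc)
  also have "\<dots> \<le> fact l ^ (k * k) * exp (real s * (- (\<eta> * k / 30)))"
  proof -
    have "4 * (real (card U) * card W) \<le> real s * s"
      using sum_squares_ge_zero[of "real (card U) - card W" 0] by (simp add: s_def algebra_simps)
    also have "\<dots> \<le> real s * (\<eta> * (2 * k * l))"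
      using s unfolding s_def by (intro mult_left_mono) auto
    finally have "real (card U) * card W / l \<le> \<eta> * k * s / 2"
      using assms(3) by (simp add: field_simps)
    thus ?thesis by (simp add: algebra_simps)
  qed
  finally show ?thesis by (simp only: s_def card_lift_space exp_of_nat_mult)
qed

lemma sum_pairs_power_card_le:
  fixes y :: real
  assumes "finite X" "0 \<le> y"
  shows "(\<Sum>(U, W)\<in>Pow X \<times> Pow X - {({}, {})}. y ^ (card U + card W)) \<le> exp (2 * card X * y) - 1"
proof -
  have "(\<Sum>(U, W)\<in>Pow X \<times> Pow X. y ^ (card U + card W)) = (\<Sum>U\<in>Pow X. y ^ card U) * (\<Sum>W\<in>Pow X. y ^ card W)"
    by (simp add: sum_product sum.cartesian_product power_add)
  also have "\<dots> = ((1 + y) ^ card X)\<^sup>2"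
    using assms by (simp add: sum_Pow_power_card power2_eq_square)
  also have "\<dots> \<le> (exp y ^ card X)\<^sup>2"
    using assms by (intro power_mono) (auto simp: add_nonneg_nonneg)
  also have "\<dots> = exp (2 * card X * y)"
    by (simp add: exp_of_nat_mult[symmetric] power2_eq_square exp_add[symmetric])
  finally have "(\<Sum>(U, W)\<in>Pow X \<times> Pow X. y ^ (card U + card W)) \<le> exp (2 * card X * y)" .
  moreover have "(\<Sum>(U, W)\<in>Pow X \<times> Pow X. y ^ (card U + card W))
     = 1 + (\<Sum>(U, W)\<in>Pow X \<times> Pow X - {({}, {})}. y ^ (card U + card W))"
    using assms by (subst sum.remove[of _ "({}, {})"]) auto
  ultimately show ?thesis by simp
qed

text \<open>Union bound over three failures for each \<open>\<eta>\<close>: expansion from the left,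
  expansion from the right, too many edges between the sides. The decay rates grow with
  \<open>\<eta>\<close>, so the rate of \<open>\<eta>\<^sub>0\<close> serves for all of
  them.\<close>

lemma exists_good_lift:
  fixes \<Lambda> :: "real set" and \<eta>\<^sub>0 :: real and k l :: nat
  defines "X \<equiv> {..<k} \<times> {..<l}"
  assumes "finite \<Lambda>" "0 < l" and \<eta>0: "\<And>\<eta>::real. \<eta> \<in> \<Lambda> \<Longrightarrow> \<eta>\<^sub>0 \<le> \<eta>" "0 < \<eta>\<^sub>0"
    and small: "3 * card \<Lambda> * (exp (2 * (k * l) * exp (- (\<eta>\<^sub>0 * k / 30))) - 1) < 1"
  obtains \<pi> where "\<pi> \<in> lift_space k l"
    "\<And>(\<eta>::real) U left. \<eta> \<in> \<Lambda> \<Longrightarrow> U \<subseteq> X \<Longrightarrow> real (card U) \<le> \<eta> * l \<Longrightarrow>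
       (1 - 8 / 5 * \<eta>) * (k * card U) \<le> card (lift_nbhd left k \<pi> U)"
    "\<And>(\<eta>::real) U W. \<eta> \<in> \<Lambda> \<Longrightarrow> U \<subseteq> X \<Longrightarrow> W \<subseteq> X \<Longrightarrow> real (card U + card W) \<le> \<eta> * (2 * k * l) \<Longrightarrow>
       2 * real (lift_cut k \<pi> U W) \<le> 8 / 5 * \<eta> * (k * (card U + card W))"
proof -
  define y where "y = exp (- (\<eta>\<^sub>0 * k / 30))"
  define \<Omega> where "\<Omega> = lift_space k l"
  define t where "t = exp (2 * (k * l) * y) - 1"
  have fin: "finite \<Omega>" "finite X" by (auto simp: \<Omega>_def X_def finite_lift_space)
  have y: "0 \<le> y" by (simp add: y_def)
  have ykl: "exp (card X * y) - 1 \<le> t" using y by (simp add: t_def X_def mult_right_mono)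
  have le_y: "exp (- (\<eta> * k / 15)) \<le> y" "exp (- (\<eta> * k / 30)) \<le> y" if "\<eta> \<in> \<Lambda>" for \<eta> :: real
  proof -
    have "\<eta>\<^sub>0 * k \<le> \<eta> * k" using \<eta>0(1)[OF that] by (intro mult_right_mono) auto
    moreover have "0 \<le> \<eta>\<^sub>0 * k" using \<eta>0(2) by simp
    ultimately show "exp (- (\<eta> * k / 15)) \<le> y" "exp (- (\<eta> * k / 30)) \<le> y" by (simp_all add: y_def)
  qed
  \<comment> \<open>A set above the size limit of its \<open>\<eta>\<close> gets an empty bad event,
    so the sums may run over all subsets.\<close>
  define B1 where "B1 left \<eta> U = (if real (card U) \<le> \<eta> * l
    then {\<pi> \<in> \<Omega>. real (card (lift_nbhd left k \<pi> U)) < (1 - 8 / 5 * \<eta>) * (k * card U)} else {})" for left and \<eta> :: real and U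
  define B3 where "B3 \<eta> = (\<lambda>(U, W). if real (card U + card W) \<le> \<eta> * (2 * k * l)
    then {\<pi> \<in> \<Omega>. 8 / 5 * \<eta> * (k * (card U + card W)) < 2 * real (lift_cut k \<pi> U W)} else {})" for \<eta> :: real
  define Bad where "Bad \<eta> = (\<Union>U\<in>Pow X - {{}}. B1 True \<eta> U) \<union> (\<Union>U\<in>Pow X - {{}}. B1 False \<eta> U)
    \<union> (\<Union>p\<in>Pow X \<times> Pow X - {({}, {})}. B3 \<eta> p)" for \<eta> :: real
  have Bad: "real (card (Bad \<eta>)) \<le> 3 * (card \<Omega> * t)" if \<eta>: "\<eta> \<in> \<Lambda>" for \<eta> :: real
  proof -
    have pw: "exp (- (\<eta> * k / 15)) ^ n \<le> y ^ n" "exp (- (\<eta> * k / 30)) ^ n \<le> y ^ n" for n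
      using le_y[OF \<eta>] by (auto intro!: power_mono)
    have b1: "real (card (B1 left \<eta> U)) \<le> card \<Omega> * y ^ card U" if "U \<subseteq> X" for left U
    proof (cases "real (card U) \<le> \<eta> * l")
      case True
      have "real (card (B1 left \<eta> U)) \<le> card \<Omega> * exp (- (\<eta> * k / 15)) ^ card U"
        using card_bad_lift_nbhd_le[of U k l \<eta>] that True assms(3) by (simp add: B1_def \<Omega>_def X_def)
      also have "\<dots> \<le> card \<Omega> * y ^ card U" using pw by (intro mult_left_mono) auto
      finally show ?thesis .
    qed (use y in \<open>auto simp: B1_def\<close>)
    have b3: "real (card (B3 \<eta> (U, W))) \<le> card \<Omega> * y ^ (card U + card W)" if "U \<subseteq> X" "W \<subseteq> X" for U W
    proof (cases "real (card U + card W) \<le> \<eta> * (2 * k * l)")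
      case True
      have "real (card (B3 \<eta> (U, W))) \<le> card \<Omega> * exp (- (\<eta> * k / 30)) ^ (card U + card W)"
        using card_bad_lift_cut_le[of U k l W \<eta>] that True assms(3) by (simp add: B3_def \<Omega>_def X_def)
      also have "\<dots> \<le> card \<Omega> * y ^ (card U + card W)" using pw by (intro mult_left_mono) auto
      finally show ?thesis .
    qed (use y in \<open>auto simp: B3_def\<close>)
    have 1: "real (card (\<Union>U\<in>Pow X - {{}}. B1 left \<eta> U)) \<le> card \<Omega> * t" for left
    proof -
      have "real (card (\<Union>U\<in>Pow X - {{}}. B1 left \<eta> U)) \<le> (\<Sum>U\<in>Pow X - {{}}. real (card (B1 left \<eta> U)))"
        using card_UN_le[of "Pow X - {{}}" "B1 left \<eta>"] fin unfolding of_nat_sum[symmetric] of_nat_le_iff by simp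
      also have "\<dots> \<le> (\<Sum>U\<in>Pow X - {{}}. card \<Omega> * y ^ card U)" using b1 by (intro sum_mono) auto
      also have "\<dots> \<le> card \<Omega> * t"
        using sum_nonempty_Pow_power_card_le[OF fin(2) y] ykl
        by (simp add: sum_distrib_left[symmetric] mult_left_mono)
      finally show ?thesis .
    qed
    have "real (card (\<Union>p\<in>Pow X \<times> Pow X - {({}, {})}. B3 \<eta> p)) \<le> (\<Sum>p\<in>Pow X \<times> Pow X - {({}, {})}. real (card (B3 \<eta> p)))"
      using card_UN_le[of "Pow X \<times> Pow X - {({}, {})}" "B3 \<eta>"] fin unfolding of_nat_sum[symmetric] of_nat_le_iff by simp
    also have "\<dots> \<le> (\<Sum>(U, W)\<in>Pow X \<times> Pow X - {({}, {})}. card \<Omega> * y ^ (card U + card W))"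
      using b3 by (intro sum_mono) auto
    also have "\<dots> = card \<Omega> * (\<Sum>(U, W)\<in>Pow X \<times> Pow X - {({}, {})}. y ^ (card U + card W))"
      by (simp add: sum_distrib_left case_prod_unfold)
    also have "\<dots> \<le> card \<Omega> * t"
      using sum_pairs_power_card_le[OF fin(2) y] by (intro mult_left_mono) (auto simp: t_def X_def)
    finally have 3: "real (card (\<Union>p\<in>Pow X \<times> Pow X - {({}, {})}. B3 \<eta> p)) \<le> card \<Omega> * t" .
    have "card (Bad \<eta>) \<le> card (\<Union>U\<in>Pow X - {{}}. B1 True \<eta> U) + card (\<Union>U\<in>Pow X - {{}}. B1 False \<eta> U)
      + card (\<Union>p\<in>Pow X \<times> Pow X - {({}, {})}. B3 \<eta> p)"
      unfolding Bad_def by (meson add_le_mono1 card_Un_le order_trans)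
    thus ?thesis using 1[of True] 1[of False] 3 by linarith
  qed
  have "card (\<Union>\<eta>\<in>\<Lambda>. Bad \<eta>) \<le> (\<Sum>\<eta>\<in>\<Lambda>. card (Bad \<eta>))"
    using assms(2) by (rule card_UN_le)
  hence "real (card (\<Union>\<eta>\<in>\<Lambda>. Bad \<eta>)) \<le> (\<Sum>\<eta>\<in>\<Lambda>. real (card (Bad \<eta>)))"
    unfolding of_nat_sum[symmetric] of_nat_le_iff .
  also have "\<dots> \<le> (\<Sum>\<eta>\<in>\<Lambda>. 3 * (card \<Omega> * t))" by (intro sum_mono Bad)
  also have "\<dots> = card \<Omega> * (3 * card \<Lambda> * t)" by simp
  also have "\<dots> < real (card \<Omega>) * 1"
  proof (intro mult_strict_left_mono)
    show "3 * card \<Lambda> * t < 1" using small by (simp add: t_def y_def)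
    have "real (card \<Omega>) > 0" unfolding \<Omega>_def card_lift_space by simp
    thus "real (card \<Omega>) > 0" .
  qed
  finally have "card (\<Union>\<eta>\<in>\<Lambda>. Bad \<eta>) < card \<Omega>" by simp
  moreover have "(\<Union>\<eta>\<in>\<Lambda>. Bad \<eta>) \<subseteq> \<Omega>" by (auto simp: Bad_def B1_def B3_def split: if_splits)
  ultimately obtain \<pi> where \<pi>: "\<pi> \<in> \<Omega>" "\<pi> \<notin> (\<Union>\<eta>\<in>\<Lambda>. Bad \<eta>)"
    by (metis less_irrefl subsetI subset_antisym)
  show ?thesis
  proof (rule that[of \<pi>])
    fix \<eta> :: real and U left assume *: "\<eta> \<in> \<Lambda>" "U \<subseteq> X" "real (card U) \<le> \<eta> * l"
    show "(1 - 8 / 5 * \<eta>) * (k * card U) \<le> card (lift_nbhd left k \<pi> U)"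
    proof (cases "U = {}")
      case False
      hence "\<pi> \<notin> B1 left \<eta> U" using \<pi> * by (cases left) (auto simp: Bad_def)
      thus ?thesis using * \<pi> by (auto simp: B1_def)
    qed auto
  next
    fix \<eta> :: real and U W assume *: "\<eta> \<in> \<Lambda>" "U \<subseteq> X" "W \<subseteq> X" "real (card U + card W) \<le> \<eta> * (2 * k * l)"
    show "2 * real (lift_cut k \<pi> U W) \<le> 8 / 5 * \<eta> * (k * (card U + card W))"
    proof (cases "U = {} \<and> W = {}")
      case False
      hence "\<pi> \<notin> B3 \<eta> (U, W)" using \<pi> * by (auto simp: Bad_def)
      thus ?thesis using * \<pi> by (auto simp: B3_def)
    qed (auto simp: lift_cut_def)
  qed (use \<pi> in \<open>auto simp: \<Omega>_def\<close>)
qed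

section \<open>Regular expanders obtained from lifts\<close>

definition regular_on :: "nat \<Rightarrow> 'a set \<Rightarrow> ('a \<times> 'a) set \<Rightarrow> bool" where
  "regular_on k V E \<longleftrightarrow> finite V \<and> E \<subseteq> V \<times> V \<and> sym E \<and> irrefl E \<and> (\<forall>v\<in>V. card (E `` {v}) = k)"

text \<open>The full neighbourhood is measured, including vertices of U itself; passing to the
  external one costs at most \<open>card U\<close>, that is, 1 in g.\<close>

definition vertex_expanding :: "'a set \<Rightarrow> ('a \<times> 'a) set \<Rightarrow> real \<Rightarrow> real \<Rightarrow> bool" where
  "vertex_expanding V E s g \<longleftrightarrow> (\<forall>U\<subseteq>V. real (card U) \<le> s \<longrightarrow> g * card U \<le> card (E `` U))"

definition edge_expanding :: "'a set \<Rightarrow> ('a \<times> 'a) set \<Rightarrow> real \<Rightarrow> real \<Rightarrow> bool" where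
  "edge_expanding V E s g \<longleftrightarrow> (\<forall>U\<subseteq>V. real (card U) \<le> s \<longrightarrow> g * card U \<le> card (E \<inter> U \<times> (V - U)))"

definition lift_edges :: "nat \<Rightarrow> nat \<Rightarrow> (nat \<times> nat \<Rightarrow> nat \<Rightarrow> nat) \<Rightarrow> (nat \<times> nat + nat \<times> nat) rel" where
  "lift_edges k l \<pi> = (let A = {(Inl (a, i), Inr (b, \<pi> (a, b) i)) |a b i. a < k \<and> b < k \<and> i < l} in A \<union> A\<inverse>)"

lemma card_arcs_eq_sum_degrees:
  assumes "finite E" "finite U"
  shows "card (E \<inter> U \<times> UNIV) = (\<Sum>u\<in>U. card (E `` {u}))"
proof -
  have "card (E \<inter> U \<times> UNIV) = card (SIGMA u:U. E `` {u})"
    by (intro arg_cong[of _ _ card]) auto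
  also have "\<dots> = (\<Sum>u\<in>U. card (E `` {u}))"
    using assms by (intro card_SigmaI) (auto intro: finite_Image)
  finally show ?thesis .
qed

context
  fixes k l :: nat and \<pi> :: "nat \<times> nat \<Rightarrow> nat \<Rightarrow> nat"
  assumes \<pi>: "\<pi> \<in> lift_space k l"
begin

lemma lift_permutes: "a < k \<Longrightarrow> b < k \<Longrightarrow> \<pi> (a, b) permutes {..<l}"
  using \<pi> by (auto simp: lift_space_def)

lemma lift_edges_Image_Inl:
  assumes "a < k" "i < l"
  shows "lift_edges k l \<pi> `` {Inl (a, i)} = Inr ` (\<lambda>b. (b, \<pi> (a, b) i)) ` {..<k}"
  using assms by (auto simp: lift_edges_def Let_def)

lemma lift_edges_Image_Inr:
  assumes "b < k" "j < l"
  shows "lift_edges k l \<pi> `` {Inr (b, j)} = Inl ` (\<lambda>a. (a, inv (\<pi> (a, b)) j)) ` {..<k}"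
proof -
  have "inv (\<pi> (a, b)) j < l \<and> \<pi> (a, b) (inv (\<pi> (a, b)) j) = j \<and> (\<forall>i. inv (\<pi> (a, b)) (\<pi> (a, b) i) = i)" if "a < k" for a
    using lift_permutes[OF that assms(1)] assms(2)
    by (metis permutes_inv permutes_in_image permutes_inverses lessThan_iff)
  thus ?thesis using assms
    by (auto simp: lift_edges_def Let_def image_iff)
qed

lemma lift_edges_Image:
  assumes "A \<subseteq> {..<k} \<times> {..<l}" "B \<subseteq> {..<k} \<times> {..<l}"
  shows "lift_edges k l \<pi> `` (Inl ` A \<union> Inr ` B) = Inl ` lift_nbhd False k \<pi> B \<union> Inr ` lift_nbhd True k \<pi> A"
proof -
  have "lift_edges k l \<pi> `` (Inl ` A) = (\<Union>(a, i)\<in>A. lift_edges k l \<pi> `` {Inl (a, i)})" by auto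
  also have "\<dots> = (\<Union>(a, i)\<in>A. Inr ` (\<lambda>b. (b, \<pi> (a, b) i)) ` {..<k})"
    using assms by (intro SUP_cong refl, unfold split_paired_all case_prod_conv, intro lift_edges_Image_Inl) auto
  also have "\<dots> = Inr ` lift_nbhd True k \<pi> A"
    using assms unfolding lift_nbhd_def by fastforce
  finally have 1: "lift_edges k l \<pi> `` (Inl ` A) = Inr ` lift_nbhd True k \<pi> A" .
  have "lift_edges k l \<pi> `` (Inr ` B) = (\<Union>(b, i)\<in>B. lift_edges k l \<pi> `` {Inr (b, i)})" by auto
  also have "\<dots> = (\<Union>(b, i)\<in>B. Inl ` (\<lambda>a. (a, inv (\<pi> (a, b)) i)) ` {..<k})"
    using assms by (intro SUP_cong refl, unfold split_paired_all case_prod_conv, intro lift_edges_Image_Inr) auto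
  also have "\<dots> = Inl ` lift_nbhd False k \<pi> B"
    using assms unfolding lift_nbhd_def by fastforce
  finally show ?thesis using 1 by (simp add: Image_Un Un_commute)
qed

lemma regular_on_lift_edges:
  "regular_on k (({..<k} \<times> {..<l}) <+> ({..<k} \<times> {..<l})) (lift_edges k l \<pi>)"
  unfolding regular_on_def
proof (intro conjI ballI)
  show "lift_edges k l \<pi> \<subseteq> (({..<k} \<times> {..<l}) <+> ({..<k} \<times> {..<l})) \<times> (({..<k} \<times> {..<l}) <+> ({..<k} \<times> {..<l}))"
    using lift_permutes by (auto simp: lift_edges_def Let_def permutes_in_image[of _ "{..<l}", simplified] )
  fix v assume "v \<in> ({..<k} \<times> {..<l}) <+> ({..<k} \<times> {..<l})"
  thus "card (lift_edges k l \<pi> `` {v}) = k"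
    by (auto simp: lift_edges_Image_Inl lift_edges_Image_Inr card_image inj_on_def image_image)
qed (auto simp: lift_edges_def Let_def sym_def irrefl_def)

text \<open>The sum type separates the two sides, so the inner arcs are the left-to-right ones and
  their converses, which accounts for the factor 2.\<close>

lemma card_lift_edges_between:
  assumes "A \<subseteq> {..<k} \<times> {..<l}" "B \<subseteq> {..<k} \<times> {..<l}"
  shows "card (lift_edges k l \<pi> \<inter> (Inl ` A \<union> Inr ` B) \<times> (Inl ` A \<union> Inr ` B)) = 2 * lift_cut k \<pi> A B"
proof -
  define E1 where "E1 = lift_edges k l \<pi> \<inter> Inl ` A \<times> Inr ` B"
  define f where "f = (\<lambda>((a, b), i). (Inl (a, i) :: nat \<times> nat + nat \<times> nat, Inr (b, \<pi> (a, b) i) :: nat \<times> nat + nat \<times> nat))"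
  define D where "D = (SIGMA e:{..<k} \<times> {..<k}. {i \<in> A `` {fst e}. \<pi> e i \<in> B `` {snd e}})"
  have finA: "finite (A `` {x})" for x
    using assms by (auto intro!: finite_subset[of _ "{..<l}"])
  have finF: "finite {i \<in> A `` {x}. P i}" for x P
    using finA[of x] by (rule finite_subset[rotated]) auto
  have E1: "E1 = f ` D"
    using assms unfolding E1_def f_def D_def lift_edges_def Let_def
    by (auto simp: image_iff; fastforce)
  have finD: "finite D" unfolding D_def using finF by (intro finite_SigmaI) blast+
  have "card E1 = card D"
    unfolding E1 by (rule card_image) (auto simp: inj_on_def f_def)
  also have "\<dots> = (\<Sum>e\<in>{..<k} \<times> {..<k}. card {i \<in> A `` {fst e}. \<pi> e i \<in> B `` {snd e}})"
    unfolding D_def by (intro card_SigmaI ballI finF finite_cartesian_product finite_lessThan)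
  also have "\<dots> = lift_cut k \<pi> A B"
    unfolding lift_cut_def
  proof (intro sum.cong refl)
    fix e assume "e \<in> {..<k} \<times> {..<k}"
    hence inj: "inj (\<pi> e)" using lift_permutes by (cases e) (auto dest: permutes_inj)
    have eq: "\<pi> e ` (A `` {fst e}) \<inter> B `` {snd e} = \<pi> e ` {i \<in> A `` {fst e}. \<pi> e i \<in> B `` {snd e}}" by auto
    show "card {i \<in> A `` {fst e}. \<pi> e i \<in> B `` {snd e}} = card (\<pi> e ` (A `` {fst e}) \<inter> B `` {snd e})"
      unfolding eq by (rule card_image[symmetric, OF inj_on_subset[OF inj]]) simp
  qed
  finally have c1: "card E1 = lift_cut k \<pi> A B" .
  have "lift_edges k l \<pi> \<inter> (Inl ` A \<union> Inr ` B) \<times> (Inl ` A \<union> Inr ` B) = E1 \<union> E1\<inverse>"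
    unfolding E1_def by (auto simp: lift_edges_def Let_def)
  moreover have "card (E1 \<union> E1\<inverse>) = card E1 + card (E1\<inverse>)"
    using finD by (intro card_Un_disjoint) (auto simp: E1 f_def)
  ultimately show ?thesis using c1 by simp
qed

end

text \<open>Degree sum over U. It turns the upper bound on the edges inside a set of a lift into
  edge expansion.\<close>

lemma card_edge_boundary:
  assumes "regular_on k V E" "U \<subseteq> V"
  shows "k * card U = card (E \<inter> U \<times> (V - U)) + card (E \<inter> U \<times> U)"
proof -
  have E: "finite V" "E \<subseteq> V \<times> V" "\<And>v. v \<in> V \<Longrightarrow> card (E `` {v}) = k"
    using assms by (auto simp: regular_on_def)
  have fin: "finite E" "finite U" using E assms finite_subset by blast+
  have "k * card U = card (E \<inter> U \<times> UNIV)"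
    using card_arcs_eq_sum_degrees[OF fin] E(3) assms(2) by (simp add: subset_iff)
  also have "E \<inter> U \<times> UNIV = (E \<inter> U \<times> (V - U)) \<union> (E \<inter> U \<times> U)" using E by auto
  also have "card \<dots> = card (E \<inter> U \<times> (V - U)) + card (E \<inter> U \<times> U)"
    using fin by (intro card_Un_disjoint) auto
  finally show ?thesis .
qed

section \<open>Transport of regularity and expansion along injections\<close>

lemma Image_map_prod:
  assumes "inj_on f V" "E \<subseteq> V \<times> V" "U \<subseteq> V"
  shows "(map_prod f f ` E) `` (f ` U) = f ` (E `` U)"
proof (intro equalityI subsetI)
  fix w assume "w \<in> (map_prod f f ` E) `` (f ` U)"
  then obtain x z u where *: "(x, z) \<in> E" "w = f z" "u \<in> U" "f x = f u" by auto
  hence "x = u" using assms by (auto dest: inj_onD)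
  thus "w \<in> f ` (E `` U)" using * by auto
next
  fix w assume "w \<in> f ` (E `` U)"
  then obtain u z where *: "(u, z) \<in> E" "u \<in> U" "w = f z" by auto
  have "(f u, f z) \<in> map_prod f f ` E" using *(1) by (intro image_eqI[of _ _ "(u, z)"]) auto
  thus "w \<in> (map_prod f f ` E) `` (f ` U)" using * by blast
qed

lemma regular_on_image:
  assumes "inj_on f V" "regular_on k V E"
  shows "regular_on k (f ` V) (map_prod f f ` E)"
proof -
  have E: "E \<subseteq> V \<times> V" "irrefl E" "sym E" using assms by (auto simp: regular_on_def)
  have "card ((map_prod f f ` E) `` {f v}) = k" if "v \<in> V" for v
  proof -
    have "(map_prod f f ` E) `` {f v} = f ` (E `` {v})"
      using Image_map_prod[OF assms(1) E(1), of "{v}"] that by simp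
    moreover have "inj_on f (E `` {v})" using assms(1) E(1) by (auto intro: inj_on_subset)
    ultimately show ?thesis using assms that by (simp add: card_image regular_on_def)
  qed
  moreover have "irrefl (map_prod f f ` E)"
    using E(1,2) assms(1) by (auto simp: irrefl_def dest: inj_onD)
  moreover have "sym (map_prod f f ` E)"
    using E(3) by (force simp: sym_def)
  ultimately show ?thesis using assms by (auto simp: regular_on_def)
qed

lemma vertex_expanding_image:
  assumes "inj_on f V" "E \<subseteq> V \<times> V" "vertex_expanding V E s g"
  shows "vertex_expanding (f ` V) (map_prod f f ` E) s g"
  unfolding vertex_expanding_def
proof (intro allI impI)
  fix U assume U: "U \<subseteq> f ` V" "real (card U) \<le> s"
  then obtain U' where U': "U' \<subseteq> V" "U = f ` U'" by (auto simp: subset_image_iff)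
  have "card U = card U'" "card (f ` (E `` U')) = card (E `` U')"
    using U' assms(1,2) by (auto intro!: card_image intro: inj_on_subset)
  thus "g * card U \<le> card ((map_prod f f ` E) `` U)"
    using assms(3) U U' Image_map_prod[OF assms(1,2) U'(1)] by (simp add: vertex_expanding_def)
qed

lemma edge_expanding_image:
  assumes "inj_on f V" "E \<subseteq> V \<times> V" "edge_expanding V E s g"
  shows "edge_expanding (f ` V) (map_prod f f ` E) s g"
  unfolding edge_expanding_def
proof (intro allI impI)
  fix U assume U: "U \<subseteq> f ` V" "real (card U) \<le> s"
  then obtain U' where U': "U' \<subseteq> V" "U = f ` U'" by (auto simp: subset_image_iff)
  have "(map_prod f f ` E) \<inter> f ` U' \<times> (f ` V - f ` U') = map_prod f f ` (E \<inter> U' \<times> (V - U'))"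
  proof -
    have *: "f x \<in> f ` U' \<longleftrightarrow> x \<in> U'" if "x \<in> V" for x
      using assms(1) U'(1) that by (auto dest: inj_onD)
    show ?thesis
    proof (intro equalityI subsetI)
      fix p assume p: "p \<in> (map_prod f f ` E) \<inter> f ` U' \<times> (f ` V - f ` U')"
      then obtain x y where xy: "(x, y) \<in> E" "p = (f x, f y)" by auto
      hence "x \<in> V" "y \<in> V" using assms(2) by auto
      hence "(x, y) \<in> E \<inter> U' \<times> (V - U')" using p xy * by auto
      thus "p \<in> map_prod f f ` (E \<inter> U' \<times> (V - U'))" using xy(2) by (intro image_eqI[of _ _ "(x, y)"]) auto
    next
      fix p assume "p \<in> map_prod f f ` (E \<inter> U' \<times> (V - U'))"
      then obtain x y where xy: "(x, y) \<in> E" "x \<in> U'" "y \<in> V - U'" "p = (f x, f y)" by auto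
      have "p \<in> map_prod f f ` E" using xy by (intro image_eqI[of _ _ "(x, y)"]) auto
      thus "p \<in> (map_prod f f ` E) \<inter> f ` U' \<times> (f ` V - f ` U')" using xy * by auto
    qed
  qed
  moreover have "inj_on (map_prod f f) (V \<times> V)" using assms(1) by (intro map_prod_inj_on)
  hence "card (map_prod f f ` (E \<inter> U' \<times> (V - U'))) = card (E \<inter> U' \<times> (V - U'))"
    using assms(2) by (intro card_image) (auto intro: inj_on_subset)
  moreover have "card U = card U'"
    using U' assms(1) by (auto intro!: card_image intro: inj_on_subset)
  ultimately show "g * card U \<le> card ((map_prod f f ` E) \<inter> U \<times> (f ` V - U))"
    using assms(3) U U' by (simp add: edge_expanding_def)
qed

text \<open>The halves of a set on the two sides have neighbourhoods on opposite sides, so these are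
  disjoint and the two one-sided expansion bounds add. Edge expansion is the degree sum minus the
  arcs inside, which the cut bound controls.\<close>

lemma exists_expander:
  fixes \<Lambda> :: "real set" and \<eta>\<^sub>0 :: real and k l :: nat
  assumes "finite \<Lambda>" "0 < l" "\<And>\<eta>::real. \<eta> \<in> \<Lambda> \<Longrightarrow> \<eta>\<^sub>0 \<le> \<eta>" "0 < \<eta>\<^sub>0"
    and "3 * card \<Lambda> * (exp (2 * (k * l) * exp (- (\<eta>\<^sub>0 * k / 30))) - 1) < 1"
  obtains E where "regular_on k {..<2 * k * l} E"
    "\<And>\<eta>::real. \<eta> \<in> \<Lambda> \<Longrightarrow> vertex_expanding {..<2 * k * l} E (\<eta> * l) ((1 - 8 / 5 * \<eta>) * k)"
    "\<And>\<eta>::real. \<eta> \<in> \<Lambda> \<Longrightarrow> edge_expanding {..<2 * k * l} E (\<eta> * (2 * k * l)) ((1 - 8 / 5 * \<eta>) * k)"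
proof -
  obtain \<pi> where \<pi>: "\<pi> \<in> lift_space k l"
    "\<And>(\<eta>::real) U left. \<eta> \<in> \<Lambda> \<Longrightarrow> U \<subseteq> {..<k} \<times> {..<l} \<Longrightarrow> real (card U) \<le> \<eta> * l \<Longrightarrow>
       (1 - 8 / 5 * \<eta>) * (k * card U) \<le> card (lift_nbhd left k \<pi> U)"
    "\<And>(\<eta>::real) U W. \<eta> \<in> \<Lambda> \<Longrightarrow> U \<subseteq> {..<k} \<times> {..<l} \<Longrightarrow> W \<subseteq> {..<k} \<times> {..<l} \<Longrightarrow>
       real (card U + card W) \<le> \<eta> * (2 * k * l) \<Longrightarrow>
       2 * real (lift_cut k \<pi> U W) \<le> 8 / 5 * \<eta> * (k * (card U + card W))"
    using exists_good_lift[OF assms] by blast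
  define X where "X = {..<k} \<times> {..<l}"
  define V where "V = X <+> X"
  define E where "E = lift_edges k l \<pi>"
  have reg: "regular_on k V E" using regular_on_lift_edges[OF \<pi>(1)] by (simp add: V_def E_def X_def)
  have split: "\<exists>A B. A \<subseteq> X \<and> B \<subseteq> X \<and> U = Inl ` A \<union> Inr ` B \<and> card U = card A + card B" if "U \<subseteq> V" for U
  proof (intro exI conjI)
    show *: "U = Inl ` (Inl -` U) \<union> Inr ` (Inr -` U)"
      using that by (auto simp: V_def Plus_def)
    show "Inl -` U \<subseteq> X" "Inr -` U \<subseteq> X" using that by (auto simp: V_def)
    moreover have "finite X" by (simp add: X_def)
    ultimately have fin: "finite (Inl -` U)" "finite (Inr -` U)" by (auto dest: finite_subset)
    have "card (Inl ` A \<union> Inr ` B) = card A + card B" if "finite A" "finite B" for A B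
      using that by (subst card_Un_disjoint) (auto simp: card_image)
    hence "card (Inl ` (Inl -` U) \<union> Inr ` (Inr -` U)) = card (Inl -` U) + card (Inr -` U)"
      using fin by blast
    thus "card U = card (Inl -` U) + card (Inr -` U)" using * by simp
  qed
  have vexp: "vertex_expanding V E (\<eta> * l) ((1 - 8 / 5 * \<eta>) * k)" if \<eta>: "\<eta> \<in> \<Lambda>" for \<eta> :: real
    unfolding vertex_expanding_def
  proof (intro allI impI)
    fix U assume U: "U \<subseteq> V" "real (card U) \<le> \<eta> * l"
    obtain A B where AB: "A \<subseteq> X" "B \<subseteq> X" "U = Inl ` A \<union> Inr ` B" "card U = card A + card B"
      using split[OF U(1)] by blast
    have fin: "finite (E `` U)"
      using reg by (intro finite_subset[of "E `` U" V]) (auto simp: regular_on_def)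
    have Im: "E `` U = Inl ` lift_nbhd False k \<pi> B \<union> Inr ` lift_nbhd True k \<pi> A"
      using lift_edges_Image[OF \<pi>(1)] AB by (simp add: E_def X_def)
    have "finite (lift_nbhd False k \<pi> B)" "finite (lift_nbhd True k \<pi> A)"
      using fin unfolding Im by (auto dest: finite_imageD)
    hence "card (E `` U) = card (lift_nbhd False k \<pi> B) + card (lift_nbhd True k \<pi> A)"
      unfolding Im by (subst card_Un_disjoint) (auto simp: card_image)
    moreover have "(1 - 8 / 5 * \<eta>) * (k * card A) \<le> card (lift_nbhd True k \<pi> A)"
      using \<pi>(2)[OF \<eta>, of A] AB U by (simp add: X_def)
    moreover have "(1 - 8 / 5 * \<eta>) * (k * card B) \<le> card (lift_nbhd False k \<pi> B)"
      using \<pi>(2)[OF \<eta>, of B] AB U by (simp add: X_def)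
    ultimately show "(1 - 8 / 5 * \<eta>) * k * card U \<le> card (E `` U)"
      using AB(4) by (simp add: algebra_simps add_divide_distrib)
  qed
  have eexp: "edge_expanding V E (\<eta> * (2 * k * l)) ((1 - 8 / 5 * \<eta>) * k)" if \<eta>: "\<eta> \<in> \<Lambda>" for \<eta> :: real
    unfolding edge_expanding_def
  proof (intro allI impI)
    fix U assume U: "U \<subseteq> V" "real (card U) \<le> \<eta> * (2 * k * l)"
    obtain A B where AB: "A \<subseteq> X" "B \<subseteq> X" "U = Inl ` A \<union> Inr ` B" "card U = card A + card B"
      using split[OF U(1)] by blast
    have "card (E \<inter> U \<times> U) = 2 * lift_cut k \<pi> A B"
      using card_lift_edges_between[OF \<pi>(1)] AB by (simp add: E_def X_def)
    moreover have "2 * real (lift_cut k \<pi> A B) \<le> 8 / 5 * \<eta> * (k * (card A + card B))"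
      using AB U by (intro \<pi>(3) \<eta>) (auto simp: X_def)
    moreover have "real (k * card U) = card (E \<inter> U \<times> (V - U)) + real (card (E \<inter> U \<times> U))"
      using card_edge_boundary[OF reg U(1)] by simp
    ultimately show "(1 - 8 / 5 * \<eta>) * k * card U \<le> card (E \<inter> U \<times> (V - U))"
      using AB(4) by (simp add: algebra_simps add_divide_distrib)
  qed
  have "finite V" "card V = 2 * k * l" by (auto simp: V_def X_def card_Plus)
  then obtain f where f: "bij_betw f V {..<2 * k * l}"
    by (metis bij_betw_iff_card card_lessThan finite_lessThan)
  hence inj: "inj_on f V" and img: "f ` V = {..<2 * k * l}" by (auto simp: bij_betw_def)
  have sub: "E \<subseteq> V \<times> V" using reg by (simp add: regular_on_def)
  show ?thesis
    by (rule that[of "map_prod f f ` E"])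
      (use regular_on_image[OF inj reg] vertex_expanding_image[OF inj sub vexp]
         edge_expanding_image[OF inj sub eexp] img in auto)
qed

section \<open>Percolation and branching processes\<close>

text \<open>The expectation of f over the random subset, written as a finite weighted sum so that
  vertices can be revealed one at a time by induction; \<open>prob_random_subset_pmf\<close> links
  it to the measure in the theorem.\<close>

definition perc :: "real \<Rightarrow> 'a set \<Rightarrow> ('a set \<Rightarrow> real) \<Rightarrow> real" where
  "perc p V f = (\<Sum>W\<in>Pow V. p ^ card W * (1 - p) ^ card (V - W) * f W)"

lemma perc_empty [simp]: "perc p {} f = f {}"
  by (simp add: perc_def)

lemma perc_cong: "(\<And>W. W \<subseteq> V \<Longrightarrow> f W = g W) \<Longrightarrow> perc p V f = perc p V g"
  by (simp add: perc_def)

lemma perc_insert: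
  assumes "finite V" "v \<notin> V"
  shows "perc p (insert v V) f = p * perc p V (\<lambda>W. f (insert v W)) + (1 - p) * perc p V f"
proof -
  have "perc p (insert v V) f = (\<Sum>W\<in>Pow V. p ^ card W * (1 - p) ^ card (insert v V - W) * f W)
    + (\<Sum>W\<in>insert v ` Pow V. p ^ card W * (1 - p) ^ card (insert v V - W) * f W)"
    unfolding Pow_insert perc_def using assms by (intro sum.union_disjoint) auto
  also have "(\<Sum>W\<in>Pow V. p ^ card W * (1 - p) ^ card (insert v V - W) * f W) = (1 - p) * perc p V f"
    unfolding perc_def sum_distrib_left
  proof (intro sum.cong refl)
    fix W assume W: "W \<in> Pow V"
    hence "insert v V - W = insert v (V - W)" using assms by auto
    hence "card (insert v V - W) = Suc (card (V - W))" using assms W by (simp add: card_insert_if)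
    thus "p ^ card W * (1 - p) ^ card (insert v V - W) * f W = (1 - p) * (p ^ card W * (1 - p) ^ card (V - W) * f W)"
      by simp
  qed
  also have "(\<Sum>W\<in>insert v ` Pow V. p ^ card W * (1 - p) ^ card (insert v V - W) * f W)
    = (\<Sum>W\<in>Pow V. p ^ card (insert v W) * (1 - p) ^ card (insert v V - insert v W) * f (insert v W))"
    using assms by (subst sum.reindex) (auto simp: inj_on_def)
  also have "\<dots> = p * perc p V (\<lambda>W. f (insert v W))"
    unfolding perc_def sum_distrib_left
  proof (intro sum.cong refl)
    fix W assume W: "W \<in> Pow V"
    hence "insert v V - insert v W = V - W" using assms by auto
    moreover have "card (insert v W) = Suc (card W)"
      using assms W by (subst card_insert_disjoint) (auto dest: finite_subset)
    ultimately show "p ^ card (insert v W) * (1 - p) ^ card (insert v V - insert v W) * f (insert v W)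
      = p * (p ^ card W * (1 - p) ^ card (V - W) * f (insert v W))" by simp
  qed
  finally show ?thesis by simp
qed

text \<open>Fubini for independent coordinates; the exposure arguments below reveal one block of
  vertices after the other by it.\<close>

lemma perc_Un:
  assumes "finite A" "finite B" "A \<inter> B = {}"
  shows "perc p (A \<union> B) f = perc p A (\<lambda>X. perc p B (\<lambda>Y. f (X \<union> Y)))"
  using assms(1,3)
proof (induction A arbitrary: f rule: finite_induct)
  case (insert v A)
  thus ?case using assms(2) by (simp add: perc_insert)
qed simp

lemma perc_mono:
  assumes "0 \<le> p" "p \<le> 1" "\<And>W. W \<subseteq> V \<Longrightarrow> f W \<le> g W"
  shows "perc p V f \<le> perc p V g"
  unfolding perc_def using assms by (intro sum_mono mult_left_mono) auto

lemma perc_add: "perc p V (\<lambda>W. f W + g W) = perc p V f + perc p V g"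
  by (simp add: perc_def algebra_simps sum.distrib)

lemma perc_diff: "perc p V (\<lambda>W. f W - g W) = perc p V f - perc p V g"
  by (simp add: perc_def algebra_simps sum_subtractf)

lemma perc_cmult: "perc p V (\<lambda>W. c * f W) = c * perc p V f"
  by (simp add: perc_def sum_distrib_left algebra_simps)

lemma perc_sum: "perc p V (\<lambda>W. \<Sum>i\<in>I. f i W) = (\<Sum>i\<in>I. perc p V (f i))"
  by (induction I rule: infinite_finite_induct) (auto simp: perc_add, auto simp: perc_def)

lemma perc_const [simp]: "finite V \<Longrightarrow> perc p V (\<lambda>_. c) = c"
  by (induction V rule: finite_induct) (auto simp: perc_insert algebra_simps)

lemma perc_nonneg: "0 \<le> p \<Longrightarrow> p \<le> 1 \<Longrightarrow> (\<And>W. W \<subseteq> V \<Longrightarrow> 0 \<le> f W) \<Longrightarrow> 0 \<le> perc p V f"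
  unfolding perc_def by (intro sum_nonneg) auto

lemma perc_disjoint:
  assumes "finite N"
  shows "perc p N (\<lambda>W. of_bool (W = {})) = (1 - p) ^ card N"
proof -
  have "perc p N (\<lambda>W. of_bool (W = {})) = (\<Sum>W\<in>{{}}. p ^ card W * (1 - p) ^ card (N - W) * of_bool (W = {}))"
    unfolding perc_def using assms by (intro sum.mono_neutral_right) auto
  thus ?thesis by simp
qed

section \<open>Means under Bin(n, p) and walks with binomial steps\<close>

primrec bin_mean :: "real \<Rightarrow> nat \<Rightarrow> (nat \<Rightarrow> real) \<Rightarrow> real" where
  "bin_mean p 0 F = F 0"
| "bin_mean p (Suc n) F = p * bin_mean p n (\<lambda>m. F (Suc m)) + (1 - p) * bin_mean p n F"

lemma perc_card_eq_bin_mean: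
  assumes "finite V"
  shows "perc p V (\<lambda>W. F (card W)) = bin_mean p (card V) F"
  using assms
proof (induction V arbitrary: F rule: finite_induct)
  case (insert v V)
  have "perc p V (\<lambda>W. F (card (insert v W))) = perc p V (\<lambda>W. F (Suc (card W)))"
  proof (rule perc_cong)
    fix W assume "W \<subseteq> V"
    hence "finite W" "v \<notin> W" using insert finite_subset by auto
    thus "F (card (insert v W)) = F (Suc (card W))" by simp
  qed
  thus ?case using insert insert.IH[of "\<lambda>m. F (Suc m)"] by (simp add: perc_insert)
qed simp

lemma bin_mean_mono:
  assumes "0 \<le> p" "p \<le> 1" "\<And>m. F m \<le> G m"
  shows "bin_mean p n F \<le> bin_mean p n G"
  using assms(3) by (induction n arbitrary: F G) (auto intro!: add_mono mult_left_mono simp: assms)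

text \<open>Conditioning on one extra trial: whatever its outcome, an increasing F cannot
  drop.\<close>

lemma bin_mean_mono_trials:
  assumes "0 \<le> p" "p \<le> 1" "mono F" "n \<le> m"
  shows "bin_mean p n F \<le> bin_mean p m F"
  using assms(4)
proof (induction m rule: dec_induct)
  case (step m)
  have "bin_mean p m F \<le> bin_mean p m (\<lambda>i. F (Suc i))"
    using assms by (intro bin_mean_mono) (auto intro: monoD)
  hence "p * bin_mean p m F \<le> p * bin_mean p m (\<lambda>i. F (Suc i))"
    using assms by (intro mult_left_mono) auto
  thus ?case using step by (simp add: algebra_simps)
qed simp

lemma bin_mean_add: "bin_mean p n (\<lambda>m. F m + G m) = bin_mean p n F + bin_mean p n G"
  by (induction n arbitrary: F G) (auto simp: algebra_simps)

lemma bin_mean_cmult: "bin_mean p n (\<lambda>m. c * F m) = c * bin_mean p n F"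
  by (induction n arbitrary: F) (auto simp: algebra_simps)

lemma bin_mean_power: "bin_mean p n (\<lambda>m. z ^ m) = (1 - p + p * z) ^ n"
  by (induction n) (auto simp: bin_mean_cmult algebra_simps)

lemma bin_mean_const: "bin_mean p n (\<lambda>m. c) = c"
  by (induction n) (auto simp: algebra_simps)

text \<open>The probability that the walk with steps Bin(d, p) - 1 from x is positive at the times
  0, ..., k - 1; in branching terms, that x individuals have total progeny at least k, themselves
  included.\<close>

primrec survival :: "real \<Rightarrow> nat \<Rightarrow> nat \<Rightarrow> nat \<Rightarrow> real" where
  "survival p d 0 x = 1"
| "survival p d (Suc k) x = (case x of 0 \<Rightarrow> 0 | Suc y \<Rightarrow> bin_mean p d (\<lambda>m. survival p d k (y + m)))"

lemma bin_mean_nonneg: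
  assumes "0 \<le> p" "p \<le> 1" "\<And>m. 0 \<le> F m"
  shows "0 \<le> bin_mean p n F"
  using bin_mean_mono[OF assms(1,2), of "\<lambda>_. 0" F n] assms(3) by (simp add: bin_mean_const)

lemma survival_nonneg:
  assumes "0 \<le> p" "p \<le> 1"
  shows "0 \<le> survival p d k x"
  by (induction k arbitrary: x) (auto split: nat.split intro!: bin_mean_nonneg assms)

lemma mono_survival:
  assumes "0 \<le> p" "p \<le> 1"
  shows "mono (survival p d k)"
proof (induction k)
  case (Suc k)
  show ?case
  proof (rule monoI)
    fix x y :: nat assume "x \<le> y"
    thus "survival p d (Suc k) x \<le> survival p d (Suc k) y"
      using assms survival_nonneg[OF assms] Suc
      by (auto split: nat.split intro!: bin_mean_nonneg bin_mean_mono monoD[OF Suc])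
  qed
qed (auto intro!: monoI)

text \<open>\<open>1 - s ^ x\<close> is a supermartingale of the walk with steps \<open>Bin(d, p) - 1\<close>, and \<open>r ^ x\<close> decays at rate \<open>\<theta>\<close>.\<close>
lemma survival_le:
  assumes p: "0 \<le> p" "p \<le> 1" and s: "0 \<le> s" "s \<le> r" "0 < r" and \<theta>: "0 \<le> \<theta>"
    and gs: "s \<le> (1 - p + p * s) ^ d" and gr: "(1 - p + p * r) ^ d \<le> \<theta> * r"
  shows "survival p d k x \<le> 1 - s ^ x + \<theta> ^ k * r ^ x"
proof (induction k arbitrary: x)
  case 0
  show ?case using s by (auto intro: power_mono)
next
  case (Suc k)
  show ?case
  proof (cases x)
    case 0
    thus ?thesis using \<theta> by simp
  next
    case (Suc y)
    have "survival p d (Suc k) x = bin_mean p d (\<lambda>m. survival p d k (y + m))" using Suc by simp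
    also have "\<dots> \<le> bin_mean p d (\<lambda>m. (1 + (- (s ^ y)) * s ^ m) + (\<theta> ^ k * r ^ y) * r ^ m)"
    proof (intro bin_mean_mono p)
      fix m show "survival p d k (y + m) \<le> (1 + (- (s ^ y)) * s ^ m) + (\<theta> ^ k * r ^ y) * r ^ m"
        using Suc.IH[of "y + m"] by (simp add: power_add mult.assoc)
    qed
    also have "\<dots> = 1 - s ^ y * (1 - p + p * s) ^ d + \<theta> ^ k * r ^ y * (1 - p + p * r) ^ d"
      by (simp only: bin_mean_add bin_mean_cmult bin_mean_power bin_mean_const)
    also have "\<dots> \<le> 1 - s ^ y * s + \<theta> ^ k * r ^ y * (\<theta> * r)"
      using gs gr s \<theta> by (intro add_mono diff_mono mult_left_mono) auto
    finally show ?thesis using Suc by (simp add: mult_ac)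
  qed
qed

text \<open>R is treated as open whether or not it lies in W. An exploration can thus keep its
  revealed frontier in R and let W range over the vertices not yet revealed; for v in W and R = {v}
  this is the component of v.\<close>

definition reach :: "('a \<times> 'a) set \<Rightarrow> 'a set \<Rightarrow> 'a set \<Rightarrow> 'a set" where
  "reach E R W = (E \<inter> (R \<union> W) \<times> (R \<union> W))\<^sup>* `` R"

lemma reach_subset: "reach E R W \<subseteq> R \<union> W"
proof
  fix y assume "y \<in> reach E R W"
  then obtain x where "x \<in> R" "(x, y) \<in> (E \<inter> (R \<union> W) \<times> (R \<union> W))\<^sup>*" by (auto simp: reach_def)
  from this(2,1) show "y \<in> R \<union> W" by (induction rule: rtrancl_induct) auto
qed

lemma subset_reach: "R \<subseteq> reach E R W"
  by (auto simp: reach_def)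

lemma reach_step: "x \<in> reach E R W \<Longrightarrow> (x, y) \<in> E \<Longrightarrow> y \<in> R \<union> W \<Longrightarrow> y \<in> reach E R W"
  using reach_subset[of E R W] unfolding reach_def by (auto intro: rtrancl_into_rtrancl)

lemma reach_minimal:
  assumes "R \<subseteq> T" "\<And>x y. x \<in> T \<Longrightarrow> (x, y) \<in> E \<Longrightarrow> x \<in> R \<union> W \<Longrightarrow> y \<in> R \<union> W \<Longrightarrow> y \<in> T"
  shows "reach E R W \<subseteq> T"
proof
  fix y assume "y \<in> reach E R W"
  then obtain x where "x \<in> R" "(x, y) \<in> (E \<inter> (R \<union> W) \<times> (R \<union> W))\<^sup>*" by (auto simp: reach_def)
  from this(2,1) show "y \<in> T" by (induction rule: rtrancl_induct) (use assms in auto)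
qed

text \<open>One exploration step: X contains the open neighbours of r discovered now, and Y avoids
  the neighbours of r. Whatever was reached through r is then reached through the rest of the new
  frontier.\<close>

lemma reach_process:
  assumes "r \<in> R" "X \<subseteq> E `` {r}" "E `` {r} \<inter> Y = {}"
  shows "reach E R (X \<union> Y) \<subseteq> insert r (reach E (R - {r} \<union> X) Y)"
proof (rule reach_minimal)
  let ?R' = "R - {r} \<union> X"
  show "R \<subseteq> insert r (reach E ?R' Y)" using subset_reach[of ?R' E Y] by auto
  fix x y assume *: "x \<in> insert r (reach E ?R' Y)" "(x, y) \<in> E" "y \<in> R \<union> (X \<union> Y)"
  show "y \<in> insert r (reach E ?R' Y)"
  proof (cases "x = r")
    case True
    hence "y \<notin> Y" using * assms by auto
    thus ?thesis using * subset_reach[of ?R' E Y] by auto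
  next
    case False
    thus ?thesis using * reach_step[of x E ?R' Y y] by auto
  qed
qed

text \<open>Each step removes one vertex of R, which accounts for one unit of k, and adds the open
  ones among its at most d unrevealed neighbours. Their number is binomial, and monotonicity of
  \<open>survival\<close> allows raising the number of trials to d.\<close>

lemma perc_reach_le_survival:
  assumes p: "0 \<le> p" "p \<le> 1"
    and "finite V" "finite R" "R \<inter> V = {}" "\<And>x. x \<in> R \<union> V \<Longrightarrow> finite (E `` {x}) \<and> card (E `` {x}) \<le> d"
  shows "perc p V (\<lambda>W. of_bool (k \<le> card (reach E R W))) \<le> survival p d k (card R)"
  using assms(3-)
proof (induction k arbitrary: R V)
  case (Suc k)
  show ?case
  proof (cases "R = {}")
    case True
    thus ?thesis using Suc.prems by (simp add: reach_def)
  next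
    case False
    then obtain r where r: "r \<in> R" by auto
    define N where "N = E `` {r} \<inter> V"
    have fN: "finite N" "N \<subseteq> V" using Suc.prems by (auto simp: N_def)
    have cN: "card N \<le> d"
    proof -
      have "card N \<le> card (E `` {r})" unfolding N_def using Suc.prems(4)[of r] r by (intro card_mono) auto
      thus ?thesis using Suc.prems(4)[of r] r by auto
    qed
    have cR: "card R = Suc (card (R - {r}))" using r Suc.prems by (metis card_Suc_Diff1)
    have "perc p V (\<lambda>W. of_bool (Suc k \<le> card (reach E R W)))
        = perc p (N \<union> (V - N)) (\<lambda>W. of_bool (Suc k \<le> card (reach E R W)))"
      using fN by (simp add: Un_absorb1)
    also have "\<dots> = perc p N (\<lambda>X. perc p (V - N) (\<lambda>Y. of_bool (Suc k \<le> card (reach E R (X \<union> Y)))))"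
      using fN Suc.prems by (intro perc_Un) auto
    also have "\<dots> \<le> perc p N (\<lambda>X. perc p (V - N) (\<lambda>Y. of_bool (k \<le> card (reach E (R - {r} \<union> X) Y))))"
    proof (intro perc_mono p)
      fix X Y assume XY: "X \<subseteq> N" "Y \<subseteq> V - N"
      have "reach E R (X \<union> Y) \<subseteq> insert r (reach E (R - {r} \<union> X) Y)"
        using XY r by (intro reach_process) (auto simp: N_def)
      moreover have "finite (reach E (R - {r} \<union> X) Y)"
        using XY fN Suc.prems by (intro finite_subset[OF reach_subset]) (auto intro: finite_subset)
      ultimately have "card (reach E R (X \<union> Y)) \<le> Suc (card (reach E (R - {r} \<union> X) Y))"
        using card_mono[of "insert r (reach E (R - {r} \<union> X) Y)" "reach E R (X \<union> Y)"]
        by (auto simp: card_insert_if split: if_splits)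
      thus "of_bool (Suc k \<le> card (reach E R (X \<union> Y))) \<le> (of_bool (k \<le> card (reach E (R - {r} \<union> X) Y)) :: real)"
        by auto
    qed
    also have "\<dots> \<le> perc p N (\<lambda>X. survival p d k (card (R - {r}) + card X))"
    proof (rule perc_mono[OF p])
      fix X assume X: "X \<subseteq> N"
      have fX: "finite X" using X fN finite_subset by auto
      have "card (R - {r} \<union> X) = card (R - {r}) + card X"
        using X fX fN Suc.prems by (intro card_Un_disjoint) auto
      moreover have "perc p (V - N) (\<lambda>Y. of_bool (k \<le> card (reach E (R - {r} \<union> X) Y)))
        \<le> survival p d k (card (R - {r} \<union> X))"
        using Suc.prems X fX fN by (intro Suc.IH) auto
      ultimately show "perc p (V - N) (\<lambda>Y. of_bool (k \<le> card (reach E (R - {r} \<union> X) Y)))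
        \<le> survival p d k (card (R - {r}) + card X)" by simp
    qed
    also have "\<dots> = bin_mean p (card N) (\<lambda>m. survival p d k (card (R - {r}) + m))"
      using fN by (intro perc_card_eq_bin_mean)
    also have "\<dots> \<le> bin_mean p d (\<lambda>m. survival p d k (card (R - {r}) + m))"
      using cN by (intro bin_mean_mono_trials p) (auto intro!: monoI monoD[OF mono_survival[OF p]])
    also have "\<dots> = survival p d (Suc k) (card R)" by (simp add: cR)
    finally show ?thesis .
  qed
qed simp

text \<open>Linearity over v: a vertex is open with probability p, and given this its component is
  dominated by the walk from 1. Here 1 - s bounds the probability of surviving forever, and
  \<open>\<theta> ^ k\<close> that of dying out only after k steps.\<close>

lemma perc_card_large_components_le:
  fixes p s r \<theta> :: real
  assumes p: "0 \<le> p" "p \<le> 1" and s: "0 \<le> s" "s \<le> r" "0 < r" "r \<le> 1" and \<theta>: "0 \<le> \<theta>"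
    and gs: "s \<le> (1 - p + p * s) ^ d" and gr: "(1 - p + p * r) ^ d \<le> \<theta> * r"
    and V: "finite V" "E \<subseteq> V \<times> V" "\<And>x. x \<in> V \<Longrightarrow> card (E `` {x}) \<le> d"
  shows "perc p V (\<lambda>W. real (card {v \<in> W. k \<le> card (reach E {v} W)})) \<le> card V * (p * (1 - s + \<theta> ^ k))"
proof -
  have "perc p V (\<lambda>W. real (card {v \<in> W. k \<le> card (reach E {v} W)}))
      = perc p V (\<lambda>W. \<Sum>v\<in>V. of_bool (v \<in> W \<and> k \<le> card (reach E {v} W)))"
  proof (rule perc_cong)
    fix W assume "W \<subseteq> V"
    hence "V \<inter> {v. v \<in> W \<and> k \<le> card (reach E {v} W)} = {v \<in> W. k \<le> card (reach E {v} W)}" by auto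
    thus "real (card {v \<in> W. k \<le> card (reach E {v} W)}) = (\<Sum>v\<in>V. of_bool (v \<in> W \<and> k \<le> card (reach E {v} W)))"
      using V by (simp add: of_bool_def sum.If_cases)
  qed
  also have "\<dots> = (\<Sum>v\<in>V. perc p V (\<lambda>W. of_bool (v \<in> W \<and> k \<le> card (reach E {v} W))))"
    by (rule perc_sum)
  also have "\<dots> \<le> (\<Sum>v\<in>V. p * (1 - s + \<theta> ^ k))"
  proof (rule sum_mono)
    fix v assume v: "v \<in> V"
    have "perc p V (\<lambda>W. of_bool (v \<in> W \<and> k \<le> card (reach E {v} W)))
        = perc p (insert v (V - {v})) (\<lambda>W. of_bool (v \<in> W \<and> k \<le> card (reach E {v} W)))"
      using v by (simp add: insert_absorb)
    also have "\<dots> = p * perc p (V - {v}) (\<lambda>W. of_bool (k \<le> card (reach E {v} (insert v W))))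
       + (1 - p) * perc p (V - {v}) (\<lambda>W. of_bool (v \<in> W \<and> k \<le> card (reach E {v} W)))"
      using V by (subst perc_insert) auto
    also have "perc p (V - {v}) (\<lambda>W. of_bool (v \<in> W \<and> k \<le> card (reach E {v} W))) = perc p (V - {v}) (\<lambda>W. 0)"
      by (intro perc_cong) auto
    also have "\<dots> = 0" using V by simp
    \<comment> \<open>The root counts as open in \<open>reach\<close> anyway, so inserting it into W
      changes nothing.\<close>
    also have "perc p (V - {v}) (\<lambda>W. of_bool (k \<le> card (reach E {v} (insert v W))))
        = perc p (V - {v}) (\<lambda>W. of_bool (k \<le> card (reach E {v} W)))"
      by (simp add: reach_def)
    also have "\<dots> \<le> survival p d k (card {v})"
      using V v by (intro perc_reach_le_survival p) (auto intro: finite_subset[of _ V])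
    also have "\<dots> \<le> 1 - s + \<theta> ^ k * r"
      using survival_le[OF p s(1-3) \<theta> gs gr, of k 1] by simp
    also have "\<dots> \<le> 1 - s + \<theta> ^ k"
      using s \<theta> by (simp add: mult_left_le)
    finally show "perc p V (\<lambda>W. of_bool (v \<in> W \<and> k \<le> card (reach E {v} W))) \<le> p * (1 - s + \<theta> ^ k)"
      using p by (simp add: mult_left_mono)
  qed
  finally show ?thesis by simp
qed

section \<open>Exploration of a percolated graph\<close>

text \<open>An adaptive exploration: the strategy sees only the queried set Q and the open vertices
  F among it.\<close>

definition query :: "('a set \<Rightarrow> 'a set \<Rightarrow> 'a) \<Rightarrow> 'a set \<Rightarrow> 'a set \<times> 'a set \<Rightarrow> 'a set \<times> 'a set" where
  "query strat W = (\<lambda>(Q, F). let v = strat Q F in (insert v Q, if v \<in> W then insert v F else F))"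

text \<open>No vertex is queried twice, so from (Q, F) onwards only the states of V - Q matter. This
  permits deleting a queried vertex from the random set in the induction.\<close>

lemma query_funpow_cong:
  assumes "\<And>Q F. F \<subseteq> Q \<Longrightarrow> Q \<subset> V \<Longrightarrow> strat Q F \<in> V - Q"
    and "finite V" "Q \<subseteq> V" "F \<subseteq> Q" "t \<le> card (V - Q)" "W \<inter> (V - Q) = W' \<inter> (V - Q)"
  shows "(query strat W ^^ t) (Q, F) = (query strat W' ^^ t) (Q, F)"
  using assms(3-)
proof (induction t arbitrary: Q F)
  case (Suc t)
  define v where "v = strat Q F"
  have "Q \<subset> V" using Suc.prems by auto
  hence v: "v \<in> V - Q" unfolding v_def using assms(1) Suc.prems by blast
  have "query strat W (Q, F) = query strat W' (Q, F)"
    using v Suc.prems unfolding query_def v_def Let_def by auto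
  moreover have "(query strat W ^^ t) (query strat W' (Q, F)) = (query strat W' ^^ t) (query strat W' (Q, F))"
  proof -
    have "card (V - insert v Q) = card (V - Q) - 1"
      using v Suc.prems assms(2) by (subst Diff_insert) (auto simp: card_Diff_singleton)
    moreover have "query strat W' (Q, F) = (insert v Q, if v \<in> W' then insert v F else F)"
      by (simp add: query_def v_def Let_def)
    ultimately show ?thesis
      using Suc.prems v by (simp only:) (intro Suc.IH, auto)
  qed
  ultimately show ?case by (simp only: funpow_Suc_right o_apply)
qed simp

text \<open>The answers of an adaptive exploration are independent Bernoulli variables.\<close>
lemma perc_query_power:
  assumes strat: "\<And>Q F. F \<subseteq> Q \<Longrightarrow> Q \<subset> V \<Longrightarrow> strat Q F \<in> V - Q"
    and "finite V" "Q \<subseteq> V" "F \<subseteq> Q" "t \<le> card (V - Q)"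
  shows "perc p (V - Q) (\<lambda>W. z ^ card (snd ((query strat W ^^ t) (Q, F)))) = z ^ card F * (1 - p + p * z) ^ t"
  using assms(3-)
proof (induction t arbitrary: Q F)
  case 0
  thus ?case using assms(2) by simp
next
  case (Suc t)
  define v where "v = strat Q F"
  have "Q \<subset> V" using Suc.prems by auto
  hence v: "v \<in> V - Q" unfolding v_def using assms(1) Suc.prems by blast
  define V' where "V' = V - insert v Q"
  have V': "V - Q = insert v V'" "v \<notin> V'" "finite V'" using v assms(2) by (auto simp: V'_def)
  hence cV': "t \<le> card V'" using Suc.prems by simp
  have fO: "finite F" "v \<notin> F" using Suc.prems assms(2) v by (auto dest: finite_subset)
  have 1: "perc p V' (\<lambda>W. z ^ card (snd ((query strat (insert v W) ^^ Suc t) (Q, F))))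
     = z ^ card (insert v F) * (1 - p + p * z) ^ t"
  proof -
    have "perc p V' (\<lambda>W. z ^ card (snd ((query strat (insert v W) ^^ Suc t) (Q, F))))
      = perc p V' (\<lambda>W. z ^ card (snd ((query strat W ^^ t) (insert v Q, insert v F))))"
    proof (rule perc_cong)
      fix W assume W: "W \<subseteq> V'"
      have "(query strat (insert v W) ^^ Suc t) (Q, F) = (query strat (insert v W) ^^ t) (insert v Q, insert v F)"
        unfolding funpow_Suc_right by (simp add: query_def v_def[symmetric])
      also have "\<dots> = (query strat W ^^ t) (insert v Q, insert v F)"
        using v Suc.prems cV' assms(2) by (intro query_funpow_cong[where V = V] strat) (auto simp: V'_def)
      finally show "z ^ card (snd ((query strat (insert v W) ^^ Suc t) (Q, F)))
        = z ^ card (snd ((query strat W ^^ t) (insert v Q, insert v F)))" by simp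
    qed
    also have "\<dots> = z ^ card (insert v F) * (1 - p + p * z) ^ t"
      unfolding V'_def using v Suc.prems cV' by (intro Suc.IH) (auto simp: V'_def)
    finally show ?thesis .
  qed
  have 2: "perc p V' (\<lambda>W. z ^ card (snd ((query strat W ^^ Suc t) (Q, F))))
     = z ^ card F * (1 - p + p * z) ^ t"
  proof -
    have "perc p V' (\<lambda>W. z ^ card (snd ((query strat W ^^ Suc t) (Q, F))))
      = perc p V' (\<lambda>W. z ^ card (snd ((query strat W ^^ t) (insert v Q, F))))"
    proof (rule perc_cong)
      fix W assume W: "W \<subseteq> V'"
      hence "v \<notin> W" by (auto simp: V'_def)
      hence "(query strat W ^^ Suc t) (Q, F) = (query strat W ^^ t) (insert v Q, F)"
        unfolding funpow_Suc_right by (simp add: query_def v_def[symmetric])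
      thus "z ^ card (snd ((query strat W ^^ Suc t) (Q, F)))
        = z ^ card (snd ((query strat W ^^ t) (insert v Q, F)))" by simp
    qed
    also have "\<dots> = z ^ card F * (1 - p + p * z) ^ t"
      unfolding V'_def using v Suc.prems cV' by (intro Suc.IH) (auto simp: V'_def)
    finally show ?thesis .
  qed
  have "perc p (V - Q) (\<lambda>W. z ^ card (snd ((query strat W ^^ Suc t) (Q, F))))
     = p * (z ^ card (insert v F) * (1 - p + p * z) ^ t) + (1 - p) * (z ^ card F * (1 - p + p * z) ^ t)"
    unfolding V'(1) perc_insert[OF V'(3,2)] 1 2 ..
  also have "\<dots> = z ^ card F * (1 - p + p * z) ^ Suc t"
    using fO by (simp add: algebra_simps)
  finally show ?case .
qed

text \<open>Search component by component: an arbitrary fresh vertex is taken only when all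
  neighbours of F have been queried, so that every component met so far is exhausted. Such times are
  the breaks below.\<close>

definition search :: "'a set \<Rightarrow> ('a \<times> 'a) set \<Rightarrow> 'a set \<Rightarrow> 'a set \<Rightarrow> 'a" where
  "search V E Q F = (if E `` F \<subseteq> Q then SOME v. v \<in> V - Q else SOME v. v \<in> E `` F - Q)"

lemma search_in:
  assumes "E \<subseteq> V \<times> V" "Q \<subset> V"
  shows "search V E Q F \<in> V - Q"
proof (cases "E `` F \<subseteq> Q")
  case True
  have "\<exists>v. v \<in> V - Q" using assms by auto
  thus ?thesis using True someI_ex[of "\<lambda>v. v \<in> V - Q"] by (simp add: search_def)
next
  case False
  hence "\<exists>v. v \<in> E `` F - Q" by auto
  hence "search V E Q F \<in> E `` F - Q" using False someI_ex[of "\<lambda>v. v \<in> E `` F - Q"] by (simp add: search_def)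
  thus ?thesis using assms by auto
qed

lemma search_in_Image: "\<not> E `` F \<subseteq> Q \<Longrightarrow> search V E Q F \<in> E `` F - Q"
proof -
  assume n: "\<not> E `` F \<subseteq> Q"
  hence "\<exists>v. v \<in> E `` F - Q" by auto
  thus ?thesis using n someI_ex[of "\<lambda>v. v \<in> E `` F - Q"] by (simp add: search_def)
qed

definition queried :: "'a set \<Rightarrow> ('a \<times> 'a) set \<Rightarrow> 'a set \<Rightarrow> nat \<Rightarrow> 'a set" where
  "queried V E W t = fst ((query (search V E) W ^^ t) ({}, {}))"

definition found :: "'a set \<Rightarrow> ('a \<times> 'a) set \<Rightarrow> 'a set \<Rightarrow> nat \<Rightarrow> 'a set" where
  "found V E W t = snd ((query (search V E) W ^^ t) ({}, {}))"

lemma queried_found_0 [simp]: "queried V E W 0 = {}" "found V E W 0 = {}"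
  by (simp_all add: queried_def found_def)

lemma queried_Suc: "queried V E W (Suc t) = insert (search V E (queried V E W t) (found V E W t)) (queried V E W t)"
  by (simp add: queried_def found_def query_def Let_def case_prod_unfold)

lemma found_Suc: "found V E W (Suc t) = (let v = search V E (queried V E W t) (found V E W t) in
    if v \<in> W then insert v (found V E W t) else found V E W t)"
  by (simp add: queried_def found_def query_def Let_def case_prod_unfold)

lemma found_eq: "found V E W t = queried V E W t \<inter> W"
  by (induction t) (auto simp: queried_Suc found_Suc Let_def)

lemma queried_mono: "s \<le> t \<Longrightarrow> queried V E W s \<subseteq> queried V E W t"
  by (induction t rule: dec_induct) (auto simp: queried_Suc)

context
  fixes V :: "'a set" and E :: "('a \<times> 'a) set" and W :: "'a set"
  assumes V: "finite V" and E: "E \<subseteq> V \<times> V"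
begin

lemma queried_card: "t \<le> card V \<Longrightarrow> queried V E W t \<subseteq> V \<and> card (queried V E W t) = t"
proof (induction t)
  case (Suc t)
  hence IH: "queried V E W t \<subseteq> V" "card (queried V E W t) = t" by auto
  hence "queried V E W t \<subset> V" using Suc.prems by auto
  hence "search V E (queried V E W t) (found V E W t) \<in> V - queried V E W t"
    by (rule search_in[OF E])
  thus ?case using IH V finite_subset[OF IH(1) V] by (auto simp: queried_Suc)
qed simp

text \<open>A closed vertex queried at a break yields another break, so the vertex queried at the
  last break \<open>\<tau>\<close> is open. Every later query is a neighbour of some found vertex,
  and that vertex was itself found after \<open>\<tau>\<close>, because the neighbours of earlier
  ones had all been queried by then. The later finds thus lie in a single component.\<close>

lemma card_reach_ge_of_no_break:
  assumes "\<tau> < t" "t \<le> card V" and brk: "E `` found V E W \<tau> \<subseteq> queried V E W \<tau>"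
    and nobrk: "\<And>s. \<tau> < s \<Longrightarrow> s \<le> t \<Longrightarrow> \<not> E `` found V E W s \<subseteq> queried V E W s"
  shows "\<exists>v\<in>W \<inter> V. found V E W t - found V E W \<tau> \<subseteq> reach E {v} W"
proof -
  define v where "v = search V E (queried V E W \<tau>) (found V E W \<tau>)"
  have "queried V E W \<tau> \<subset> V" using queried_card[of \<tau>] assms by auto
  hence vV: "v \<in> V" using search_in[OF E, of "queried V E W \<tau>" "found V E W \<tau>"] by (auto simp: v_def)
  have vW: "v \<in> W"
  proof (rule ccontr)
    assume "v \<notin> W"
    hence "found V E W (Suc \<tau>) = found V E W \<tau>" by (simp add: found_Suc v_def Let_def)
    hence "E `` found V E W (Suc \<tau>) \<subseteq> queried V E W (Suc \<tau>)" using brk by (auto simp: queried_Suc)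
    thus False using nobrk[of "Suc \<tau>"] assms(1) by auto
  qed
  have "found V E W s - found V E W \<tau> \<subseteq> reach E {v} W" if "\<tau> < s" "s \<le> t" for s
    using that
  proof (induction s)
    case (Suc s)
    define u where "u = search V E (queried V E W s) (found V E W s)"
    show ?case
    proof (cases "s = \<tau>")
      case True
      thus ?thesis using subset_reach[of "{v}" E W] by (auto simp: found_Suc Let_def v_def)
    next
      case False
      hence s: "\<tau> < s" "s \<le> t" using Suc.prems by auto
      hence IH: "found V E W s - found V E W \<tau> \<subseteq> reach E {v} W" using Suc.IH by auto
      have u: "u \<in> E `` found V E W s - queried V E W s"
        unfolding u_def by (rule search_in_Image) (use nobrk s in auto)
      then obtain x where x: "x \<in> found V E W s" "(x, u) \<in> E" by auto
      have "x \<notin> found V E W \<tau>"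
        using x u brk queried_mono[of \<tau> s V E W] s by auto
      hence "x \<in> reach E {v} W" using IH x by auto
      hence "u \<in> reach E {v} W" if "u \<in> W" using reach_step x that by fast
      thus ?thesis using IH by (auto simp: found_Suc Let_def u_def[symmetric])
    qed
  qed simp
  thus ?thesis using vV vW assms by blast
qed

text \<open>At a break the found set has all its neighbours among the t queried vertices, so
  expansion gives g * |found| \<le> t, while \<open>many\<close> and a g > 1 give the opposite. The
  last break therefore precedes \<open>t0\<close>, and at most \<open>t0 / g\<close> vertices were
  found before it.\<close>

lemma card_reach_ge_of_expansion:
  fixes m t0 t1 :: nat and g a :: real
  assumes exp: "vertex_expanding V E m g" and g: "0 < g"
    and t: "0 < t0" "t0 \<le> t1" "t1 \<le> card V" "real t1 < g * m" and a: "1 < a * g"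
    and many: "\<And>t. t0 \<le> t \<Longrightarrow> t \<le> t1 \<Longrightarrow> a * t < card (found V E W t)"
  shows "\<exists>v\<in>W \<inter> V. a * t1 - t0 / g \<le> card (reach E {v} W)"
proof -
  define brk where "brk t \<longleftrightarrow> E `` found V E W t \<subseteq> queried V E W t" for t
  have fV: "found V E W t \<subseteq> V" if "t \<le> card V" for t
    using queried_card[OF that] by (auto simp: found_eq)
  have brk_le: "g * card (found V E W t) \<le> t" if "t \<le> t1" "brk t" for t
  proof -
    have Q: "queried V E W t \<subseteq> V" "card (queried V E W t) = t"
      using queried_card[of t] that t by auto
    have *: "g * card S \<le> t" if "S \<subseteq> found V E W t" "real (card S) \<le> m" for S
    proof -
      have "g * card S \<le> card (E `` S)"
        using exp that fV[of t] \<open>t \<le> t1\<close> t by (auto simp: vertex_expanding_def)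
      also have "\<dots> \<le> card (queried V E W t)"
        using that \<open>brk t\<close> Q finite_subset[OF Q(1) V] unfolding brk_def by (intro of_nat_mono card_mono) auto
      finally show ?thesis using Q by simp
    qed
    \<comment> \<open>Expansion is available only up to size m. A larger found set contains a subset
      of size m, whose g m neighbours would exceed \<open>t1\<close> queries.\<close>
    show ?thesis
    proof (cases "card (found V E W t) \<le> m")
      case True
      thus ?thesis using * by auto
    next
      case False
      then obtain S where S: "S \<subseteq> found V E W t" "card S = m"
        by (meson obtain_subset_with_card_n nat_le_linear)
      hence "g * m \<le> t" using *[of S] by simp
      thus ?thesis using that t by simp
    qed
  qed
  have nobrk: "\<not> brk t" if "t0 \<le> t" "t \<le> t1" for t
  proof
    assume "brk t"
    hence "g * card (found V E W t) \<le> t" using brk_le that by auto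
    moreover have "g * (a * t) < g * card (found V E W t)" using many[OF that] g by simp
    moreover have "1 * real t < (a * g) * real t" using a that t by (intro mult_strict_right_mono) auto
    ultimately show False by (simp add: mult_ac)
  qed
  define \<tau> where "\<tau> = Max {t. t \<le> t1 \<and> brk t}"
  have fin: "finite {t. t \<le> t1 \<and> brk t}" by (rule finite_subset[of _ "{..t1}"]) auto
  \<comment> \<open>Time 0 is a break, so the maximum exists.\<close>
  have "0 \<in> {t. t \<le> t1 \<and> brk t}" by (auto simp: brk_def)
  hence "\<tau> \<in> {t. t \<le> t1 \<and> brk t}" unfolding \<tau>_def using fin by (intro Max_in) auto
  hence \<tau>: "\<tau> \<le> t1" "brk \<tau>" by auto
  have after: "\<not> brk s" if "\<tau> < s" "s \<le> t1" for s
  proof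
    assume "brk s"
    hence "s \<le> \<tau>" unfolding \<tau>_def using that by (intro Max_ge[OF fin]) auto
    thus False using that by simp
  qed
  have \<tau>t0: "\<tau> < t0" using nobrk[of \<tau>] \<tau> by force
  then obtain v where v: "v \<in> W \<inter> V" "found V E W t1 - found V E W \<tau> \<subseteq> reach E {v} W"
    using card_reach_ge_of_no_break[of \<tau> t1] after \<tau> t unfolding brk_def by auto
  have fin2: "finite (found V E W t1)" "finite (found V E W \<tau>)"
    using fV[of t1] fV[of \<tau>] t \<tau> V by (auto dest: finite_subset)
  have "reach E {v} W \<subseteq> V"
    by (rule reach_minimal) (use v E in auto)
  hence "card (found V E W t1 - found V E W \<tau>) \<le> card (reach E {v} W)"
    using v V by (intro card_mono) (auto intro: finite_subset)
  moreover have "card (found V E W t1) - card (found V E W \<tau>) \<le> card (found V E W t1 - found V E W \<tau>)"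
    using fin2 by (intro diff_card_le_card_Diff) auto
  moreover have "card (found V E W \<tau>) \<le> t0 / g"
  proof -
    have "g * card (found V E W \<tau>) \<le> t0" using brk_le[OF \<tau>] \<tau>t0 by linarith
    thus ?thesis using g by (simp add: field_simps)
  qed
  moreover have "a * t1 < card (found V E W t1)" using many t by simp
  ultimately show ?thesis using v(1) by (intro bexI[of _ v]) linarith+
qed

end

lemma perc_found_power:
  assumes "finite V" "E \<subseteq> V \<times> V" "t \<le> card V"
  shows "perc p V (\<lambda>W. z ^ card (found V E W t)) = (1 - p + p * z) ^ t"
  using perc_query_power[of V "search V E" "{}" "{}" t p z] search_in[OF assms(2)] assms
  by (simp add: found_def)

text \<open>Chernoff's bound with parameter z for the lower tail of Bin(t, p), summed over the times
  from \<open>t0\<close> to \<open>t1\<close>; as \<open>\<rho> \<le> 1\<close>, every term is at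
  most \<open>\<rho> ^ t0\<close>. If no time fails, the expansion argument applies.\<close>

lemma perc_no_large_component_le:
  fixes p z a g \<rho> :: real and m t0 t1 :: nat
  assumes p: "0 \<le> p" "p \<le> 1" and V: "finite V" and E: "E \<subseteq> V \<times> V"
    and exp: "vertex_expanding V E m g" and g: "0 < g"
    and t: "0 < t0" "t0 \<le> t1" "t1 \<le> card V" "real t1 < g * m" and a: "1 < a * g"
    and z: "0 < z" "z \<le> 1" and \<rho>: "(1 - p + p * z) * z powr (- a) \<le> \<rho>" "\<rho> \<le> 1"
  shows "perc p V (\<lambda>W. of_bool (\<not> (\<exists>v\<in>W. a * t1 - t0 / g \<le> card (reach E {v} W)))) \<le> (t1 + 1) * \<rho> ^ t0"
proof -
  have pz: "0 \<le> 1 - p + p * z" using p z by simp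
  have "perc p V (\<lambda>W. of_bool (\<not> (\<exists>v\<in>W. a * t1 - t0 / g \<le> card (reach E {v} W))))
    \<le> perc p V (\<lambda>W. \<Sum>t\<in>{t0..t1}. z powr (- (a * t)) * z ^ card (found V E W t))"
  proof (rule perc_mono[OF p])
    fix W assume W: "W \<subseteq> V"
    have nn: "0 \<le> (\<Sum>t\<in>{t0..t1}. z powr (- (a * t)) * z ^ card (found V E W t))"
      using z by (intro sum_nonneg) auto
    show "of_bool (\<not> (\<exists>v\<in>W. a * t1 - t0 / g \<le> card (reach E {v} W)))
      \<le> (\<Sum>t\<in>{t0..t1}. z powr (- (a * t)) * z ^ card (found V E W t))"
    proof (cases "\<exists>v\<in>W. a * t1 - t0 / g \<le> card (reach E {v} W)")
      case False
      have "\<exists>t. t0 \<le> t \<and> t \<le> t1 \<and> card (found V E W t) \<le> a * t"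
      proof (rule ccontr)
        assume "\<not> (\<exists>t. t0 \<le> t \<and> t \<le> t1 \<and> card (found V E W t) \<le> a * t)"
        hence "a * t < card (found V E W t)" if "t0 \<le> t" "t \<le> t1" for t
          using that by (meson not_le)
        from card_reach_ge_of_expansion[OF V E exp g t a this] show "False" using False by blast
      qed
      then obtain t where tt: "t0 \<le> t" "t \<le> t1" "card (found V E W t) \<le> a * t" by blast
      have "1 \<le> z powr (- (a * t)) * z ^ card (found V E W t)"
      proof -
        have "z powr 0 \<le> z powr (card (found V E W t) - a * t)"
          using z tt by (intro powr_mono') auto
        also have "\<dots> = z powr (- (a * t)) * z ^ card (found V E W t)"
          using z by (simp add: powr_diff powr_minus powr_realpow field_simps)
        finally show ?thesis using z by simp
      qed
      also have "\<dots> \<le> (\<Sum>t\<in>{t0..t1}. z powr (- (a * t)) * z ^ card (found V E W t))"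
        using tt z by (intro member_le_sum[where f = "\<lambda>t. z powr (- (a * real t)) * z ^ card (found V E W t)"]) auto
      finally show ?thesis using False by simp
    qed (use nn in simp)
  qed
  also have "\<dots> = (\<Sum>t\<in>{t0..t1}. z powr (- (a * t)) * (1 - p + p * z) ^ t)"
    unfolding perc_sum perc_cmult using t by (intro sum.cong refl) (simp add: perc_found_power[OF V E])
  also have "\<dots> = (\<Sum>t\<in>{t0..t1}. ((1 - p + p * z) * z powr (- a)) ^ t)"
    using z by (intro sum.cong refl) (simp add: power_mult_distrib powr_realpow[symmetric] powr_powr mult.commute)
  also have "\<dots> \<le> (\<Sum>t\<in>{t0..t1}. \<rho> ^ t0)"
  proof (rule sum_mono)
    fix t assume "t \<in> {t0..t1}"
    have r0: "0 \<le> (1 - p + p * z) * z powr (- a)" using pz by simp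
    hence "((1 - p + p * z) * z powr (- a)) ^ t \<le> \<rho> ^ t" using \<rho> by (intro power_mono)
    also have "\<dots> \<le> \<rho> ^ t0" using \<open>t \<in> _\<close> \<rho> r0 by (intro power_decreasing) auto
    finally show "((1 - p + p * z) * z powr (- a)) ^ t \<le> \<rho> ^ t0" .
  qed
  also have "\<dots> = real (card {t0..t1}) * \<rho> ^ t0" by simp
  also have "\<dots> \<le> (t1 + 1) * \<rho> ^ t0"
  proof (rule mult_right_mono)
    have "0 \<le> (1 - p + p * z) * z powr (- a)" using pz by simp
    thus "0 \<le> \<rho> ^ t0" using \<rho> by simp
  qed auto
  finally show ?thesis by simp
qed

section \<open>Large components and independence\<close>

lemma reach_eq_of_mem:
  assumes "sym E" "v \<in> W" "u \<in> reach E {v} W"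
  shows "reach E {u} W = reach E {v} W"
proof -
  define S where "S = (E \<inter> W \<times> W)\<^sup>*"
  have u: "u \<in> W" using assms reach_subset[of E "{v}" W] by auto
  hence eq: "reach E {u} W = S `` {u}" "reach E {v} W = S `` {v}"
    using assms by (simp_all add: reach_def S_def insert_absorb)
  have "sym (E \<inter> W \<times> W)" using assms(1) by (auto simp: sym_def)
  hence "sym S" unfolding S_def by (rule sym_rtrancl)
  moreover have "(v, u) \<in> S" using assms(3) eq by auto
  moreover have "trans S" unfolding S_def by (rule trans_rtrancl)
  ultimately show ?thesis unfolding eq by (auto dest: symD transD)
qed

text \<open>Two failures are excluded: the exploration finds no large component, or the one found
  exceeds \<open>k\<^sub>1\<close>. In the second case all its vertices belong to a component of
  size at least \<open>k\<^sub>0\<close>, so Markov's inequality for the number of such vertices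
  applies.\<close>

lemma perc_component_size_ge:
  fixes p z a g \<rho> s r \<theta> k\<^sub>1 :: real and m t0 t1 d k\<^sub>0 :: nat
  assumes p: "0 \<le> p" "p \<le> 1" and V: "finite V" and E: "E \<subseteq> V \<times> V" and sym: "sym E"
    and exp: "vertex_expanding V E m g" and g: "0 < g"
    and t: "0 < t0" "t0 \<le> t1" "t1 \<le> card V" "real t1 < g * m" and a: "1 < a * g"
    and z: "0 < z" "z \<le> 1" and \<rho>: "(1 - p + p * z) * z powr (- a) \<le> \<rho>" "\<rho> \<le> 1"
    and deg: "\<And>x. x \<in> V \<Longrightarrow> card (E `` {x}) \<le> d"
    and s: "0 \<le> s" "s \<le> r" "0 < r" "r \<le> 1" and \<theta>: "0 \<le> \<theta>"
    and gs: "s \<le> (1 - p + p * s) ^ d" and gr: "(1 - p + p * r) ^ d \<le> \<theta> * r"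
    and k0: "k\<^sub>0 \<le> a * t1 - t0 / g" and k1: "0 < k\<^sub>1"
  shows "1 - (t1 + 1) * \<rho> ^ t0 - card V * (p * (1 - s + \<theta> ^ k\<^sub>0)) / k\<^sub>1
    \<le> perc p V (\<lambda>W. of_bool (\<exists>v\<in>W. k\<^sub>0 \<le> card (reach E {v} W) \<and> card (reach E {v} W) \<le> k\<^sub>1))"
proof -
  define Big where "Big W = {v \<in> W. k\<^sub>0 \<le> card (reach E {v} W)}" for W
  have "1 - perc p V (\<lambda>W. of_bool (\<not> (\<exists>v\<in>W. a * t1 - t0 / g \<le> card (reach E {v} W))))
      - perc p V (\<lambda>W. inverse k\<^sub>1 * real (card (Big W)))
    = perc p V (\<lambda>W. 1 - of_bool (\<not> (\<exists>v\<in>W. a * t1 - t0 / g \<le> card (reach E {v} W))) - inverse k\<^sub>1 * real (card (Big W)))"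
    using V by (simp add: perc_diff)
  also have "\<dots> \<le> perc p V (\<lambda>W. of_bool (\<exists>v\<in>W. k\<^sub>0 \<le> card (reach E {v} W) \<and> card (reach E {v} W) \<le> k\<^sub>1))"
  proof (rule perc_mono[OF p])
    fix W assume W: "W \<subseteq> V"
    hence fW: "finite W" using V finite_subset by auto
    have nn: "0 \<le> inverse k\<^sub>1 * real (card (Big W))" using k1 by simp
    show "1 - of_bool (\<not> (\<exists>v\<in>W. a * t1 - t0 / g \<le> card (reach E {v} W))) - inverse k\<^sub>1 * real (card (Big W))
      \<le> of_bool (\<exists>v\<in>W. k\<^sub>0 \<le> card (reach E {v} W) \<and> card (reach E {v} W) \<le> k\<^sub>1)"
    proof (cases "\<exists>v\<in>W. a * t1 - t0 / g \<le> card (reach E {v} W)")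
      case True
      then obtain v where v: "v \<in> W" "a * t1 - t0 / g \<le> card (reach E {v} W)" by auto
      hence kv: "k\<^sub>0 \<le> card (reach E {v} W)" using k0 by linarith
      show ?thesis
      proof (cases "card (reach E {v} W) \<le> k\<^sub>1")
        case True
        thus ?thesis using v kv nn by auto
      next
        case False
        have "reach E {v} W \<subseteq> Big W"
          using reach_eq_of_mem[OF sym v(1)] reach_subset[of E "{v}" W] v kv by (auto simp: Big_def)
        hence "card (reach E {v} W) \<le> card (Big W)"
          using fW by (intro card_mono) (auto simp: Big_def)
        hence "k\<^sub>1 \<le> card (Big W)" using False by linarith
        hence "1 \<le> inverse k\<^sub>1 * real (card (Big W))" using k1 by (simp add: field_simps)
        thus ?thesis by simp
      qed
    qed (use nn in simp)
  qed
  finally have "1 - perc p V (\<lambda>W. of_bool (\<not> (\<exists>v\<in>W. a * t1 - t0 / g \<le> card (reach E {v} W))))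
      - inverse k\<^sub>1 * perc p V (\<lambda>W. real (card (Big W)))
    \<le> perc p V (\<lambda>W. of_bool (\<exists>v\<in>W. k\<^sub>0 \<le> card (reach E {v} W) \<and> card (reach E {v} W) \<le> k\<^sub>1))"
    by (simp only: perc_cmult)
  moreover have "perc p V (\<lambda>W. of_bool (\<not> (\<exists>v\<in>W. a * t1 - t0 / g \<le> card (reach E {v} W)))) \<le> (t1 + 1) * \<rho> ^ t0"
    by (rule perc_no_large_component_le[OF p V E exp g t a z \<rho>])
  moreover have "inverse k\<^sub>1 * perc p V (\<lambda>W. real (card (Big W))) \<le> inverse k\<^sub>1 * (card V * (p * (1 - s + \<theta> ^ k\<^sub>0)))"
    unfolding Big_def using k1 by (intro mult_left_mono perc_card_large_components_le[OF p s \<theta> gs gr V E deg]) auto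
  moreover have "inverse k\<^sub>1 * (card V * (p * (1 - s + \<theta> ^ k\<^sub>0))) = card V * (p * (1 - s + \<theta> ^ k\<^sub>0)) / k\<^sub>1"
    by (simp add: field_simps)
  ultimately show ?thesis by linarith
qed

section \<open>Independence of events on disjoint sets\<close>

lemma perc_none:
  assumes "finite I" "finite V" "\<And>i. i \<in> I \<Longrightarrow> T i \<subseteq> V" "disjoint_family_on T I"
  shows "perc p V (\<lambda>W. of_bool (\<forall>i\<in>I. \<not> Q i (W \<inter> T i))) = (\<Prod>i\<in>I. 1 - perc p (T i) (\<lambda>W. of_bool (Q i W)))"
  using assms
proof (induction I arbitrary: V rule: finite_induct)
  case (insert i I)
  have T: "T i \<subseteq> V" "finite (T i)" using insert.prems(1,2) finite_subset[of "T i" V] by auto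
  have disj: "T i \<inter> T j = {}" if "j \<in> I" for j
    using insert.prems(3) insert.hyps that by (auto simp: disjoint_family_on_def)
  have "perc p V (\<lambda>W. of_bool (\<forall>j\<in>insert i I. \<not> Q j (W \<inter> T j)))
    = perc p (T i \<union> (V - T i)) (\<lambda>W. of_bool (\<forall>j\<in>insert i I. \<not> Q j (W \<inter> T j)))"
    using T by (simp add: Un_absorb1)
  also have "\<dots> = perc p (T i) (\<lambda>X. perc p (V - T i) (\<lambda>Y. of_bool (\<forall>j\<in>insert i I. \<not> Q j ((X \<union> Y) \<inter> T j))))"
    using T insert.prems by (intro perc_Un) auto
  also have "\<dots> = perc p (T i) (\<lambda>X. perc p (V - T i) (\<lambda>Y. (1 - of_bool (Q i X)) * of_bool (\<forall>j\<in>I. \<not> Q j (Y \<inter> T j))))"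
  proof (intro perc_cong)
    fix X Y assume XY: "X \<subseteq> T i" "Y \<subseteq> V - T i"
    have 1: "(X \<union> Y) \<inter> T i = X" using XY by auto
    have 2: "(X \<union> Y) \<inter> T j = Y \<inter> T j" if "j \<in> I" for j using XY disj[OF that] by auto
    show "of_bool (\<forall>j\<in>insert i I. \<not> Q j ((X \<union> Y) \<inter> T j))
      = (1 - of_bool (Q i X)) * (of_bool (\<forall>j\<in>I. \<not> Q j (Y \<inter> T j)) :: real)"
      using 1 2 by auto
  qed
  also have "\<dots> = perc p (T i) (\<lambda>X. (1 - of_bool (Q i X)) * (\<Prod>j\<in>I. 1 - perc p (T j) (\<lambda>W. of_bool (Q j W))))"
  proof -
    have "perc p (V - T i) (\<lambda>Y. of_bool (\<forall>j\<in>I. \<not> Q j (Y \<inter> T j))) = (\<Prod>j\<in>I. 1 - perc p (T j) (\<lambda>W. of_bool (Q j W)))"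
    proof (rule insert.IH)
      show "T j \<subseteq> V - T i" if "j \<in> I" for j
        using disj[OF that] insert.prems(2)[of j] that by blast
      show "disjoint_family_on T I"
        using insert.prems(3) by (auto simp: disjoint_family_on_def)
    qed (use insert.prems in auto)
    thus ?thesis by (simp add: perc_cmult)
  qed
  also have "\<dots> = (\<Prod>j\<in>I. 1 - perc p (T j) (\<lambda>W. of_bool (Q j W))) * perc p (T i) (\<lambda>X. 1 - of_bool (Q i X))"
    by (subst perc_cmult[symmetric]) (simp add: mult.commute)
  also have "perc p (T i) (\<lambda>X. 1 - of_bool (Q i X)) = 1 - perc p (T i) (\<lambda>X. of_bool (Q i X))"
    using T by (simp add: perc_diff)
  finally show ?case using insert.hyps by (simp add: mult.commute)
qed simp

lemma perc_avoid:
  assumes "finite N" "K \<subseteq> N"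
  shows "perc p N (\<lambda>Y. of_bool (K \<inter> Y = {})) = (1 - p) ^ card K"
proof -
  have fin: "finite K" using assms finite_subset by auto
  have "perc p N (\<lambda>Y. of_bool (K \<inter> Y = {})) = perc p (K \<union> (N - K)) (\<lambda>Y. of_bool (K \<inter> Y = {}))"
    using assms by (simp add: Un_absorb1)
  also have "\<dots> = perc p K (\<lambda>X. perc p (N - K) (\<lambda>Y. of_bool (K \<inter> (X \<union> Y) = {})))"
    using assms fin by (intro perc_Un) auto
  also have "\<dots> = perc p K (\<lambda>X. perc p (N - K) (\<lambda>Y. of_bool (X = {})))"
  proof (intro perc_cong)
    fix X Y assume "X \<subseteq> K" "Y \<subseteq> N - K"
    hence "K \<inter> (X \<union> Y) = {} \<longleftrightarrow> X = {}" by auto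
    thus "of_bool (K \<inter> (X \<union> Y) = {}) = (of_bool (X = {}) :: real)" by simp
  qed
  also have "\<dots> = (1 - p) ^ card K"
    using assms fin by (simp add: perc_disjoint)
  finally show ?thesis .
qed

section \<open>Grids of expanders\<close>

text \<open>\<open>hue i i'\<close> names the vertex of H at which the parts with coordinates i and
  i' on a common line are joined. It is an edge colouring of K_q with M colours, each colour class
  being 2 \<beta>-regular, so the joining edges load all vertices of a part equally.\<close>

locale blowup =
  fixes q M k \<beta> :: nat and hue :: "nat \<Rightarrow> nat \<Rightarrow> nat" and H :: "(nat \<times> nat) set"
  assumes hue_sym: "hue i i' = hue i' i"
    and hue_less: "i < q \<Longrightarrow> i' < q \<Longrightarrow> i \<noteq> i' \<Longrightarrow> hue i i' < M"
    and hue_card: "i < q \<Longrightarrow> x < M \<Longrightarrow> card {i'. i' < q \<and> i' \<noteq> i \<and> hue i i' = x} = 2 * \<beta>"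
    and H: "regular_on k {..<M} H"
    and even_M: "even M"
begin

definition V :: "(nat \<times> nat \<times> nat) set" where
  "V = {..<q} \<times> {..<q} \<times> {..<M}"

definition idx :: "(nat \<times> nat) set" where
  "idx = {..<q} \<times> {..<q}"

definition EH :: "(nat \<times> nat \<times> nat) rel" where
  "EH = {((i, j, x), (i, j, y)) |i j x y. i < q \<and> j < q \<and> (x, y) \<in> H}"

definition ER :: "(nat \<times> nat \<times> nat) rel" where
  "ER = {((i, j, x), (i', j, x)) |i i' j x. i < q \<and> i' < q \<and> j < q \<and> i \<noteq> i' \<and> x = hue i i'}"

text \<open>Rows use the hues in reversed order, so that (as \<open>M\<close> is even) no vertex is joined both to the
  diagonal part \<open>(i, i)\<close> and to the diagonal part \<open>(j, j)\<close>.\<close>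
definition EC :: "(nat \<times> nat \<times> nat) rel" where
  "EC = {((i, j, x), (i, j', x)) |i j j' x. i < q \<and> j < q \<and> j' < q \<and> j \<noteq> j' \<and> x = M - 1 - hue j j'}"

definition EF :: "(nat \<times> nat \<times> nat) rel" where
  "EF = ER \<union> EC"

definition E :: "(nat \<times> nat \<times> nat) rel" where
  "E = EH \<union> EF"

lemma H_sub: "H \<subseteq> {..<M} \<times> {..<M}" and H_sym: "sym H" and H_irrefl: "irrefl H"
  and H_deg: "x < M \<Longrightarrow> card (H `` {x}) = k"
  using H by (auto simp: regular_on_def)

lemma finite_V: "finite V" and card_V: "card V = q ^ 2 * M"
  by (simp_all add: V_def card_cartesian_product power2_eq_square)

lemma EH_sub: "EH \<subseteq> V \<times> V"
  using H_sub by (auto simp: EH_def V_def)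

lemma M_minus_hue_less: "j < q \<Longrightarrow> j' < q \<Longrightarrow> j \<noteq> j' \<Longrightarrow> M - 1 - hue j j' < M"
  using hue_less[of j j'] by auto

lemma EF_sub: "EF \<subseteq> V \<times> V"
  using hue_less M_minus_hue_less by (auto simp: EF_def ER_def EC_def V_def)

lemma E_sub: "E \<subseteq> V \<times> V"
  using EH_sub EF_sub by (auto simp: E_def)

lemma sym_EF: "sym EF"
  unfolding EF_def ER_def EC_def by (intro symI) (auto simp: hue_sym)

lemma sym_EH: "sym EH"
  using H_sym unfolding EH_def by (intro symI) (auto dest: symD)

lemma sym_E: "sym E"
  using sym_EF sym_EH by (auto simp: E_def sym_def)

lemma finite_E: "finite EH" "finite EF" "finite E"
  using finite_subset[OF EH_sub] finite_subset[OF EF_sub] finite_subset[OF E_sub] finite_V by auto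

lemma EF_Image:
  assumes "(i, j, x) \<in> V"
  shows "EF `` {(i, j, x)} = (\<lambda>i'. (i', j, x)) ` {i'. i' < q \<and> i' \<noteq> i \<and> hue i i' = x}
    \<union> (\<lambda>j'. (i, j', x)) ` {j'. j' < q \<and> j' \<noteq> j \<and> hue j j' = M - 1 - x}"
proof -
  \<comment> \<open>Reversal x to M - 1 - x is an involution below M; \<open>hue_less\<close> keeps
    the natural subtraction exact.\<close>
  have "x = M - 1 - hue j j' \<longleftrightarrow> hue j j' = M - 1 - x" if "j' < q" "j' \<noteq> j" for j'
    using assms that hue_less[of j j'] by (auto simp: V_def)
  thus ?thesis using assms by (auto simp: EF_def ER_def EC_def V_def image_iff)
qed

lemma EF_deg: "v \<in> V \<Longrightarrow> card (EF `` {v}) = 4 * \<beta>"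
proof -
  assume v: "v \<in> V"
  obtain i j x where ijx: "v = (i, j, x)" by (cases v)
  have b: "i < q" "j < q" "x < M" "M - 1 - x < M" using v ijx by (auto simp: V_def)
  have "card (EF `` {v}) = card ((\<lambda>i'. (i', j, x)) ` {i'. i' < q \<and> i' \<noteq> i \<and> hue i i' = x})
    + card ((\<lambda>j'. (i, j', x)) ` {j'. j' < q \<and> j' \<noteq> j \<and> hue j j' = M - 1 - x})"
    unfolding ijx EF_Image[OF v[unfolded ijx]] by (intro card_Un_disjoint) auto
  also have "\<dots> = 2 * \<beta> + 2 * \<beta>"
    using hue_card[OF b(1,3)] hue_card[OF b(2,4)] by (simp add: card_image inj_on_def)
  finally show ?thesis by simp
qed

lemma EH_Image: "i < q \<Longrightarrow> j < q \<Longrightarrow> EH `` {(i, j, x)} = (\<lambda>y. (i, j, y)) ` (H `` {x})"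
  by (auto simp: EH_def)

lemma regular_on_E: "regular_on (k + 4 * \<beta>) V E"
  unfolding regular_on_def
proof (intro conjI ballI)
  show "irrefl E" using H_irrefl by (auto simp: irrefl_def E_def EH_def EF_def ER_def EC_def)
  fix v assume v: "v \<in> V"
  obtain i j x where ijx: "v = (i, j, x)" by (cases v)
  have b: "i < q" "j < q" "x < M" using v ijx by (auto simp: V_def)
  have "card (E `` {v}) = card (EH `` {v}) + card (EF `` {v})"
    unfolding E_def Un_Image
  proof (rule card_Un_disjoint)
    show "EH `` {v} \<inter> EF `` {v} = {}" by (auto simp: EH_def EF_def ER_def EC_def)
  qed (use finite_E in \<open>auto intro: finite_Image\<close>)
  also have "card (EH `` {v}) = k"
    unfolding ijx EH_Image[OF b(1,2)] using H_deg[OF b(3)] by (simp add: card_image inj_on_def)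
  finally show "card (E `` {v}) = k + 4 * \<beta>" using EF_deg[OF v] by simp
qed (use E_sub sym_E finite_V in auto)

definition slice :: "(nat \<times> nat \<times> nat) set \<Rightarrow> nat \<times> nat \<Rightarrow> nat set" where
  "slice U e = {x. (fst e, snd e, x) \<in> U}"

lemma slice_sub: "U \<subseteq> V \<Longrightarrow> slice U e \<subseteq> {..<M}"
  by (auto simp: slice_def V_def)

lemma finite_slice: "U \<subseteq> V \<Longrightarrow> finite (slice U e)"
  using slice_sub[of U e] finite_subset[of "slice U e" "{..<M}"] by simp

lemma card_slices:
  assumes "U \<subseteq> V"
  shows "card U = (\<Sum>e\<in>idx. card (slice U e))"
proof -
  have U: "U = (\<lambda>(e, x). (fst e, snd e, x)) ` (SIGMA e:idx. slice U e)"
    using assms by (force simp: idx_def slice_def V_def)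
  have "card U = card (SIGMA e:idx. slice U e)"
    by (subst U, rule card_image) (auto simp: inj_on_def)
  also have "\<dots> = (\<Sum>e\<in>idx. card (slice U e))"
    using assms finite_slice by (intro card_SigmaI) (auto simp: idx_def)
  finally show ?thesis .
qed

lemma card_slice_le: "U \<subseteq> V \<Longrightarrow> card (slice U e) \<le> card U"
proof -
  assume U: "U \<subseteq> V"
  have "card (slice U e) = card ((\<lambda>x. (fst e, snd e, x)) ` slice U e)"
    by (rule card_image[symmetric]) (auto simp: inj_on_def)
  also have "\<dots> \<le> card U"
    using U finite_V by (intro card_mono) (auto simp: slice_def intro: finite_subset)
  finally show ?thesis .
qed

lemma card_EH_boundary:
  assumes "U \<subseteq> V"
  shows "card (EH \<inter> U \<times> (V - U)) = (\<Sum>e\<in>idx. card (H \<inter> slice U e \<times> ({..<M} - slice U e)))"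
proof -
  define f :: "(nat \<times> nat) \<times> (nat \<times> nat) \<Rightarrow> (nat \<times> nat \<times> nat) \<times> (nat \<times> nat \<times> nat)"
    where "f = (\<lambda>((i, j), (x, y)). ((i, j, x), (i, j, y)))"
  have eq: "EH \<inter> U \<times> (V - U) = f ` (SIGMA e:idx. H \<inter> slice U e \<times> ({..<M} - slice U e))"
  proof (intro equalityI subsetI)
    fix a assume a: "a \<in> EH \<inter> U \<times> (V - U)"
    then obtain i j x y where *: "a = ((i, j, x), (i, j, y))" "i < q" "j < q" "(x, y) \<in> H"
      by (auto simp: EH_def)
    have "((i, j), (x, y)) \<in> (SIGMA e:idx. H \<inter> slice U e \<times> ({..<M} - slice U e))"
      using * a H_sub by (auto simp: idx_def slice_def)
    thus "a \<in> f ` (SIGMA e:idx. H \<inter> slice U e \<times> ({..<M} - slice U e))"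
      using *(1) by (intro image_eqI[of _ _ "((i, j), (x, y))"]) (auto simp: f_def)
  next
    fix a assume "a \<in> f ` (SIGMA e:idx. H \<inter> slice U e \<times> ({..<M} - slice U e))"
    thus "a \<in> EH \<inter> U \<times> (V - U)" by (auto simp: f_def EH_def V_def idx_def slice_def)
  qed
  have "card (EH \<inter> U \<times> (V - U)) = card (SIGMA e:idx. H \<inter> slice U e \<times> ({..<M} - slice U e))"
    unfolding eq by (rule card_image) (auto simp: inj_on_def f_def)
  also have "\<dots> = (\<Sum>e\<in>idx. card (H \<inter> slice U e \<times> ({..<M} - slice U e)))"
    using finite_slice[OF assms] by (intro card_SigmaI) (auto simp: idx_def)
  finally show ?thesis .
qed

text \<open>Edges between parts only help: no slice of U is larger than U, and the boundaries inside
  the parts add up.\<close>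

lemma edge_expanding_E:
  assumes "edge_expanding {..<M} H s g"
  shows "edge_expanding V E s g"
  unfolding edge_expanding_def
proof (intro allI impI)
  fix U assume U: "U \<subseteq> V" "real (card U) \<le> s"
  have "g * card U = (\<Sum>e\<in>idx. g * card (slice U e))"
    by (simp add: card_slices[OF U(1)] sum_distrib_left)
  also have "\<dots> \<le> (\<Sum>e\<in>idx. real (card (H \<inter> slice U e \<times> ({..<M} - slice U e))))"
  proof (intro sum_mono)
    fix e
    have "real (card (slice U e)) \<le> s" using card_slice_le[OF U(1), of e] U(2) by linarith
    thus "g * card (slice U e) \<le> card (H \<inter> slice U e \<times> ({..<M} - slice U e))"
      using assms slice_sub[OF U(1)] by (simp add: edge_expanding_def)
  qed
  also have "\<dots> = card (EH \<inter> U \<times> (V - U))" by (simp add: card_EH_boundary[OF U(1)])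
  also have "\<dots> \<le> card (E \<inter> U \<times> (V - U))"
    using finite_E by (intro of_nat_mono card_mono) (auto simp: E_def)
  finally show "g * card U \<le> card (E \<inter> U \<times> (V - U))" .
qed

text \<open>Summed over slices. A slice may meet its own neighbourhood, which costs the 1 in g -
  1.\<close>

lemma card_ext_nbhd_ge:
  assumes "vertex_expanding {..<M} H s g" "U \<subseteq> V" "real (card U) \<le> s"
  shows "(g - 1) * card U \<le> card (E `` U - U)"
proof -
  have sub: "EH `` U - U \<subseteq> V" using EH_sub by auto
  have "(g - 1) * card U = (\<Sum>e\<in>idx. (g - 1) * card (slice U e))"
    by (simp add: card_slices[OF assms(2)] sum_distrib_left)
  also have "\<dots> \<le> (\<Sum>e\<in>idx. real (card (slice (EH `` U - U) e)))"
  proof (intro sum_mono)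
    fix e assume e: "e \<in> idx"
    have "real (card (slice U e)) \<le> s" using card_slice_le[OF assms(2), of e] assms(3) by linarith
    hence "g * card (slice U e) \<le> card (H `` slice U e)"
      using assms(1) slice_sub[OF assms(2)] by (simp add: vertex_expanding_def)
    moreover have "card (H `` slice U e) - card (slice U e) \<le> card (H `` slice U e - slice U e)"
      using finite_slice[OF assms(2)] by (rule diff_card_le_card_Diff)
    moreover have "slice (EH `` U - U) e = H `` slice U e - slice U e"
      using e by (force simp: slice_def EH_def idx_def)
    ultimately show "(g - 1) * card (slice U e) \<le> card (slice (EH `` U - U) e)"
      by (simp add: algebra_simps)
  qed
  also have "\<dots> = card (EH `` U - U)" by (simp add: card_slices[OF sub])
  also have "\<dots> \<le> card (E `` U - U)"
    using finite_E by (intro of_nat_mono card_mono) (auto simp: E_def intro: finite_Image)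
  finally show ?thesis .
qed

text \<open>Canonical paths in the grid: a cell (i, j) in A is joined to a cell (i', j') outside
  through the corner (i', j). One of the two steps leaves A, and its edge together with the one
  coordinate it forgets, out of q values, determines both cells.\<close>

lemma card_EF_cut_parts:
  assumes A: "A \<subseteq> idx"
  defines "P \<equiv> {(i, j, x). (i, j) \<in> A \<and> x < M}"
  shows "card A * (q\<^sup>2 - card A) \<le> q * card (EF \<inter> P \<times> (V - P))"
proof -
  define c1 where "c1 i j i' = (((i, j, hue i i'), (i', j, hue i i')) :: (nat \<times> nat \<times> nat) \<times> (nat \<times> nat \<times> nat))" for i j i'
  define c2 where "c2 i' j j' = (((i', j, M - 1 - hue j j'), (i', j', M - 1 - hue j j')) :: (nat \<times> nat \<times> nat) \<times> (nat \<times> nat \<times> nat))" for i' j j'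
  define \<phi> where "\<phi> = (\<lambda>((i, j), (i', j')). if (i', j) \<notin> A then (c1 i j i', j') else (c2 i' j j', i))"
  have "card (A \<times> (idx - A)) \<le> card ((EF \<inter> P \<times> (V - P)) \<times> {..<q})"
  proof (rule card_inj_on_le)
    show "inj_on \<phi> (A \<times> (idx - A))"
    proof (rule inj_onI)
      fix s t assume st: "s \<in> A \<times> (idx - A)" "t \<in> A \<times> (idx - A)" and eq: "\<phi> s = \<phi> t"
      obtain i j i' j' a b a' b' where "s = ((i, j), (i', j'))" "t = ((a, b), (a', b'))"
        by (metis surj_pair)
      thus "s = t"
        using eq st by (auto simp: \<phi>_def c1_def c2_def split: if_splits)
    qed
    show "\<phi> ` (A \<times> (idx - A)) \<subseteq> (EF \<inter> P \<times> (V - P)) \<times> {..<q}"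
    proof
      fix y assume "y \<in> \<phi> ` (A \<times> (idx - A))"
      then obtain i j i' j' where y: "y = \<phi> ((i, j), (i', j'))"
        and *: "(i, j) \<in> A" "(i', j') \<in> idx" "(i', j') \<notin> A" by auto
      hence b: "i < q" "j < q" "i' < q" "j' < q" using A by (auto simp: idx_def)
      show "y \<in> (EF \<inter> P \<times> (V - P)) \<times> {..<q}"
        unfolding y
      proof (cases "(i', j) \<in> A")
        case False
        hence "i \<noteq> i'" using * by auto
        thus "\<phi> ((i, j), (i', j')) \<in> (EF \<inter> P \<times> (V - P)) \<times> {..<q}"
          using False * b hue_less[of i i']
          by (auto simp: \<phi>_def c1_def EF_def ER_def P_def V_def)
      next
        case True
        hence "j \<noteq> j'" using * by auto
        thus "\<phi> ((i, j), (i', j')) \<in> (EF \<inter> P \<times> (V - P)) \<times> {..<q}"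
          using True * b M_minus_hue_less[of j j']
          by (auto simp: \<phi>_def c2_def EF_def EC_def P_def V_def)
      qed
    qed
    show "finite ((EF \<inter> P \<times> (V - P)) \<times> {..<q})" using finite_E by auto
  qed
  moreover have "card (idx - A) = q\<^sup>2 - card A"
    using A by (subst card_Diff_subset) (auto simp: idx_def power2_eq_square intro: finite_subset)
  ultimately show ?thesis by (simp add: card_cartesian_product mult.commute)
qed

lemma card_EF_incident:
  assumes "X \<subseteq> V"
  shows "card (EF \<inter> X \<times> UNIV) = 4 * \<beta> * card X" "card (EF \<inter> UNIV \<times> X) = 4 * \<beta> * card X"
proof -
  have fX: "finite X" using assms finite_V finite_subset by auto
  have "(\<Sum>u\<in>X. card (EF `` {u})) = (\<Sum>u\<in>X. 4 * \<beta>)"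
    using EF_deg assms by (intro sum.cong) auto
  thus 1: "card (EF \<inter> X \<times> UNIV) = 4 * \<beta> * card X"
    using card_arcs_eq_sum_degrees[OF finite_E(2) fX] by simp
  have "EF \<inter> UNIV \<times> X = (EF \<inter> X \<times> UNIV)\<inverse>"
    using sym_EF by (auto dest: symD)
  thus "card (EF \<inter> UNIV \<times> X) = 4 * \<beta> * card X" using 1 by simp
qed

text \<open>U is compared with P, the union of the parts that it fills by more than half; D is the
  size of the symmetric difference. The edges inside the parts supply at least 5 \<beta> D.
  Exchanging U for P changes the cut between parts by at most 4 \<beta> D, and the remaining \<beta>
  D pays for the vertices where U and P differ. As q > 2 \<beta> M, the grid inequality gives
  \<beta> per vertex of P, or of its complement when P is the larger half.\<close>

lemma card_boundary_ge:
  fixes \<kappa> :: real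
  assumes q: "q = 2 * \<beta> * M + 1" and \<kappa>: "edge_expanding {..<M} H (M / 2) \<kappa>" "5 * real \<beta> \<le> \<kappa>"
    and U: "U \<subseteq> V" "real (card U) \<le> real (card V) / 2"
  shows "\<beta> * card U \<le> card (E \<inter> U \<times> (V - U))"
proof -
  define A where "A = {e \<in> idx. M < 2 * card (slice U e)}"
  define P where "P = {(i, j, x). (i, j) \<in> A \<and> x < M}"
  define D where "D = (\<Sum>e\<in>idx. min (card (slice U e)) (M - card (slice U e)))"
  have PV: "P \<subseteq> V" by (auto simp: P_def A_def idx_def V_def)
  have fin: "finite U" "finite P" using U PV finite_V finite_subset by auto
  have sM: "card (slice U e) \<le> M" for e
    using card_mono[OF _ slice_sub[OF U(1), of e]] by simp
  have symdiff: "card (U - P) + card (P - U) = D"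
  proof -
    have s1: "card (slice (U - P) e) + card (slice (P - U) e) = min (card (slice U e)) (M - card (slice U e))"
      if e: "e \<in> idx" for e
    proof (cases "e \<in> A")
      case True
      hence "slice (U - P) e = {}" "slice (P - U) e = {..<M} - slice U e"
        using slice_sub[OF U(1), of e] by (auto simp: slice_def P_def)
      thus ?thesis using True sM[of e] slice_sub[OF U(1), of e] finite_slice[OF U(1), of e]
        by (auto simp: card_Diff_subset A_def min_def)
    next
      case False
      hence "slice (U - P) e = slice U e" "slice (P - U) e = {}"
        by (auto simp: slice_def P_def)
      thus ?thesis using False e by (simp add: A_def)
    qed
    have "card (U - P) + card (P - U) = (\<Sum>e\<in>idx. card (slice (U - P) e) + card (slice (P - U) e))"
      using card_slices[of "U - P"] card_slices[of "P - U"] U PV by (simp add: sum.distrib subset_iff)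
    thus ?thesis unfolding D_def using s1 by simp
  qed
  have H_part: "\<kappa> * D \<le> card (EH \<inter> U \<times> (V - U))"
  proof -
    have "\<kappa> * D = (\<Sum>e\<in>idx. \<kappa> * min (card (slice U e)) (M - card (slice U e)))"
      by (simp add: D_def sum_distrib_left)
    also have "\<dots> \<le> (\<Sum>e\<in>idx. real (card (H \<inter> slice U e \<times> ({..<M} - slice U e))))"
    proof (intro sum_mono)
      fix e
      define S where "S = slice U e"
      have S: "S \<subseteq> {..<M}" using slice_sub[OF U(1)] by (simp add: S_def)
      have SM: "card S \<le> M" using sM by (simp add: S_def)
      have exp: "\<kappa> * card T \<le> card (H \<inter> T \<times> ({..<M} - T))" if "T \<subseteq> {..<M}" "2 * card T \<le> M" for T
        using \<kappa>(1) that by (simp add: edge_expanding_def)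
      show "\<kappa> * min (card (slice U e)) (M - card (slice U e)) \<le> card (H \<inter> slice U e \<times> ({..<M} - slice U e))"
        unfolding S_def[symmetric]
      proof (cases "2 * card S \<le> M")
        case True
        hence "min (card S) (M - card S) = card S" by auto
        thus "\<kappa> * min (card S) (M - card S) \<le> card (H \<inter> S \<times> ({..<M} - S))"
          using exp[OF S True] by simp
      next
        case False
        \<comment> \<open>For a slice above M / 2 the complement expands, and symmetry of H reverses
          the arcs of its boundary.\<close>
        have c: "card ({..<M} - S) = M - card S" using S finite_subset[OF S] by (simp add: card_Diff_subset)
        have "\<kappa> * card ({..<M} - S) \<le> card (H \<inter> ({..<M} - S) \<times> ({..<M} - ({..<M} - S)))"
          using False c by (intro exp) auto
        also have "{..<M} - ({..<M} - S) = S" using S by auto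
        also have "H \<inter> ({..<M} - S) \<times> S = (H \<inter> S \<times> ({..<M} - S))\<inverse>"
          using H_sym by (auto dest: symD)
        finally have "\<kappa> * (M - card S) \<le> card (H \<inter> S \<times> ({..<M} - S))" unfolding c by simp
        moreover have "min (card S) (M - card S) = M - card S" using False by auto
        ultimately show "\<kappa> * min (card S) (M - card S) \<le> card (H \<inter> S \<times> ({..<M} - S))" by simp
      qed
    qed
    finally show ?thesis by (simp add: card_EH_boundary[OF U(1)])
  qed
  have F_part: "card (EF \<inter> P \<times> (V - P)) \<le> card (EF \<inter> U \<times> (V - U)) + 4 * \<beta> * D"
  proof -
    \<comment> \<open>An arc out of P that does not leave U starts in P - U or ends in U -
      P.\<close>
    have "EF \<inter> P \<times> (V - P) \<subseteq> EF \<inter> U \<times> (V - U) \<union> (EF \<inter> (P - U) \<times> UNIV \<union> EF \<inter> UNIV \<times> (U - P))" by auto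
    hence "card (EF \<inter> P \<times> (V - P)) \<le> card (EF \<inter> U \<times> (V - U) \<union> (EF \<inter> (P - U) \<times> UNIV \<union> EF \<inter> UNIV \<times> (U - P)))"
      using finite_E by (intro card_mono) auto
    also have "\<dots> \<le> card (EF \<inter> U \<times> (V - U)) + (card (EF \<inter> (P - U) \<times> UNIV) + card (EF \<inter> UNIV \<times> (U - P)))"
      by (meson add_left_mono card_Un_le order_trans)
    also have "card (EF \<inter> (P - U) \<times> UNIV) + card (EF \<inter> UNIV \<times> (U - P)) = 4 * \<beta> * D"
      using card_EF_incident[of "P - U"] card_EF_incident[of "U - P"] PV U
      by (simp add: symdiff[symmetric] algebra_simps subset_iff)
    finally show ?thesis by simp
  qed
  have split: "card (E \<inter> U \<times> (V - U)) = card (EH \<inter> U \<times> (V - U)) + card (EF \<inter> U \<times> (V - U))"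
  proof -
    have "E \<inter> U \<times> (V - U) = (EH \<inter> U \<times> (V - U)) \<union> (EF \<inter> U \<times> (V - U))" by (auto simp: E_def)
    moreover have "EH \<inter> EF = {}" by (auto simp: EH_def EF_def ER_def EC_def)
    ultimately show ?thesis using finite_E by (simp add: card_Un_disjoint Int_Un_distrib disjoint_iff)
  qed
  define a where "a = card A"
  have aq: "a \<le> q\<^sup>2"
  proof -
    have "a \<le> card idx" unfolding a_def by (rule card_mono) (auto simp: A_def idx_def)
    thus ?thesis by (simp add: idx_def power2_eq_square)
  qed
  have cP: "card P = a * M"
  proof -
    have "P = (\<lambda>((i, j), x). (i, j, x)) ` (A \<times> {..<M})" by (force simp: P_def)
    also have "card \<dots> = card (A \<times> {..<M})" by (rule card_image) (auto simp: inj_on_def)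
    finally show ?thesis by (simp add: a_def card_cartesian_product)
  qed
  have UP: "card U \<le> a * M + D" "a * M \<le> card U + D"
  proof -
    have "card U \<le> card P + card (U - P)"
      using card_mono[of "P \<union> (U - P)" U] card_Un_le[of P "U - P"] fin by auto
    thus "card U \<le> a * M + D" using symdiff cP by linarith
    have "card P \<le> card U + card (P - U)"
      using card_mono[of "U \<union> (P - U)" P] card_Un_le[of U "P - U"] fin by auto
    thus "a * M \<le> card U + D" using symdiff cP by linarith
  qed
  define Q where "Q = real q"
  have Q: "Q \<ge> 2 * real \<beta> * M" "Q > 0" by (simp_all add: Q_def q add_pos_nonneg)
  have cut: "real a * (Q\<^sup>2 - a) \<le> Q * card (EF \<inter> P \<times> (V - P))"
  proof -
    have "real (a * (q\<^sup>2 - a)) \<le> real (q * card (EF \<inter> P \<times> (V - P)))"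
      unfolding of_nat_le_iff a_def P_def by (rule card_EF_cut_parts) (auto simp: A_def)
    thus ?thesis using aq by (simp add: Q_def of_nat_diff)
  qed
  have U2: "2 * real (card U) \<le> Q\<^sup>2 * M" using U(2) by (simp add: card_V Q_def)
  have main: "real \<beta> * real (card U) \<le> \<kappa> * D + (real (card (EF \<inter> P \<times> (V - P))) - 4 * real \<beta> * D)"
  proof (cases "2 * real a \<le> Q\<^sup>2")
    case True
    have "real a * (Q\<^sup>2 / 2) \<le> real a * (Q\<^sup>2 - a)" using True by (intro mult_left_mono) auto
    hence "Q * (Q / 2 * a) \<le> Q * card (EF \<inter> P \<times> (V - P))" using cut by (simp add: power2_eq_square algebra_simps)
    hence "Q / 2 * a \<le> card (EF \<inter> P \<times> (V - P))" using Q(2) by simp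
    moreover have "real \<beta> * M * a \<le> Q / 2 * a" using Q(1) by (intro mult_right_mono) auto
    moreover have "real \<beta> * real (card U) \<le> real \<beta> * (real a * M + D)"
      using UP(1) by (intro mult_left_mono) (simp_all flip: of_nat_mult of_nat_add)
    moreover have "5 * real \<beta> * D \<le> \<kappa> * D" using \<kappa>(2) by (intro mult_right_mono) auto
    ultimately show ?thesis by (simp add: algebra_simps)
  next
    case False
    \<comment> \<open>More than half of the parts lie in A: as U has at most half of all vertices,
      \<open>card U - D\<close> is at most the number of vertices outside P.\<close>
    have "Q\<^sup>2 / 2 * (Q\<^sup>2 - a) \<le> real a * (Q\<^sup>2 - a)"
      using False aq by (intro mult_right_mono) (auto simp: Q_def simp flip: of_nat_power)
    hence "Q\<^sup>2 / 2 * (Q\<^sup>2 - a) \<le> Q * card (EF \<inter> P \<times> (V - P))" using cut by (rule order_trans)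
    moreover have "Q * (Q / 2 * (Q\<^sup>2 - a)) = Q\<^sup>2 / 2 * (Q\<^sup>2 - a)" by (simp add: power2_eq_square)
    ultimately have "Q * (Q / 2 * (Q\<^sup>2 - a)) \<le> Q * card (EF \<inter> P \<times> (V - P))" by linarith
    hence "Q / 2 * (Q\<^sup>2 - a) \<le> card (EF \<inter> P \<times> (V - P))" using Q(2) by simp
    moreover have "real \<beta> * M * (Q\<^sup>2 - a) \<le> Q / 2 * (Q\<^sup>2 - a)"
      using Q(1) aq by (intro mult_right_mono) (auto simp: Q_def simp flip: of_nat_power)
    moreover have "real \<beta> * (real (card U) - D) \<le> real \<beta> * (M * (Q\<^sup>2 - a))"
    proof (rule mult_left_mono)
      have "real a * M \<le> card U + D" using UP(2) by (simp flip: of_nat_mult of_nat_add)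
      thus "real (card U) - D \<le> M * (Q\<^sup>2 - a)" using U2 by (simp add: algebra_simps)
    qed simp
    moreover have "5 * real \<beta> * D \<le> \<kappa> * D" using \<kappa>(2) by (intro mult_right_mono) auto
    ultimately show ?thesis by (simp add: algebra_simps)
  qed
  have "real (card (EF \<inter> P \<times> (V - P))) \<le> card (EF \<inter> U \<times> (V - U)) + 4 * real \<beta> * D"
    using of_nat_mono[OF F_part, where ?'a = real] by simp
  hence "real \<beta> * real (card U) \<le> card (E \<inter> U \<times> (V - U))"
    using main H_part split by simp
  thus ?thesis by (simp flip: of_nat_mult)
qed

end

section \<open>Isolated components on the diagonal\<close>

lemma perc_le_1: "0 \<le> p \<Longrightarrow> p \<le> 1 \<Longrightarrow> finite V \<Longrightarrow> (\<And>W. W \<subseteq> V \<Longrightarrow> f W \<le> 1) \<Longrightarrow> perc p V f \<le> 1"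
  using perc_mono[of p V f "\<lambda>_. 1"] by simp

context blowup
begin

definition diag :: "nat \<Rightarrow> nat \<Rightarrow> nat \<times> nat \<times> nat" where
  "diag i x = (i, i, x)"

definition diag_part :: "nat \<Rightarrow> (nat \<times> nat \<times> nat) set" where
  "diag_part i = diag i ` {..<M}"

definition diag_edges :: "nat \<Rightarrow> (nat \<times> nat \<times> nat) rel" where
  "diag_edges i = map_prod (diag i) (diag i) ` H"

text \<open>The vertices on which \<open>isolated\<close> depends for the part i; disjointness of
  these sets yields independence of the parts.\<close>

definition territory :: "nat \<Rightarrow> (nat \<times> nat \<times> nat) set" where
  "territory i = diag_part i \<union> EF `` diag_part i"

definition isolated :: "nat \<Rightarrow> nat \<Rightarrow> (nat \<times> nat \<times> nat) set \<Rightarrow> bool" where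
  "isolated s i W \<longleftrightarrow> (\<exists>v\<in>W \<inter> diag_part i. s \<le> card (reach (diag_edges i) {v} (W \<inter> diag_part i)) \<and>
     EF `` reach (diag_edges i) {v} (W \<inter> diag_part i) \<inter> W = {})"

lemma inj_diag: "inj_on (diag i) A"
  by (auto simp: inj_on_def diag_def)

lemma diag_part_sub: "i < q \<Longrightarrow> diag_part i \<subseteq> V"
  by (auto simp: diag_part_def diag_def V_def)

lemma mem_diag_part: "(a, b, x) \<in> diag_part i \<longleftrightarrow> a = i \<and> b = i \<and> x < M"
  by (auto simp: diag_part_def diag_def)

lemma finite_diag_part: "finite (diag_part i)"
  by (simp add: diag_part_def)

lemma diag_edges_iff: "i < q \<Longrightarrow> x \<in> diag_part i \<Longrightarrow> (x, y) \<in> diag_edges i \<longleftrightarrow> (x, y) \<in> EH"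
  by (cases x; cases y) (force simp: diag_edges_def diag_def EH_def mem_diag_part)

lemma diag_edges_sub: "diag_edges i \<subseteq> diag_part i \<times> diag_part i"
  using H_sub by (auto simp: diag_edges_def diag_part_def)

lemma territory_sub: "i < q \<Longrightarrow> territory i \<subseteq> V"
  using diag_part_sub EF_sub by (auto simp: territory_def)

lemma finite_territory: "i < q \<Longrightarrow> finite (territory i)"
  using territory_sub finite_V finite_subset by blast

lemma EF_diag_part:
  assumes "i < q" "(a, b, x) \<in> EF `` diag_part i"
  shows "(b = i \<and> a \<noteq> i \<and> a < q \<and> x = hue i a) \<or> (a = i \<and> b \<noteq> i \<and> b < q \<and> x = M - 1 - hue i b)"
  using assms by (auto simp: EF_def ER_def EC_def mem_diag_part)

text \<open>The outside neighbours of the part (i, i) lie in row i and column i, so two territories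
  can meet only in the cells (i, j) and (j, i). A common vertex there would be both
  \<open>hue i j\<close> and its reversal, making M odd.\<close>

lemma disjoint_territories: "disjoint_family_on territory {..<q}"
  unfolding disjoint_family_on_def
proof (intro ballI impI equals0I)
  fix i j v assume ij: "i \<in> {..<q}" "j \<in> {..<q}" "i \<noteq> j" and v: "v \<in> territory i \<inter> territory j"
  obtain a b x where abx: "v = (a, b, x)" by (cases v)
  have parity: "hue i j \<noteq> M - 1 - hue j i"
  proof
    assume "hue i j = M - 1 - hue j i"
    hence "M = 2 * hue i j + 1" using hue_less[of i j] ij hue_sym[of i j] by simp
    thus False using even_M by simp
  qed
  have T: "(a = l \<and> b = l) \<or> (b = l \<and> a \<noteq> l \<and> x = hue l a) \<or> (a = l \<and> b \<noteq> l \<and> x = M - 1 - hue l b)"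
    if "l < q" "v \<in> territory l" for l
    using that EF_diag_part[of l a b x] by (auto simp: territory_def abx mem_diag_part)
  show False
    using T[of i] T[of j] v ij parity hue_sym[of i j] by auto
qed

text \<open>With every outside neighbour of K closed, no step of E inside W leaves K, so a component
  within the part is already a component of the whole graph.\<close>

lemma isolated_component:
  assumes i: "i < q" and iso: "isolated s i (W \<inter> territory i)"
  shows "\<exists>v\<in>W \<inter> diag_part i. s \<le> card (reach E {v} W) \<and> reach E {v} W \<subseteq> diag_part i"
proof -
  have "W \<inter> territory i \<inter> diag_part i = W \<inter> diag_part i" by (auto simp: territory_def)
  then obtain v where v: "v \<in> W \<inter> diag_part i" "s \<le> card (reach (diag_edges i) {v} (W \<inter> diag_part i))"
    "EF `` reach (diag_edges i) {v} (W \<inter> diag_part i) \<inter> (W \<inter> territory i) = {}"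
    using iso by (auto simp: isolated_def)
  define K where "K = reach (diag_edges i) {v} (W \<inter> diag_part i)"
  have KP: "K \<subseteq> W \<inter> diag_part i" using reach_subset[of "diag_edges i" "{v}" "W \<inter> diag_part i"] v(1)
    by (auto simp: K_def)
  have EFK: "EF `` K \<inter> W = {}" using v(3) KP unfolding K_def[symmetric] by (auto simp: territory_def)
  have "reach E {v} W = K"
  proof
    show "reach E {v} W \<subseteq> K"
    proof (rule reach_minimal)
      show "{v} \<subseteq> K" using subset_reach[of "{v}" "diag_edges i"] by (simp add: K_def)
      fix x y assume *: "x \<in> K" "(x, y) \<in> E" "y \<in> {v} \<union> W"
      hence yW: "y \<in> W" using v by auto
      hence "(x, y) \<notin> EF" using * EFK by auto
      hence "(x, y) \<in> diag_edges i" using * KP diag_edges_iff[OF i, of x y] by (auto simp: E_def)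
      moreover have "y \<in> diag_part i" using \<open>(x, y) \<in> diag_edges i\<close> diag_edges_sub by auto
      ultimately show "y \<in> K" using *(1) yW reach_step[of x "diag_edges i" "{v}" "W \<inter> diag_part i" y]
        by (simp add: K_def)
    qed
    show "K \<subseteq> reach E {v} W"
      unfolding K_def
    proof (rule reach_minimal)
      fix x y assume *: "x \<in> reach E {v} W" "(x, y) \<in> diag_edges i" "x \<in> {v} \<union> W \<inter> diag_part i"
        "y \<in> {v} \<union> W \<inter> diag_part i"
      hence "(x, y) \<in> E" using v diag_edges_iff[OF i, of x y] by (auto simp: E_def)
      thus "y \<in> reach E {v} W" using * reach_step[of x E "{v}" W y] by auto
    qed (rule subset_reach)
  qed
  thus ?thesis using v KP by (intro bexI[of _ v]) (auto simp: K_def)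
qed

lemma card_EF_Image_le:
  assumes "K \<subseteq> V"
  shows "card (EF `` K) \<le> 4 * \<beta> * card K"
proof -
  have fK: "finite K" using assms finite_V finite_subset by auto
  have "EF `` K = snd ` (EF \<inter> K \<times> UNIV)" by force
  hence "card (EF `` K) \<le> card (EF \<inter> K \<times> UNIV)"
    using finite_E by (simp add: card_image_le)
  thus ?thesis using card_EF_incident(1)[OF assms] by simp
qed

text \<open>The part is revealed first. The neighbours to be closed lie outside it, hence are still
  unrevealed, and there are at most n of them since each vertex of the component has 4
  \<beta>.\<close>

lemma perc_isolated_ge:
  fixes k\<^sub>1 :: real
  assumes p: "0 \<le> p" "p \<le> 1" and i: "i < q" and n: "4 * \<beta> * k\<^sub>1 \<le> n"
  shows "perc p (diag_part i) (\<lambda>W. of_bool (\<exists>v\<in>W. s \<le> card (reach (diag_edges i) {v} W) \<and> card (reach (diag_edges i) {v} W) \<le> k\<^sub>1)) * (1 - p) ^ n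
    \<le> perc p (territory i) (\<lambda>W. of_bool (isolated s i W))"
proof -
  define N where "N = EF `` diag_part i"
  have disj: "diag_part i \<inter> N = {}"
    using EF_diag_part[OF i] unfolding N_def by (force simp: diag_part_def diag_def)
  have finN: "finite N" unfolding N_def using finite_E by (auto intro: finite_Image)
  have "perc p (diag_part i) (\<lambda>W. of_bool (\<exists>v\<in>W. s \<le> card (reach (diag_edges i) {v} W) \<and> card (reach (diag_edges i) {v} W) \<le> k\<^sub>1)) * (1 - p) ^ n
    = perc p (diag_part i) (\<lambda>W. (1 - p) ^ n * of_bool (\<exists>v\<in>W. s \<le> card (reach (diag_edges i) {v} W) \<and> card (reach (diag_edges i) {v} W) \<le> k\<^sub>1))"
    by (simp add: perc_cmult mult.commute)
  also have "\<dots> \<le> perc p (diag_part i) (\<lambda>X. perc p N (\<lambda>Y. of_bool (isolated s i (X \<union> Y))))"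
  proof (rule perc_mono[OF p])
    fix X assume X: "X \<subseteq> diag_part i"
    have nn: "0 \<le> perc p N (\<lambda>Y. of_bool (isolated s i (X \<union> Y)))"
      by (intro perc_nonneg p) auto
    show "(1 - p) ^ n * of_bool (\<exists>v\<in>X. s \<le> card (reach (diag_edges i) {v} X) \<and> card (reach (diag_edges i) {v} X) \<le> k\<^sub>1)
      \<le> perc p N (\<lambda>Y. of_bool (isolated s i (X \<union> Y)))"
    proof (cases "\<exists>v\<in>X. s \<le> card (reach (diag_edges i) {v} X) \<and> card (reach (diag_edges i) {v} X) \<le> k\<^sub>1")
      case True
      then obtain v where v: "v \<in> X" "s \<le> card (reach (diag_edges i) {v} X)" "card (reach (diag_edges i) {v} X) \<le> k\<^sub>1"
        by auto
      define K where "K = reach (diag_edges i) {v} X"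
      have KX: "K \<subseteq> X" using reach_subset[of "diag_edges i" "{v}" X] v(1) by (auto simp: K_def)
      have KV: "K \<subseteq> V" using KX X diag_part_sub[OF i] by auto
      have "EF `` K \<subseteq> N" using KX X by (auto simp: N_def)
      have "card (EF `` K) \<le> n"
      proof -
        have "real (card (EF `` K)) \<le> real (4 * \<beta> * card K)"
          using card_EF_Image_le[OF KV] of_nat_le_iff by blast
        also have "\<dots> \<le> 4 * \<beta> * k\<^sub>1" using v(3) by (simp add: K_def mult_left_mono)
        finally show ?thesis using n by simp
      qed
      hence "(1 - p) ^ n \<le> (1 - p) ^ card (EF `` K)" using p by (intro power_decreasing) auto
      also have "\<dots> = perc p N (\<lambda>Y. of_bool (EF `` K \<inter> Y = {}))"
        using perc_avoid[OF finN \<open>EF `` K \<subseteq> N\<close>] by simp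
      also have "\<dots> \<le> perc p N (\<lambda>Y. of_bool (isolated s i (X \<union> Y)))"
      proof (rule perc_mono[OF p])
        fix Y assume Y: "Y \<subseteq> N"
        have eq: "(X \<union> Y) \<inter> diag_part i = X" using X Y disj by auto
        have "EF `` K \<inter> X = {}" using X \<open>EF `` K \<subseteq> N\<close> disj by auto
        hence "isolated s i (X \<union> Y)" if "EF `` K \<inter> Y = {}"
          unfolding isolated_def eq using that v K_def by (intro bexI[of _ v]) auto
        thus "of_bool (EF `` K \<inter> Y = {}) \<le> (of_bool (isolated s i (X \<union> Y)) :: real)" by auto
      qed
      finally show ?thesis using True by simp
    next
      case False
      hence "of_bool (\<exists>v\<in>X. s \<le> card (reach (diag_edges i) {v} X) \<and> card (reach (diag_edges i) {v} X) \<le> k\<^sub>1) = (0::real)"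
        by (simp only: of_bool_eq)
      thus ?thesis using nn by (simp only: mult_zero_right)
    qed
  qed
  also have "\<dots> = perc p (diag_part i \<union> N) (\<lambda>W. of_bool (isolated s i W))"
    using disj finN finite_diag_part by (simp add: perc_Un)
  finally show ?thesis by (simp add: territory_def N_def)
qed

text \<open>The two components come from two disjoint groups of h diagonal parts, each group
  containing no isolated one with probability at most (1 - \<mu>)^h. They are distinct because each
  stays in its own part.\<close>

lemma perc_two_components_ge:
  assumes p: "0 \<le> p" "p \<le> 1" and h: "2 * h \<le> q" and \<mu>: "0 \<le> \<mu>"
    and iso: "\<And>i. i < q \<Longrightarrow> \<mu> \<le> perc p (territory i) (\<lambda>W. of_bool (isolated s i W))"
  shows "1 - 2 * (1 - \<mu>) ^ h \<le> perc p V (\<lambda>W. of_bool (\<exists>u\<in>W. \<exists>w\<in>W. reach E {u} W \<noteq> reach E {w} W \<and>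
     s \<le> card (reach E {u} W) \<and> s \<le> card (reach E {w} W)))"
proof -
  have none: "perc p V (\<lambda>W. of_bool (\<forall>i\<in>I. \<not> isolated s i (W \<inter> territory i))) \<le> (1 - \<mu>) ^ h"
    if "I \<subseteq> {..<q}" "card I = h" for I
  proof -
    have fin: "finite I" using that finite_subset by auto
    have "perc p V (\<lambda>W. of_bool (\<forall>i\<in>I. \<not> isolated s i (W \<inter> territory i)))
      = (\<Prod>i\<in>I. 1 - perc p (territory i) (\<lambda>W. of_bool (isolated s i W)))"
    proof (rule perc_none[OF fin finite_V])
      show "disjoint_family_on territory I"
        using disjoint_territories that(1) by (rule disjoint_family_on_mono[rotated])
    qed (use that territory_sub in auto)
    also have "\<dots> \<le> (\<Prod>i\<in>I. 1 - \<mu>)"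
    proof (rule prod_mono)
      fix i assume "i \<in> I"
      hence "i < q" using that by auto
      thus "0 \<le> 1 - perc p (territory i) (\<lambda>W. of_bool (isolated s i W)) \<and>
        1 - perc p (territory i) (\<lambda>W. of_bool (isolated s i W)) \<le> 1 - \<mu>"
        using iso perc_le_1[OF p finite_territory, of i "\<lambda>W. of_bool (isolated s i W)"] by auto
    qed
    finally show ?thesis using that by simp
  qed
  have "1 - 2 * (1 - \<mu>) ^ h \<le> 1 - perc p V (\<lambda>W. of_bool (\<forall>i\<in>{..<h}. \<not> isolated s i (W \<inter> territory i)))
     - perc p V (\<lambda>W. of_bool (\<forall>i\<in>{h..<2 * h}. \<not> isolated s i (W \<inter> territory i)))"
  proof -
    have "{..<h} \<subseteq> {..<q}" "{h..<2 * h} \<subseteq> {..<q}" using h by auto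
    thus ?thesis using none[of "{..<h}"] none[of "{h..<2 * h}"] by simp
  qed
  also have "\<dots> = perc p V (\<lambda>W. 1 - of_bool (\<forall>i\<in>{..<h}. \<not> isolated s i (W \<inter> territory i))
     - of_bool (\<forall>i\<in>{h..<2 * h}. \<not> isolated s i (W \<inter> territory i)))"
    using finite_V by (simp add: perc_diff)
  also have "\<dots> \<le> perc p V (\<lambda>W. of_bool (\<exists>u\<in>W. \<exists>w\<in>W. reach E {u} W \<noteq> reach E {w} W \<and>
     s \<le> card (reach E {u} W) \<and> s \<le> card (reach E {w} W)))"
  proof (rule perc_mono[OF p])
    fix W assume W: "W \<subseteq> V"
    show "1 - of_bool (\<forall>i\<in>{..<h}. \<not> isolated s i (W \<inter> territory i))
       - of_bool (\<forall>i\<in>{h..<2 * h}. \<not> isolated s i (W \<inter> territory i))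
      \<le> (of_bool (\<exists>u\<in>W. \<exists>w\<in>W. reach E {u} W \<noteq> reach E {w} W \<and>
     s \<le> card (reach E {u} W) \<and> s \<le> card (reach E {w} W)) :: real)"
    proof (cases "(\<exists>i\<in>{..<h}. isolated s i (W \<inter> territory i)) \<and> (\<exists>i\<in>{h..<2 * h}. isolated s i (W \<inter> territory i))")
      case True
      then obtain i j where ij: "i < h" "h \<le> j" "j < 2 * h" "isolated s i (W \<inter> territory i)" "isolated s j (W \<inter> territory j)"
        by auto
      obtain u where u: "u \<in> W \<inter> diag_part i" "s \<le> card (reach E {u} W)" "reach E {u} W \<subseteq> diag_part i"
        using isolated_component[of i s W] ij h by auto
      obtain w where w: "w \<in> W \<inter> diag_part j" "s \<le> card (reach E {w} W)"
        using isolated_component[of j s W] ij h by auto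
      have "w \<notin> diag_part i" using w(1) ij by (cases w) (auto simp: mem_diag_part)
      hence "reach E {u} W \<noteq> reach E {w} W" using u(3) subset_reach[of "{w}" E W] by auto
      thus ?thesis using u w by auto
    qed auto
  qed
  finally show ?thesis .
qed

end

section \<open>Transfer to the definitions of the statement\<close>

lemma prob_random_subset_pmf:
  assumes "finite V" "0 \<le> p" "p \<le> 1"
  shows "measure_pmf.prob (random_subset_pmf V p) S = perc p V (\<lambda>W. of_bool (W \<in> S))"
proof -
  define P where "P = Pi_pmf V False (\<lambda>_. bernoulli_pmf p)"
  have pmf: "pmf (random_subset_pmf V p) W = p ^ card W * (1 - p) ^ card (V - W)" if W: "W \<subseteq> V" for W
  proof -
    \<comment> \<open>Functions in the support are False off V, so W has at most one preimage
      there.\<close>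
    have "set_pmf P \<subseteq> {f. \<forall>x. x \<notin> V \<longrightarrow> f x = False}"
      unfolding P_def by (rule set_Pi_pmf_subset[OF assms(1)])
    hence "((\<lambda>f. {v \<in> V. f v}) -` {W}) \<inter> set_pmf P = {\<lambda>v. v \<in> W} \<inter> set_pmf P"
      using W by auto
    hence "measure_pmf.prob P ((\<lambda>f. {v \<in> V. f v}) -` {W}) = measure_pmf.prob P {\<lambda>v. v \<in> W}"
      using measure_Int_set_pmf[of P "(\<lambda>f. {v \<in> V. f v}) -` {W}"] measure_Int_set_pmf[of P "{\<lambda>v. v \<in> W}"]
      by simp
    hence "pmf (random_subset_pmf V p) W = measure_pmf.prob P {\<lambda>v. v \<in> W}"
      unfolding random_subset_pmf_def P_def[symmetric] pmf_map .
    also have "\<dots> = pmf P (\<lambda>v. v \<in> W)" by (simp add: measure_pmf_single)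
    also have "\<dots> = (\<Prod>v\<in>V. pmf (bernoulli_pmf p) (v \<in> W))"
      unfolding P_def using assms W by (intro pmf_Pi') auto
    also have "\<dots> = (\<Prod>v\<in>V. if v \<in> W then p else 1 - p)"
      using assms by (intro prod.cong) auto
    also have "\<dots> = p ^ card W * (1 - p) ^ card (V - W)"
    proof -
      have "V \<inter> {v. v \<in> W} = W" "V \<inter> - {v. v \<in> W} = V - W" using W by auto
      thus ?thesis using assms by (simp add: prod.If_cases)
    qed
    finally show ?thesis .
  qed
  have "set_pmf (random_subset_pmf V p) \<subseteq> Pow V" by (auto simp: random_subset_pmf_def)
  hence "S \<inter> set_pmf (random_subset_pmf V p) = (S \<inter> Pow V) \<inter> set_pmf (random_subset_pmf V p)" by auto
  hence "measure_pmf.prob (random_subset_pmf V p) S = measure_pmf.prob (random_subset_pmf V p) (S \<inter> Pow V)"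
    using measure_Int_set_pmf[of "random_subset_pmf V p" S]
      measure_Int_set_pmf[of "random_subset_pmf V p" "S \<inter> Pow V"] by simp
  also have "\<dots> = (\<Sum>W\<in>S \<inter> Pow V. pmf (random_subset_pmf V p) W)"
    using assms by (intro measure_measure_pmf_finite) auto
  also have "\<dots> = (\<Sum>W\<in>S \<inter> Pow V. p ^ card W * (1 - p) ^ card (V - W))"
    using pmf by (intro sum.cong) auto
  also have "\<dots> = perc p V (\<lambda>W. of_bool (W \<in> S))"
    unfolding perc_def using assms by (intro sum.mono_neutral_cong_left) auto
  finally show ?thesis .
qed

lemma pair_graph_of_regular_on:
  assumes "regular_on d V E"
  shows "pair_graph \<lparr>pverts = V, parcs = E\<rparr>"
proof -
  have E: "finite V" "E \<subseteq> V \<times> V" "sym E" "irrefl E" using assms by (auto simp: regular_on_def)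
  have "finite E" using E finite_subset by blast
  thus ?thesis using E by unfold_locales (auto simp: symmetric_def irrefl_def)
qed

lemma regular_graph_of_regular_on:
  assumes "regular_on d V E" "card V = n"
  shows "regular_graph d n \<lparr>pverts = V, parcs = E\<rparr>"
  unfolding regular_graph_def
proof (intro conjI ballI)
  fix v assume "v \<in> pverts \<lparr>pverts = V, parcs = E\<rparr>"
  moreover have "{e \<in> E. fst e = v} = Pair v ` (E `` {v})" by force
  ultimately show "out_degree (with_proj \<lparr>pverts = V, parcs = E\<rparr>) v = d"
    using assms by (simp add: out_degree_def out_arcs_def card_image inj_on_def regular_on_def)
qed (use assms pair_graph_of_regular_on in auto)

text \<open>Connectedness is defined by walks in the symmetric closure, which adds nothing here as E
  is symmetric. In a connected graph between the two induced ones every vertex is on a walk from v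
  inside W, hence lies in \<open>reach\<close>, and wellformedness then confines the arcs.\<close>

lemma reach_in_graph_components:
  assumes E: "E \<subseteq> V \<times> V" "sym E" and v: "v \<in> W"
  shows "with_proj \<lparr>pverts = V, parcs = E\<rparr> \<restriction> reach E {v} W
    \<in> graph_components (with_proj \<lparr>pverts = V, parcs = E\<rparr> \<restriction> W)"
proof -
  define G where "G = with_proj \<lparr>pverts = V, parcs = E\<rparr>"
  define K where "K = reach E {v} W"
  have K: "K \<subseteq> W" "v \<in> K" using v reach_subset[of E "{v}" W] subset_reach[of "{v}" E W]
    by (auto simp: K_def)
  have step: "y \<in> K" if "x \<in> K" "(x, y) \<in> E" "y \<in> W" for x y
    using that reach_step[of x E "{v}" W y] by (simp add: K_def)
  have wf: "wf_digraph (G \<restriction> A)" for A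
    by unfold_locales auto
  have ends: "arcs_ends (G \<restriction> A) = E \<inter> A \<times> A" for A
    by (auto simp: arcs_ends_conv G_def image_iff)
  have subKW: "subgraph (G \<restriction> K) (G \<restriction> W)"
    using K wf by (auto simp: subgraph_def compatible_def)
  have conn: "connected (G \<restriction> K)"
    unfolding connected_conv
  proof (intro conjI ballI)
    let ?R = "rtrancl_on K ((E \<inter> K \<times> K)\<^sup>s)"
    have from_v: "(v, y) \<in> ?R" if "y \<in> K" for y
    proof -
      have "(v, y) \<in> (E \<inter> ({v} \<union> W) \<times> ({v} \<union> W))\<^sup>*" using that by (auto simp: K_def reach_def)
      hence "y \<in> K \<and> (v, y) \<in> ?R"
      proof (induction rule: rtrancl_induct)
        case (step y z)
        hence "z \<in> K" using \<open>\<And>x y. x \<in> K \<Longrightarrow> (x, y) \<in> E \<Longrightarrow> y \<in> W \<Longrightarrow> y \<in> K\<close> v by auto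
        moreover have "(y, z) \<in> (E \<inter> K \<times> K)\<^sup>s" using step \<open>z \<in> K\<close> by (auto simp: symcl_def)
        ultimately show ?case using step by (auto intro: rtrancl_on_into_rtrancl_on)
      qed (use K in auto)
      thus ?thesis by simp
    qed
    fix x y assume xy: "x \<in> verts (G \<restriction> K)" "y \<in> verts (G \<restriction> K)"
    have "sym ((E \<inter> K \<times> K)\<^sup>s)" by (auto simp: symcl_def sym_def)
    hence "sym ?R" by (rule rtrancl_on_sym)
    hence "(x, v) \<in> ?R" using from_v[of x] xy by (auto dest: symD)
    thus "(x, y) \<in> rtrancl_on (verts (G \<restriction> K)) ((arcs_ends (G \<restriction> K))\<^sup>s)"
      using from_v[of y] xy unfolding ends by (auto intro: rtrancl_on_trans)
  qed (use K in auto)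
  have max: "H' = G \<restriction> K" if H': "subgraph (G \<restriction> K) H'" "subgraph H' (G \<restriction> W)" "connected H'" for H'
  proof -
    have sub: "K \<subseteq> verts H'" "verts H' \<subseteq> W" "arcs (G \<restriction> K) \<subseteq> arcs H'" "arcs H' \<subseteq> arcs (G \<restriction> W)"
      "tail H' = tail G" "head H' = head G" "wf_digraph H'"
      using H'(1,2) by (auto simp: subgraph_def compatible_def)
    have arcsE: "(x, y) \<in> E \<and> x \<in> W \<and> y \<in> W" if "(x, y) \<in> (arcs_ends H')\<^sup>s" for x y
      using that sub E(2) by (auto simp: symcl_def arcs_ends_conv G_def dest: symD)
    have "w \<in> K" if w: "w \<in> verts H'" for w
    proof -
      have "(v, w) \<in> rtrancl_on (verts H') ((arcs_ends H')\<^sup>s)"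
        using H'(3) K(2) sub(1) w unfolding connected_conv by blast
      thus ?thesis
      proof (induction rule: rtrancl_on_induct)
        case (step y z)
        thus ?case using arcsE[of y z] \<open>\<And>x y. x \<in> K \<Longrightarrow> (x, y) \<in> E \<Longrightarrow> y \<in> W \<Longrightarrow> y \<in> K\<close> by auto
      qed (rule K)
    qed
    hence verts: "verts H' = K" using sub by auto
    have "arcs H' \<subseteq> arcs (G \<restriction> K)"
    proof
      fix e assume e: "e \<in> arcs H'"
      hence "tail H' e \<in> verts H'" "head H' e \<in> verts H'"
        using wf_digraph.tail_in_verts[OF sub(7)] wf_digraph.head_in_verts[OF sub(7)] by blast+
      thus "e \<in> arcs (G \<restriction> K)" using e sub verts by auto
    qed
    hence "arcs H' = arcs (G \<restriction> K)" using sub by auto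
    thus ?thesis using verts sub by (intro pre_digraph.equality) auto
  qed
  have "pre_digraph.max_subgraph (G \<restriction> W) connected (G \<restriction> K)"
    unfolding pre_digraph.max_subgraph_def using subKW conn max by auto
  thus ?thesis by (simp add: graph_components_def G_def K_def)
qed

section \<open>Transport of percolation along an injection\<close>

lemma perc_image:
  assumes "inj_on f V"
  shows "perc p (f ` V) g = perc p V (\<lambda>W. g (f ` W))"
proof -
  have "perc p (f ` V) g = (\<Sum>W\<in>(`) f ` Pow V. p ^ card W * (1 - p) ^ card (f ` V - W) * g W)"
    by (simp add: perc_def image_Pow_surj)
  also have "\<dots> = (\<Sum>W\<in>Pow V. p ^ card (f ` W) * (1 - p) ^ card (f ` V - f ` W) * g (f ` W))"
    using assms by (subst sum.reindex) (auto intro: inj_on_image_Pow)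
  also have "\<dots> = perc p V (\<lambda>W. g (f ` W))"
    unfolding perc_def
  proof (intro sum.cong refl)
    fix W assume W: "W \<in> Pow V"
    have "f ` V - f ` W = f ` (V - W)" using inj_on_image_set_diff[OF assms, of V W] W by auto
    moreover have "card (f ` W) = card W" "card (f ` (V - W)) = card (V - W)"
      using W assms by (auto intro!: card_image intro: inj_on_subset)
    ultimately show "p ^ card (f ` W) * (1 - p) ^ card (f ` V - f ` W) * g (f ` W) = p ^ card W * (1 - p) ^ card (V - W) * g (f ` W)"
      by simp
  qed
  finally show ?thesis .
qed

lemma reach_image:
  assumes f: "inj_on f V" and "E \<subseteq> V \<times> V" "R \<subseteq> V" "W \<subseteq> V"
  shows "reach (map_prod f f ` E) (f ` R) (f ` W) = f ` reach E R W"
proof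
  have mem: "f x \<in> f ` A \<longleftrightarrow> x \<in> A" if "x \<in> V" "A \<subseteq> V" for x A
    using that f by (auto dest: inj_onD)
  have reachV: "reach E R W \<subseteq> V" using reach_subset[of E R W] assms by auto
  show "reach (map_prod f f ` E) (f ` R) (f ` W) \<subseteq> f ` reach E R W"
  proof (rule reach_minimal)
    show "f ` R \<subseteq> f ` reach E R W" using subset_reach by (intro image_mono)
    fix x y assume *: "x \<in> f ` reach E R W" "(x, y) \<in> map_prod f f ` E" "y \<in> f ` R \<union> f ` W"
    then obtain a b where ab: "(a, b) \<in> E" "x = f a" "y = f b" by auto
    hence V: "a \<in> V" "b \<in> V" using assms by auto
    have "a \<in> reach E R W" using * ab mem[OF V(1) reachV] by simp
    moreover have "b \<in> R \<union> W" using * ab mem[OF V(2)] assms by auto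
    ultimately show "y \<in> f ` reach E R W" using ab reach_step by fast
  qed
  have "reach E R W \<subseteq> {x. f x \<in> reach (map_prod f f ` E) (f ` R) (f ` W)}"
  proof (rule reach_minimal)
    show "R \<subseteq> {x. f x \<in> reach (map_prod f f ` E) (f ` R) (f ` W)}"
      using subset_reach[of "f ` R" "map_prod f f ` E" "f ` W"] by auto
    fix x y assume *: "x \<in> {x. f x \<in> reach (map_prod f f ` E) (f ` R) (f ` W)}" "(x, y) \<in> E" "y \<in> R \<union> W"
    have "(f x, f y) \<in> map_prod f f ` E" using *(2) by (intro image_eqI[of _ _ "(x, y)"]) auto
    thus "y \<in> {x. f x \<in> reach (map_prod f f ` E) (f ` R) (f ` W)}"
      using * by (auto intro: reach_step)
  qed
  thus "f ` reach E R W \<subseteq> reach (map_prod f f ` E) (f ` R) (f ` W)" by auto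
qed

text \<open>A circulant construction: the vertices sit on a cycle of odd length q, the cyclic
  distances run through 1, ..., \<beta> M, and \<beta> consecutive distances share a hue. Each
  distance is attained twice at every vertex, which gives 2 \<beta>.\<close>

lemma exists_hue:
  fixes q M \<beta> :: nat
  assumes q: "q = 2 * \<beta> * M + 1" and \<beta>: "0 < \<beta>"
  obtains hue :: "nat \<Rightarrow> nat \<Rightarrow> nat" where "\<And>i i'. hue i i' = hue i' i"
    "\<And>i i'. i < q \<Longrightarrow> i' < q \<Longrightarrow> i \<noteq> i' \<Longrightarrow> hue i i' < M"
    "\<And>i x. i < q \<Longrightarrow> x < M \<Longrightarrow> card {i'. i' < q \<and> i' \<noteq> i \<and> hue i i' = x} = 2 * \<beta>"
proof -
  define dst where "dst i i' = (if i \<le> i' then i' - i else i - i' :: nat)" for i i' :: nat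
  define cyc where "cyc i i' = min (dst i i') (q - dst i i')" for i i'
  define hue where "hue i i' = (cyc i i' - 1) div \<beta>" for i i'
  show ?thesis
  proof (rule that[of hue])
    show "hue i i' = hue i' i" for i i' by (auto simp: hue_def cyc_def dst_def)
    have cyc: "1 \<le> cyc i i' \<and> cyc i i' \<le> \<beta> * M" if "i < q" "i' < q" "i \<noteq> i'" for i i'
      using that q by (auto simp: cyc_def dst_def min_def)
    show "hue i i' < M" if "i < q" "i' < q" "i \<noteq> i'" for i i'
    proof -
      have "cyc i i' - 1 < M * \<beta>" using cyc[OF that] unfolding mult.commute[of M] by linarith
      thus ?thesis unfolding hue_def by (rule less_mult_imp_div_less)
    qed
    fix i x assume ix: "i < q" "x < M"
    define lo where "lo = \<beta> * x + 1"
    define hi where "hi = \<beta> * x + \<beta>"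
    have hi: "hi \<le> \<beta> * M"
    proof -
      have "\<beta> * Suc x \<le> \<beta> * M" using ix by (intro mult_le_mono2) auto
      thus ?thesis by (simp add: hi_def)
    qed
    have hq: "2 * hi < q" using hi q by simp
    \<comment> \<open>Rotation forward from i by \<open>\<delta>\<close>: a partner at a distance
      between \<open>lo\<close> and \<open>hi\<close> has that distance as \<open>\<delta>\<close>
      or as \<open>q - \<delta>\<close>, and by \<open>hq\<close> these two ranges are
      disjoint.\<close>
    define \<psi> where "\<psi> \<delta> = (if i + \<delta> < q then i + \<delta> else i + \<delta> - q)" for \<delta>
    have eq: "{i'. i' < q \<and> i' \<noteq> i \<and> hue i i' = x} = \<psi> ` ({lo..hi} \<union> {q - hi..q - lo})"
    proof -
      have hue_iff: "hue i i' = x \<longleftrightarrow> lo \<le> cyc i i' \<and> cyc i i' \<le> hi" if "i' < q" "i' \<noteq> i" for i'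
      proof -
        have "(cyc i i' - 1) div \<beta> = x \<longleftrightarrow> x * \<beta> \<le> cyc i i' - 1 \<and> cyc i i' - 1 < x * \<beta> + \<beta>"
        proof
          assume "(cyc i i' - 1) div \<beta> = x"
          thus "x * \<beta> \<le> cyc i i' - 1 \<and> cyc i i' - 1 < x * \<beta> + \<beta>"
            using div_mult_mod_eq[of "cyc i i' - 1" \<beta>] mod_less_divisor[OF \<beta>, of "cyc i i' - 1"] by auto
        next
          assume "x * \<beta> \<le> cyc i i' - 1 \<and> cyc i i' - 1 < x * \<beta> + \<beta>"
          thus "(cyc i i' - 1) div \<beta> = x" by (intro div_nat_eqI) (auto simp: mult.commute)
        qed
        moreover have "x * \<beta> \<le> cyc i i' - 1 \<and> cyc i i' - 1 < x * \<beta> + \<beta>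
            \<longleftrightarrow> x * \<beta> + 1 \<le> cyc i i' \<and> cyc i i' \<le> x * \<beta> + \<beta>"
          using cyc[OF ix(1) that(1)] that by linarith
        ultimately show ?thesis unfolding hue_def lo_def hi_def mult.commute[of \<beta> x] by (rule trans)
      qed
      show ?thesis
      proof (intro equalityI subsetI)
        fix i' assume i': "i' \<in> {i'. i' < q \<and> i' \<noteq> i \<and> hue i i' = x}"
        define \<delta> where "\<delta> = (if i \<le> i' then i' - i else i' + q - i)"
        have "\<psi> \<delta> = i'" using i' ix by (auto simp: \<psi>_def \<delta>_def)
        moreover have "\<delta> \<in> {lo..hi} \<union> {q - hi..q - lo}"
          using i' hue_iff[of i'] ix hq by (auto simp: \<delta>_def cyc_def dst_def min_def split: if_splits)
        ultimately show "i' \<in> \<psi> ` ({lo..hi} \<union> {q - hi..q - lo})" by blast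
      next
        fix i' assume "i' \<in> \<psi> ` ({lo..hi} \<union> {q - hi..q - lo})"
        then obtain \<delta> where \<delta>: "\<delta> \<in> {lo..hi} \<union> {q - hi..q - lo}" "i' = \<psi> \<delta>" by (elim imageE)
        have lo1: "1 \<le> lo" by (simp add: lo_def)
        have "i' < q" "i' \<noteq> i" using \<delta> hq ix lo1 by (auto simp: \<psi>_def)
        moreover have "lo \<le> cyc i i' \<and> cyc i i' \<le> hi"
          using \<delta> hq ix lo1 by (auto simp: \<psi>_def cyc_def dst_def min_def split: if_splits)
        ultimately show "i' \<in> {i'. i' < q \<and> i' \<noteq> i \<and> hue i i' = x}" using hue_iff by auto
      qed
    qed
    have "inj_on \<psi> ({lo..hi} \<union> {q - hi..q - lo})"
      using hq ix by (intro inj_onI) (auto simp: \<psi>_def lo_def split: if_splits)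
    hence "card {i'. i' < q \<and> i' \<noteq> i \<and> hue i i' = x} = card ({lo..hi} \<union> {q - hi..q - lo})"
      unfolding eq by (rule card_image)
    also have "\<dots> = card {lo..hi} + card {q - hi..q - lo}"
      using hq by (intro card_Un_disjoint) auto
    also have "\<dots> = 2 * \<beta>"
      using hq \<beta> by (simp add: lo_def hi_def)
    finally show "card {i'. i' < q \<and> i' \<noteq> i \<and> hue i i' = x} = 2 * \<beta>" .
  qed
qed

section \<open>Choice of the parameters\<close>

text \<open>Percolation in one part with the numbers filled in. The extinction probability is about
  1 - 2 \<epsilon>, so the offspring generating function lies above the diagonal at s = 1 - 3
  \<epsilon> and below it at r = 1 - \<epsilon>. The two failure probabilities come out as at most
  1/10 and 4/5.\<close>

lemma expander_component:
  fixes \<epsilon> \<theta> \<kappa> x L :: real and d k l k\<^sub>0 :: nat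
  defines "p \<equiv> (1 + \<epsilon>) / x" and "x \<equiv> real d" and "M \<equiv> 2 * k * l"
  assumes \<epsilon>: "0 < \<epsilon>" "\<epsilon> \<le> 1 / 5000" and \<theta>: "0 < \<theta>" "\<theta> \<le> 1"
    and \<kappa>: "\<kappa> = \<epsilon> / 20 + (1 - \<epsilon> / 20) * ln (1 - \<epsilon> / 20)" "0 < \<kappa>"
    and V: "card V = M" and reg: "regular_on k V E"
    and exp: "vertex_expanding V E (\<epsilon> / 2 * l) ((1 - 8 / 5 * (\<epsilon> / 2)) * k)"
    and x: "31 \<le> x" "x / 2 \<le> k" "k \<le> x"
    and l: "16 * x * L \<le> l" "l \<le> 16 * x * L + 1" and big: "100 \<le> \<epsilon> * x * L"
    and super: "1 < (1 - \<epsilon> / 20) * (1 + \<epsilon>) * (1 - 4 / 5 * \<epsilon>) * (k / x)"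
    and err1: "(2 * x * (16 * x * L + 1) + 1) * exp (- (\<kappa> * (\<epsilon> * x * L / 50))) \<le> 1 / 10"
    and gs: "1 - 3 * \<epsilon> \<le> (1 - p + p * (1 - 3 * \<epsilon>)) ^ d"
    and gr: "(1 - p + p * (1 - \<epsilon>)) ^ d \<le> \<theta> * (1 - \<epsilon>)"
    and k0: "6 * \<epsilon> * x * L \<le> k\<^sub>0" "k\<^sub>0 \<le> 13 / 2 * \<epsilon> * x * L + 1"
    and err2: "(1 + \<epsilon>) / (4 * \<epsilon>) * \<theta> powr (6 * \<epsilon> * x * L) \<le> 1 / 25"
  shows "1 / 10 \<le> perc p V (\<lambda>W. of_bool (\<exists>v\<in>W. k\<^sub>0 \<le> card (reach E {v} W) \<and> card (reach E {v} W) \<le> 4 * \<epsilon> * M / x))"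
proof -
  define m where "m = nat \<lfloor>\<epsilon> / 2 * l\<rfloor>"
  define g where "g = (1 - 4 / 5 * \<epsilon>) * k"
  \<comment> \<open>The factor 99/100 secures \<open>t1 < g * m\<close> strictly; the tenth of the
    time before \<open>t0\<close> is given up to breaks.\<close>
  define t1 where "t1 = nat \<lfloor>99 / 100 * (g * m)\<rfloor>"
  define t0 where "t0 = nat \<lfloor>real t1 / 10\<rfloor>"
  \<comment> \<open>A factor 1 - \<epsilon>/20 below the density p of open vertices, which by
    \<open>super\<close> still leaves a g > 1.\<close>
  define a where "a = (1 - \<epsilon> / 20) * p"
  have E: "finite V" "E \<subseteq> V \<times> V" "sym E" "\<And>v. v \<in> V \<Longrightarrow> card (E `` {v}) = k"
    using reg by (auto simp: regular_on_def)
  have p: "0 < p" "p \<le> 1" "1 / x \<le> p"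
    using \<epsilon> x by (auto simp: p_def field_simps)
  have g: "99 / 200 * x \<le> g" "g \<le> k" "0 < g"
  proof -
    have "99 / 100 * real k \<le> g" unfolding g_def using \<epsilon> by (intro mult_right_mono) auto
    thus "99 / 200 * x \<le> g" using x by linarith
    thus "0 < g" using x by linarith
    have "g \<le> 1 * real k" unfolding g_def using \<epsilon> by (intro mult_right_mono) auto
    thus "g \<le> k" by simp
  qed
  have m: "real m \<le> \<epsilon> / 2 * l" "\<epsilon> / 2 * l - 1 \<le> m"
  proof -
    have "0 \<le> \<epsilon> / 2 * l" using \<epsilon> by simp
    thus "real m \<le> \<epsilon> / 2 * l" "\<epsilon> / 2 * l - 1 \<le> m" unfolding m_def by linarith+
  qed
  have ml: "8 * \<epsilon> * x * L - 1 \<le> m"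
  proof -
    have "\<epsilon> / 2 * (16 * x * L) \<le> \<epsilon> / 2 * l" using \<epsilon> l by (intro mult_left_mono) auto
    thus ?thesis using m by linarith
  qed
  hence m7: "7 * (\<epsilon> * x * L) \<le> m" using big by linarith
  hence m700: "700 \<le> real m" using big by linarith
  have gm: "100 \<le> g * m"
  proof -
    have "1 \<le> g" using g x by linarith
    hence "1 * 700 \<le> g * m" using m700 by (intro mult_mono) auto
    thus ?thesis by simp
  qed
  have t1: "real t1 \<le> 99 / 100 * (g * m)" "98 / 100 * (g * m) \<le> t1" "98 \<le> real t1"
  proof -
    have "99 / 100 * (g * m) - 1 \<le> t1" "real t1 \<le> 99 / 100 * (g * m)"
      using gm unfolding t1_def by linarith+
    thus "real t1 \<le> 99 / 100 * (g * m)" "98 / 100 * (g * m) \<le> t1" "98 \<le> real t1" using gm by linarith+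
  qed
  have t0: "real t0 \<le> real t1 / 10" "real t1 / 20 \<le> t0"
    using t1(3) unfolding t0_def by linarith+
  have t0': "0 < t0" "t0 \<le> t1" using t0 t1(3) by linarith+
  have mM: "g * m \<le> M"
  proof -
    have "g * m \<le> real k * (\<epsilon> / 2 * l)" using g m \<epsilon> by (intro mult_mono) auto
    also have "\<dots> \<le> real k * (2 * l)"
    proof (rule mult_left_mono)
      show "\<epsilon> / 2 * l \<le> real (2 * l)" using \<epsilon> mult_right_mono[of "\<epsilon> / 2" 2 "real l"] by simp
    qed simp
    finally show ?thesis by (simp add: M_def)
  qed
  have t1M: "t1 \<le> M" using t1 mM gm by linarith
  have M_le: "real M \<le> 2 * x * (16 * x * L + 1)"
    using x l unfolding M_def by (simp add: mult_mono)
  have ag: "1 < a * g"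
    using super by (simp add: a_def g_def p_def mult_ac)
  have expm: "vertex_expanding V E (real m) g"
    using exp m by (auto simp: vertex_expanding_def g_def)
  have k0': "k\<^sub>0 \<le> a * t1 - t0 / g"
  proof -
    have "1 * real t1 \<le> (a * g) * t1" using ag by (intro mult_right_mono) auto
    hence "real t1 / g \<le> a * t1" using g by (simp add: field_simps)
    moreover have "t0 / g \<le> (real t1 / 10) / g" using t0 g by (intro divide_right_mono) auto
    moreover have "98 / 100 * m \<le> real t1 / g" using t1 g by (simp add: field_simps)
    \<comment> \<open>m is at least 8 \<epsilon> x L - 1, and 9/10 * 98/100 * 8 exceeds 13/2, with
      room for the rounding terms by \<open>big\<close>.\<close>
    moreover have "13 / 2 * \<epsilon> * x * L + 1 \<le> 9 / 10 * (98 / 100 * m)"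
      using ml big by linarith
    ultimately show ?thesis using k0 by linarith
  qed
  have z: "0 < 1 - \<epsilon> / 20" "1 - \<epsilon> / 20 \<le> 1" using \<epsilon> by auto
  \<comment> \<open>\<open>\<kappa>\<close> is the Poisson large-deviation rate at the ratio 1 -
    \<epsilon>/20, and the same ratio is the optimal parameter z.\<close>
  have \<rho>: "(1 - p + p * (1 - \<epsilon> / 20)) * (1 - \<epsilon> / 20) powr (- a) \<le> exp (- (p * \<kappa>))"
  proof -
    have "(1 - p + p * (1 - \<epsilon> / 20)) \<le> exp (- (p * (\<epsilon> / 20)))"
      using exp_ge_add_one_self[of "- (p * (\<epsilon> / 20))"] by (simp add: algebra_simps)
    moreover have "(1 - \<epsilon> / 20) powr (- a) = exp (- (p * ((1 - \<epsilon> / 20) * ln (1 - \<epsilon> / 20))))"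
      using z by (simp add: powr_def a_def)
    ultimately have "(1 - p + p * (1 - \<epsilon> / 20)) * (1 - \<epsilon> / 20) powr (- a)
      \<le> exp (- (p * (\<epsilon> / 20))) * exp (- (p * ((1 - \<epsilon> / 20) * ln (1 - \<epsilon> / 20))))"
      by (simp add: mult_right_mono)
    also have "\<dots> = exp (- (p * \<kappa>))"
      unfolding \<kappa>(1) exp_add[symmetric] by (simp add: algebra_simps)
    finally show ?thesis .
  qed
  have M0: "0 < M"
    using t1M t1(3) by (cases M) auto
  have main: "1 - (t1 + 1) * exp (- (p * \<kappa>)) ^ t0 - card V * (p * (1 - (1 - 3 * \<epsilon>) + \<theta> ^ k\<^sub>0)) / (4 * \<epsilon> * M / x)
    \<le> perc p V (\<lambda>W. of_bool (\<exists>v\<in>W. k\<^sub>0 \<le> card (reach E {v} W) \<and> card (reach E {v} W) \<le> 4 * \<epsilon> * M / x))"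
  proof (rule perc_component_size_ge[where d = d and g = g and m = m and a = a and z = "1 - \<epsilon> / 20" and r = "1 - \<epsilon>"])
    show "real t1 < g * m" using t1 gm by linarith
    show "card (E `` {v}) \<le> d" if "v \<in> V" for v using E(4)[OF that] x by (simp add: x_def)
    show "exp (- (p * \<kappa>)) \<le> 1" using p \<kappa> by simp
    show "0 < 4 * \<epsilon> * M / x" using \<epsilon> M0 x by simp
  qed (use p E expm g t0' t1M V ag z \<rho> \<epsilon> \<theta> gs gr k0' in auto)
  have e1: "(t1 + 1) * exp (- (p * \<kappa>)) ^ t0 \<le> 1 / 10"
  proof -
    have "\<epsilon> * x * L / 50 \<le> p * t0"
    proof -
      have "99 / 200 * x * (7 * (\<epsilon> * x * L)) \<le> g * m" using g m7 x \<epsilon> big by (intro mult_mono) auto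
      moreover have "0 \<le> x * (\<epsilon> * x * L)" using x big by simp
      ultimately have "x * (\<epsilon> * x * L / 50) \<le> 49 / 1000 * (g * m)" by linarith
      also have "\<dots> \<le> t0" using t1 t0 by linarith
      finally have "\<epsilon> * x * L / 50 \<le> 1 / x * t0" using x by (simp add: field_simps)
      also have "\<dots> \<le> p * t0" using p by (intro mult_right_mono) auto
      finally show ?thesis .
    qed
    hence "\<kappa> * (\<epsilon> * x * L / 50) \<le> \<kappa> * (p * t0)" using \<kappa> by (intro mult_left_mono) auto
    hence "exp (- (p * \<kappa>)) ^ t0 \<le> exp (- (\<kappa> * (\<epsilon> * x * L / 50)))"
      by (simp add: exp_of_nat_mult[symmetric] mult_ac)
    hence "(t1 + 1) * exp (- (p * \<kappa>)) ^ t0 \<le> (2 * x * (16 * x * L + 1) + 1) * exp (- (\<kappa> * (\<epsilon> * x * L / 50)))"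
      using t1M M_le by (intro mult_mono) auto
    thus ?thesis using err1 by linarith
  qed
  have e2: "card V * (p * (1 - (1 - 3 * \<epsilon>) + \<theta> ^ k\<^sub>0)) / (4 * \<epsilon> * M / x) \<le> 4 / 5"
  proof -
    \<comment> \<open>M cancels; an expected 3 \<epsilon> against the allowed 4 \<epsilon> leaves
      the main term 3/4.\<close>
    have eq: "card V * (p * (1 - (1 - 3 * \<epsilon>) + \<theta> ^ k\<^sub>0)) / (4 * \<epsilon> * M / x)
      = (1 + \<epsilon>) * (3 / 4) + (1 + \<epsilon>) / (4 * \<epsilon>) * \<theta> ^ k\<^sub>0"
      using V M0 \<epsilon> x by (simp add: p_def field_simps)
    have "\<theta> ^ k\<^sub>0 \<le> \<theta> powr (6 * \<epsilon> * x * L)"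
      using k0 \<theta> by (simp add: powr_realpow[symmetric] powr_mono')
    hence "(1 + \<epsilon>) / (4 * \<epsilon>) * \<theta> ^ k\<^sub>0 \<le> (1 + \<epsilon>) / (4 * \<epsilon>) * \<theta> powr (6 * \<epsilon> * x * L)"
      using \<epsilon> by (intro mult_left_mono) auto
    hence "(1 + \<epsilon>) / (4 * \<epsilon>) * \<theta> ^ k\<^sub>0 \<le> 1 / 25" using err2 by (rule order_trans)
    moreover have "(1 + \<epsilon>) * (3 / 4) \<le> 19 / 25" using \<epsilon> by simp
    ultimately have "(1 + \<epsilon>) * (3 / 4) + (1 + \<epsilon>) / (4 * \<epsilon>) * \<theta> ^ k\<^sub>0 \<le> 19 / 25 + 1 / 25"
      by (intro add_mono)
    thus ?thesis unfolding eq by (rule order_trans) simp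
  qed
  show ?thesis using main e1 e2 by linarith
qed

text \<open>All requirements for one pair (d, n), with c = \<alpha>/2 and an explicit failure
  probability that depends on d alone.\<close>

definition separating_graph :: "real \<Rightarrow> real \<Rightarrow> real \<Rightarrow> nat \<Rightarrow> nat \<Rightarrow> nat pair_pre_digraph \<Rightarrow> bool" where
  "separating_graph b \<alpha> \<epsilon> d n G \<longleftrightarrow> real d < real n powr (1 / 5) \<and> regular_graph d n G \<and>
     (\<forall>U \<subseteq> pverts G. real (card U) \<le> real n / 2 \<longrightarrow>
        b * real (card U) \<le> real (edges_between G U (pverts G - U))) \<and>
     (\<forall>U \<subseteq> pverts G. real (card U) \<le> \<alpha> / 2 * real d * ln (real n) \<longrightarrow>
        (1 - \<alpha>) * real d * real (card U) \<le> real (card (ext_nbhd G U))) \<and>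
     (\<forall>U \<subseteq> pverts G. real (card U) \<le> \<alpha> / 2 * real d ^ 2 * ln (real n) \<longrightarrow>
        (1 - \<alpha>) * real d * real (card U) \<le> real (edges_between G U (pverts G - U))) \<and>
     1 - 2 * exp (- (real d powr (4 / 5) / 10)) \<le>
       measure_pmf.prob (random_subset_pmf (pverts G) ((1 + \<epsilon>) / real d))
         {W. \<exists>C\<^sub>1 \<in> graph_components (with_proj G \<restriction> W). \<exists>C\<^sub>2 \<in> graph_components (with_proj G \<restriction> W).
            C\<^sub>1 \<noteq> C\<^sub>2 \<and> \<epsilon> * real d * ln (real n) \<le> real (card (verts C\<^sub>1)) \<and>
            \<epsilon> * real d * ln (real n) \<le> real (card (verts C\<^sub>2))}"

text \<open>Inequalities that hold for all large d once the other parameters are fixed, so that the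
  construction itself involves no limits. The 12 is three failures times four expansion scales; 29
  \<beta> \<le> d leaves an inner degree k \<ge> 25 \<beta> for (Q1).\<close>

locale suitable_degree =
  fixes \<alpha> \<epsilon> \<kappa> \<theta> \<eta>\<^sub>0 :: real and \<beta> d :: nat
  assumes d_ge: "31 + 29 * \<beta> \<le> d"
    and d_\<alpha>: "real (4 * \<beta> + 1) \<le> \<alpha> / 5 * real d"
    and union_bound: "12 * (exp (2 * real d * (16 * real d * ln (real d) + 1) * exp (- (\<eta>\<^sub>0 * real d / 60))) - 1) < 1"
    and ln_n: "ln (9 * real \<beta> ^ 2) + 3 * ln (2 * real d * (16 * real d * ln (real d) + 1)) \<le> 13 / 2 * ln (real d)"
    and big: "100 \<le> \<epsilon> * real d * ln (real d)"
    and super: "1 < (1 - \<epsilon> / 20) * (1 + \<epsilon>) * (1 - 4 / 5 * \<epsilon>) * ((real d - 4 * real \<beta>) / real d)"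
    and err1: "(2 * real d * (16 * real d * ln (real d) + 1) + 1) * exp (- (\<kappa> * (\<epsilon> * real d * ln (real d) / 50))) \<le> 1 / 10"
    and gs: "1 - 3 * \<epsilon> \<le> (1 - (1 + \<epsilon>) / real d + (1 + \<epsilon>) / real d * (1 - 3 * \<epsilon>)) ^ d"
    and gr: "(1 - (1 + \<epsilon>) / real d + (1 + \<epsilon>) / real d * (1 - \<epsilon>)) ^ d \<le> \<theta> * (1 - \<epsilon>)"
    and err2: "(1 + \<epsilon>) / (4 * \<epsilon>) * \<theta> powr (6 * \<epsilon> * real d * ln (real d)) \<le> 1 / 25"
    and closing: "((1 + \<epsilon>) / real d + 2 * ((1 + \<epsilon>) / real d)\<^sup>2) *
      (16 * (1 / 500 + \<epsilon>) * (2 * (16 * real d * ln (real d) + 1)) + 1) \<le> 6 / 5 * ln (real d)"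

lemma (in suitable_degree) exists_separating_graph:
  assumes \<alpha>: "0 < \<alpha>" "\<alpha> < 1" and \<epsilon>: "0 < \<epsilon>" "\<epsilon> \<le> 1 / 5000"
    and \<beta>: "0 < \<beta>" "\<beta> \<le> 1 / (500 * \<epsilon>) + 1"
    and \<eta>0: "0 < \<eta>\<^sub>0" "\<eta>\<^sub>0 \<le> \<alpha> / 3" "\<eta>\<^sub>0 \<le> \<epsilon> / 2"
    and \<theta>: "0 < \<theta>" "\<theta> \<le> 1"
    and \<kappa>: "\<kappa> = \<epsilon> / 20 + (1 - \<epsilon> / 20) * ln (1 - \<epsilon> / 20)" "0 < \<kappa>"
  shows "\<exists>n G. separating_graph \<beta> \<alpha> \<epsilon> d n G"
proof -
  define x where "x = real d"
  define L where "L = ln x"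
  define p where "p = (1 + \<epsilon>) / x"
  define k where "k = d - 4 * \<beta>"
  \<comment> \<open>As ln n will be at most 13/2 L, the 16 leaves room for 2 x ln n \<le> l, which
    covers the size ranges of (Q2) and (Q3).\<close>
  define l where "l = nat \<lceil>16 * x * L\<rceil>"
  define M where "M = 2 * k * l"
  \<comment> \<open>On each line a part then has 2 \<beta> M partners, 2 \<beta> for each of its
    vertices.\<close>
  define q where "q = 2 * \<beta> * M + 1"
  define n where "n = q\<^sup>2 * M"
  note d_\<alpha> = d_\<alpha>[folded x_def, folded L_def p_def]
  note union_bound = union_bound[folded x_def, folded L_def p_def]
  note ln_n = ln_n[folded x_def, folded L_def p_def]
  note big = big[folded x_def, folded L_def p_def]
  note super = super[folded x_def, folded L_def p_def]
  note err1 = err1[folded x_def, folded L_def p_def]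
  note gs = gs[folded x_def, folded L_def p_def]
  note gr = gr[folded x_def, folded L_def p_def]
  note err2 = err2[folded x_def, folded L_def p_def]
  note closing = closing[folded x_def, folded L_def p_def]
  have x: "31 \<le> x" "0 < x" "29 * real \<beta> \<le> x" using d_ge by (auto simp: x_def)
  have k: "real k = x - 4 * \<beta>" "x / 2 \<le> k" "real k \<le> x" "25 * \<beta> \<le> k" "k \<le> d" "d = k + 4 * \<beta>"
    using d_ge by (auto simp: k_def x_def of_nat_diff)
  have L1: "1 \<le> L"
  proof -
    have "exp 1 \<le> x" using exp_le x(1) by linarith
    thus ?thesis unfolding L_def using x by (simp add: ln_ge_iff)
  qed
  have l: "16 * x * L \<le> l" "l \<le> 16 * x * L + 1" "0 < l"
  proof -
    have "0 < 16 * x * L" using x L1 by simp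
    thus "16 * x * L \<le> l" "l \<le> 16 * x * L + 1" "0 < l" unfolding l_def by linarith+
  qed
  have kl: "x * l \<le> M" using k(2) by (simp add: M_def mult_right_mono)
  have M_le: "real M \<le> 2 * x * (16 * x * L + 1)"
    using x k l unfolding M_def by (simp add: mult_mono)
  have M_ge: "x ^ 2 \<le> M"
  proof -
    have "x * 1 \<le> x * L" using x L1 by (intro mult_left_mono) auto
    hence "x \<le> l" using l(1) x by linarith
    hence "x * x \<le> x * l" using x by (intro mult_left_mono) auto
    thus ?thesis using kl by (simp add: power2_eq_square)
  qed
  have M1: "1 \<le> real M" "0 < M"
  proof -
    have "1 \<le> x ^ 2" using x by simp
    thus "1 \<le> real M" using M_ge by linarith
    thus "0 < M" by simp
  qed
  have qM: "M \<le> q" "real q \<le> 3 * \<beta> * M" 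
  proof -
    have "1 * M \<le> \<beta> * M" using \<beta> by (intro mult_le_mono1) auto
    thus "M \<le> q" unfolding q_def by linarith
    have "1 \<le> \<beta> * M" using \<beta> M1 by simp
    hence "q \<le> 3 * \<beta> * M" by (simp add: q_def)
    thus "real q \<le> 3 * \<beta> * M" by (simp only: of_nat_le_iff)
  qed
  have n_ge: "x ^ 6 \<le> n"
  proof -
    have "x ^ 6 = (x ^ 2) ^ 3" by simp
    also have "\<dots> \<le> real M ^ 3" using M_ge by (intro power_mono) auto
    also have "\<dots> = real M ^ 2 * M" by (simp add: power2_eq_square power3_eq_cube)
    also have "\<dots> \<le> real q ^ 2 * M" using qM by (intro mult_right_mono power_mono) auto
    finally show ?thesis by (simp add: n_def)
  qed
  have ln_ge: "6 * L \<le> ln n"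
  proof -
    have "ln (x ^ 6) \<le> ln n" using n_ge x by (intro ln_mono) auto
    thus ?thesis using x by (simp add: L_def ln_realpow)
  qed
  \<comment> \<open>n is of order M^3 and M of order x^2 L; the excess of 13/2 over 6 absorbs the
    logarithms and \<beta>.\<close>
  have ln_le: "ln n \<le> 13 / 2 * L"
  proof -
    have "real n \<le> (3 * \<beta> * M) ^ 2 * real M"
      unfolding n_def using qM by (simp add: mult_right_mono power_mono del: power_mult_distrib)
    also have "\<dots> = 9 * real \<beta> ^ 2 * real M ^ 3" by (simp add: power2_eq_square power3_eq_cube)
    finally have "real n \<le> 9 * real \<beta> ^ 2 * real M ^ 3" .
    moreover have "0 < real n" using n_ge x by (smt (verit) zero_less_power)
    ultimately have "ln n \<le> ln (9 * real \<beta> ^ 2 * real M ^ 3)" by (intro ln_mono) auto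
    also have "\<dots> = ln (9 * real \<beta> ^ 2) + 3 * ln M"
      using M1 \<beta> by (simp add: ln_mult ln_realpow)
    also have "\<dots> \<le> ln (9 * real \<beta> ^ 2) + 3 * ln (2 * x * (16 * x * L + 1))"
      using M_le M1 by (intro add_left_mono mult_left_mono ln_mono) auto
    finally show ?thesis using ln_n by linarith
  qed
  have l_ln: "2 * x * ln n \<le> l"
  proof -
    have "2 * x * ln n \<le> 2 * x * (13 / 2 * L)" using ln_le x by (intro mult_left_mono) auto
    also have "\<dots> \<le> l" using l x L1 by (simp add: algebra_simps)
    finally show ?thesis .
  qed

  \<comment> \<open>Four scales of expansion: \<alpha>/3 for (Q2), \<alpha>/2 for (Q3), \<epsilon>/2
    for percolation inside a part, 1/2 for (Q1).\<close>
  define \<Lambda> where "\<Lambda> = {\<alpha> / 3, \<alpha> / 2, \<epsilon> / 2, 1 / 2 :: real}"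
  have "card \<Lambda> \<le> 4" unfolding \<Lambda>_def by (rule card_insert_le_m1 | simp)+
  have "3 * card \<Lambda> * (exp (2 * (k * l) * exp (- (\<eta>\<^sub>0 * k / 30))) - 1) < 1"
  proof -
    have "\<eta>\<^sub>0 * (x / 2) \<le> \<eta>\<^sub>0 * k" using k(2) \<eta>0 by (intro mult_left_mono) auto
    hence "\<eta>\<^sub>0 * x / 60 \<le> \<eta>\<^sub>0 * k / 30" by linarith
    hence "2 * (k * l) * exp (- (\<eta>\<^sub>0 * k / 30)) \<le> 2 * x * (16 * x * L + 1) * exp (- (\<eta>\<^sub>0 * x / 60))"
      using M_le x L1 by (intro mult_mono) (auto simp: M_def mult.assoc)
    hence "exp (2 * (k * l) * exp (- (\<eta>\<^sub>0 * k / 30))) - 1 \<le> exp (2 * x * (16 * x * L + 1) * exp (- (\<eta>\<^sub>0 * x / 60))) - 1"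
      by simp
    moreover have "real (3 * card \<Lambda>) \<le> 12" using \<open>card \<Lambda> \<le> 4\<close> by simp
    ultimately have "3 * card \<Lambda> * (exp (2 * (k * l) * exp (- (\<eta>\<^sub>0 * k / 30))) - 1)
      \<le> 12 * (exp (2 * x * (16 * x * L + 1) * exp (- (\<eta>\<^sub>0 * x / 60))) - 1)"
      by (intro mult_mono) auto
    thus ?thesis using union_bound by linarith
  qed
  moreover have "\<eta>\<^sub>0 \<le> \<eta>" if "\<eta> \<in> \<Lambda>" for \<eta> using that \<eta>0 \<alpha> \<epsilon> by (auto simp: \<Lambda>_def)
  moreover have "finite \<Lambda>" by (simp add: \<Lambda>_def)
  ultimately obtain H where H0: "regular_on k {..<2 * k * l} H"
    "\<And>\<eta>::real. \<eta> \<in> \<Lambda> \<Longrightarrow> vertex_expanding {..<2 * k * l} H (\<eta> * l) ((1 - 8 / 5 * \<eta>) * k)"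
    "\<And>\<eta>::real. \<eta> \<in> \<Lambda> \<Longrightarrow> edge_expanding {..<2 * k * l} H (\<eta> * (2 * k * l)) ((1 - 8 / 5 * \<eta>) * k)"
    using exists_expander[of \<Lambda> l \<eta>\<^sub>0 k] l(3) \<eta>0(1) by blast
  have H: "regular_on k {..<M} H"
    "\<And>\<eta>::real. \<eta> \<in> \<Lambda> \<Longrightarrow> vertex_expanding {..<M} H (\<eta> * l) ((1 - 8 / 5 * \<eta>) * k)"
    "\<And>\<eta>::real. \<eta> \<in> \<Lambda> \<Longrightarrow> edge_expanding {..<M} H (\<eta> * M) ((1 - 8 / 5 * \<eta>) * k)"
    using H0 by (simp_all add: M_def)
  obtain hue where hue: "\<And>i i'. hue i i' = hue i' i"
    "\<And>i i'. i < q \<Longrightarrow> i' < q \<Longrightarrow> i \<noteq> i' \<Longrightarrow> hue i i' < M"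
    "\<And>i x. i < q \<Longrightarrow> x < M \<Longrightarrow> card {i'. i' < q \<and> i' \<noteq> i \<and> hue i i' = x} = 2 * \<beta>"
    using exists_hue[of q \<beta> M] \<beta>(1) q_def by blast
  interpret B: blowup q M k \<beta> hue H
    using hue H by unfold_locales (auto simp: M_def)
  define f :: "nat \<times> nat \<times> nat \<Rightarrow> nat" where "f = (\<lambda>(i, j, y). prod_encode (i, prod_encode (j, y)))"
  have inj: "inj_on f B.V" by (auto simp: inj_on_def f_def)
  define V where "V = f ` B.V"
  define E where "E = map_prod f f ` B.E"
  define G where "G = \<lparr>pverts = V, parcs = E\<rparr>"
  have reg: "regular_on d V E"
    using regular_on_image[OF inj B.regular_on_E] by (simp add: V_def E_def k)
  have EV: "E \<subseteq> V \<times> V" "sym E" "finite V" using reg by (auto simp: regular_on_def)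
  have cV: "card V = n" unfolding V_def n_def card_image[OF inj] B.card_V by simp
  have eb: "edges_between G U (pverts G - U) = card (E \<inter> U \<times> (V - U))" for U
    unfolding edges_between_def G_def by (intro arg_cong[of _ _ card]) auto
  have en: "ext_nbhd G U = E `` U - U" for U
    using EV unfolding ext_nbhd_def G_def by auto

  have dx: "(1 - \<alpha>) * d = x - \<alpha> * x" by (simp add: x_def algebra_simps)
  have p: "0 < p" "p \<le> 1 / 2"
    using \<epsilon> x by (auto simp: p_def field_simps)

  have F1: "real d < real n powr (1 / 5)"
  proof -
    have "x ^ 5 < n" using n_ge power_strict_increasing[of 5 6 x] x by linarith
    hence "(x ^ 5) powr (1 / 5) < n powr (1 / 5)" using x by (intro powr_less_mono2) auto
    moreover have "(x ^ 5) powr (1 / 5) = x"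
    proof -
      have "x ^ 5 = x powr 5" using x by simp
      hence "(x ^ 5) powr (1 / 5) = x powr (5 * (1 / 5))" by (simp only: powr_powr)
      thus ?thesis using x by simp
    qed
    ultimately show ?thesis by (simp add: x_def)
  qed
  have F2: "regular_graph d n G"
    unfolding G_def by (rule regular_graph_of_regular_on[OF reg cV])
  have F3: "\<beta> * real (card U) \<le> edges_between G U (pverts G - U)"
    if "U \<subseteq> pverts G" "real (card U) \<le> real n / 2" for U
  proof -
    have "edge_expanding B.V B.E (real (card B.V) / 2) \<beta>"
      unfolding edge_expanding_def
    proof (intro allI impI)
      fix U assume U: "U \<subseteq> B.V" "real (card U) \<le> real (card B.V) / 2"
      \<comment> \<open>At scale 1/2 the expansion rate is k / 5, which is at least 5
        \<beta>.\<close>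
      have "edge_expanding {..<M} H (M / 2) ((1 - 8 / 5 * (1 / 2)) * k)"
        using H(3)[of "1 / 2"] by (simp add: \<Lambda>_def)
      from B.card_boundary_ge[OF _ this _ U] show "real \<beta> * real (card U) \<le> card (B.E \<inter> U \<times> (B.V - U))"
        using k(4) by (simp add: q_def flip: of_nat_mult)
    qed
    hence "edge_expanding V E (real (card B.V) / 2) \<beta>"
      unfolding V_def E_def by (intro edge_expanding_image inj B.E_sub)
    moreover have "card B.V = n" using cV card_image[OF inj] by (simp add: V_def)
    ultimately show ?thesis using that unfolding eb by (simp add: edge_expanding_def G_def)
  qed
  have F4: "(1 - \<alpha>) * d * card U \<le> card (ext_nbhd G U)"
    if U: "U \<subseteq> pverts G" "real (card U) \<le> \<alpha> / 2 * d * ln n" for U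
  proof -
    obtain U' where U': "U' \<subseteq> B.V" "U = f ` U'" using U by (auto simp: G_def V_def subset_image_iff)
    have sub: "B.E `` U' \<subseteq> B.V" using B.E_sub by auto
    have cU: "card U = card U'" using U' inj by (auto intro!: card_image intro: inj_on_subset)
    have "E `` U - U = f ` (B.E `` U' - U')"
      unfolding E_def U'(2) Image_map_prod[OF inj B.E_sub U'(1)]
      using inj_on_image_set_diff[OF inj, of "B.E `` U'" U'] sub U' by auto
    moreover have "card (f ` (B.E `` U' - U')) = card (B.E `` U' - U')"
      using sub inj by (intro card_image) (auto intro: inj_on_subset)
    moreover have "((1 - 8 / 5 * (\<alpha> / 3)) * k - 1) * card U' \<le> card (B.E `` U' - U')"
    proof (rule B.card_ext_nbhd_ge[OF H(2) U'(1)])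
      have "\<alpha> / 3 * (2 * x * ln n) \<le> \<alpha> / 3 * l" using l_ln \<alpha> by (intro mult_left_mono) auto
      moreover have "0 \<le> \<alpha> * (x * ln n)" using \<alpha> x ln_ge L1 by (intro mult_nonneg_nonneg) auto
      ultimately show "real (card U') \<le> \<alpha> / 3 * l" using U(2) cU by (simp add: x_def)
    qed (simp add: \<Lambda>_def)
    moreover have "(1 - \<alpha>) * d * card U' \<le> ((1 - 8 / 5 * (\<alpha> / 3)) * k - 1) * card U'"
    proof (rule mult_right_mono)
      \<comment> \<open>The expansion loses 8/15 \<alpha>; the other 7/15 \<alpha> x covers the
        missing inner degree 4 \<beta> and the 1.\<close>
      have "(1 - 8 / 5 * (\<alpha> / 3)) * k = k - 8 / 15 * \<alpha> * k" by (simp add: algebra_simps)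
      moreover have "\<alpha> * k \<le> \<alpha> * x" "0 \<le> \<alpha> * x" using \<alpha> k x by (auto intro: mult_left_mono)
      ultimately show "(1 - \<alpha>) * d \<le> (1 - 8 / 5 * (\<alpha> / 3)) * k - 1"
        using d_\<alpha> k(1) dx by linarith
    qed simp
    ultimately show ?thesis unfolding en by (simp add: cU)
  qed
  have F5: "(1 - \<alpha>) * d * card U \<le> edges_between G U (pverts G - U)"
    if U: "U \<subseteq> pverts G" "real (card U) \<le> \<alpha> / 2 * real d ^ 2 * ln n" for U
  proof -
    have "edge_expanding V E (\<alpha> / 2 * M) ((1 - 8 / 5 * (\<alpha> / 2)) * k)"
      unfolding V_def E_def by (intro edge_expanding_image inj B.E_sub B.edge_expanding_E H(3)) (simp add: \<Lambda>_def)
    moreover have "real (card U) \<le> \<alpha> / 2 * M"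
    proof -
      have "0 \<le> x * ln n" using x ln_ge L1 by (intro mult_nonneg_nonneg) auto
      hence "x * ln n \<le> l" using l_ln by linarith
      hence "x * (x * ln n) \<le> x * l" using x by (intro mult_left_mono) auto
      hence "x ^ 2 * ln n \<le> M" using kl by (simp add: power2_eq_square)
      hence "\<alpha> / 2 * (x ^ 2 * ln n) \<le> \<alpha> / 2 * M" using \<alpha> by (intro mult_left_mono) auto
      thus ?thesis using U(2) by (simp add: x_def)
    qed
    ultimately have "(1 - 8 / 5 * (\<alpha> / 2)) * k * card U \<le> card (E \<inter> U \<times> (V - U))"
      using U by (simp add: edge_expanding_def G_def)
    moreover have "(1 - \<alpha>) * d * card U \<le> (1 - 8 / 5 * (\<alpha> / 2)) * k * card U"
    proof (rule mult_right_mono)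
      \<comment> \<open>Here the loss is 4/5 \<alpha>, so \<alpha> x / 5 is left for the degree 4
        \<beta> spent between parts; hence the 1/5 in \<open>d_\<alpha>\<close>.\<close>
      have "(1 - 8 / 5 * (\<alpha> / 2)) * k = k - 4 / 5 * \<alpha> * k" by (simp add: algebra_simps)
      moreover have "\<alpha> * k \<le> \<alpha> * x" "0 \<le> \<alpha> * x" using \<alpha> k x by (auto intro: mult_left_mono)
      ultimately show "(1 - \<alpha>) * d \<le> (1 - 8 / 5 * (\<alpha> / 2)) * k"
        using d_\<alpha> k(1) dx by linarith
    qed simp
    ultimately show ?thesis unfolding eb by linarith
  qed
  have F6: "1 - 2 * exp (- (x powr (4 / 5) / 10)) \<le> measure_pmf.prob (random_subset_pmf (pverts G) p)
       {W. \<exists>C\<^sub>1 \<in> graph_components (with_proj G \<restriction> W). \<exists>C\<^sub>2 \<in> graph_components (with_proj G \<restriction> W).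
          C\<^sub>1 \<noteq> C\<^sub>2 \<and> \<epsilon> * d * ln n \<le> card (verts C\<^sub>1) \<and> \<epsilon> * d * ln n \<le> card (verts C\<^sub>2)}"
    (is "_ \<le> measure_pmf.prob _ ?S")
  proof -
    define s where "s = nat \<lceil>\<epsilon> * x * ln n\<rceil>"
    define k\<^sub>1 where "k\<^sub>1 = 4 * \<epsilon> * M / x"
    \<comment> \<open>\<open>n1\<close> bounds the number of outside neighbours to be closed; the
      1/10 in \<open>\<mu>\<close> is the probability of a suitable component inside the
      part.\<close>
    define n1 where "n1 = nat \<lceil>4 * real \<beta> * k\<^sub>1\<rceil>"
    define \<mu> where "\<mu> = 1 / 10 * (1 - p) ^ n1"
    have \<epsilon>x: "0 \<le> \<epsilon> * x" using \<epsilon> x by simp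
    have s: "6 * \<epsilon> * x * L \<le> s" "s \<le> 13 / 2 * \<epsilon> * x * L + 1" "\<epsilon> * x * ln n \<le> s"
    proof -
      note 1 = mult_left_mono[OF ln_ge \<epsilon>x] mult_left_mono[OF ln_le \<epsilon>x]
      have "0 \<le> ln n" using ln_ge L1 by linarith
      hence "0 \<le> \<epsilon> * x * ln n" by (rule mult_nonneg_nonneg[OF \<epsilon>x])
      hence 2: "\<epsilon> * x * ln n \<le> s" "s \<le> \<epsilon> * x * ln n + 1" unfolding s_def by linarith+
      show "6 * \<epsilon> * x * L \<le> s" "s \<le> 13 / 2 * \<epsilon> * x * L + 1" "\<epsilon> * x * ln n \<le> s"
        using 1 2 by linarith+
    qed
    have k1: "0 \<le> 4 * real \<beta> * k\<^sub>1" using \<epsilon> x by (simp add: k\<^sub>1_def)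
    have part: "1 / 10 \<le> perc p (B.diag_part i) (\<lambda>W. of_bool (\<exists>v\<in>W. s \<le> card (reach (B.diag_edges i) {v} W)
        \<and> card (reach (B.diag_edges i) {v} W) \<le> k\<^sub>1))" if i: "i < q" for i
      unfolding k\<^sub>1_def
    proof (rule expander_component[where \<theta> = \<theta> and \<kappa> = \<kappa> and L = L and \<epsilon> = \<epsilon> and d = d and k = k and l = l,
          folded x_def, folded p_def M_def])
      show "card (B.diag_part i) = M"
        by (simp add: B.diag_part_def card_image[OF B.inj_diag])
      show "regular_on k (B.diag_part i) (B.diag_edges i)"
        unfolding B.diag_part_def B.diag_edges_def by (rule regular_on_image[OF B.inj_diag H(1)])
      show "vertex_expanding (B.diag_part i) (B.diag_edges i) (\<epsilon> / 2 * l) ((1 - 8 / 5 * (\<epsilon> / 2)) * k)"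
        unfolding B.diag_part_def B.diag_edges_def
        by (rule vertex_expanding_image[OF B.inj_diag B.H_sub H(2)]) (simp add: \<Lambda>_def)
      show "1 < (1 - \<epsilon> / 20) * (1 + \<epsilon>) * (1 - 4 / 5 * \<epsilon>) * (k / x)" using super k(1) by simp
    qed fact+
    have iso: "\<mu> \<le> perc p (B.territory i) (\<lambda>W. of_bool (B.isolated s i W))" if i: "i < q" for i
    proof -
      have "\<mu> \<le> perc p (B.diag_part i) (\<lambda>W. of_bool (\<exists>v\<in>W. s \<le> card (reach (B.diag_edges i) {v} W)
        \<and> card (reach (B.diag_edges i) {v} W) \<le> k\<^sub>1)) * (1 - p) ^ n1"
        unfolding \<mu>_def using part[OF i] p by (intro mult_right_mono) auto
      also have "\<dots> \<le> perc p (B.territory i) (\<lambda>W. of_bool (B.isolated s i W))"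
        using p i k1 by (intro B.perc_isolated_ge) (auto simp: n1_def)
      finally show ?thesis .
    qed
    have \<mu>0: "0 \<le> \<mu>" "\<mu> \<le> 1" using p by (auto simp: \<mu>_def power_le_one intro: order_trans[OF power_le_one])
    \<comment> \<open>\<open>n1\<close> is about 16 \<beta> \<epsilon> M / x, where \<beta>
      \<epsilon> \<le> 1/500 + \<epsilon> after rounding \<beta> up and M / x is about 32 x L;
      multiplied by p this stays below 6/5 L.\<close>
    have \<mu>_ge: "x powr (- (6 / 5)) / 10 \<le> \<mu>"
    proof -
      have n1: "n1 \<le> 16 * (1 / 500 + \<epsilon>) * (2 * (16 * x * L + 1)) + 1"
      proof -
        have "\<beta> * \<epsilon> \<le> (1 / (500 * \<epsilon>) + 1) * \<epsilon>" using \<beta> \<epsilon> by (intro mult_right_mono) auto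
        hence be: "\<beta> * \<epsilon> \<le> 1 / 500 + \<epsilon>" using \<epsilon> by (simp add: algebra_simps)
        have Mx: "M / x \<le> 2 * (16 * x * L + 1)" using M_le x by (simp add: field_simps)
        have "4 * real \<beta> * k\<^sub>1 = 16 * (\<beta> * \<epsilon>) * (M / x)" by (simp add: k\<^sub>1_def)
        also have "\<dots> \<le> 16 * (1 / 500 + \<epsilon>) * (2 * (16 * x * L + 1))"
          using be Mx \<epsilon> x by (intro mult_mono) auto
        finally have "4 * real \<beta> * k\<^sub>1 \<le> 16 * (1 / 500 + \<epsilon>) * (2 * (16 * x * L + 1))" .
        moreover have "real (nat \<lceil>y\<rceil>) \<le> y + 1" if "0 \<le> y" for y :: real using that by linarith
        ultimately show ?thesis using k1 unfolding n1_def by (meson add_right_mono order_trans)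
      qed
      have "- (6 / 5 * L) \<le> - ((p + 2 * p\<^sup>2) * n1)"
      proof -
        have "(p + 2 * p\<^sup>2) * n1 \<le> (p + 2 * p\<^sup>2) * (16 * (1 / 500 + \<epsilon>) * (2 * (16 * x * L + 1)) + 1)"
          using n1 p by (intro mult_left_mono) auto
        thus ?thesis using closing by linarith
      qed
      also have "\<dots> \<le> n1 * ln (1 - p)"
        using mult_left_mono[OF ln_one_minus_pos_lower_bound[of p], of "real n1"] p by (simp add: algebra_simps)
      finally have "exp (- (6 / 5 * L)) \<le> exp (n1 * ln (1 - p))" by simp
      also have "\<dots> = (1 - p) ^ n1" using p by (simp add: exp_of_nat_mult)
      finally show ?thesis using x by (simp add: \<mu>_def powr_def L_def)
    qed
    \<comment> \<open>Each group has at least x^2 diagonal parts, each successful with probability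
      at least x^(-6/5) / 10.\<close>
    have "x powr (4 / 5) / 10 \<le> \<mu> * (\<beta> * M)"
    proof -
      have "x powr (4 / 5) / 10 = x powr (- (6 / 5)) / 10 * x ^ 2"
        using x powr_add[of x "- (6 / 5)" 2] by simp
      also have "\<dots> \<le> \<mu> * (\<beta> * M)"
      proof (rule mult_mono[OF \<mu>_ge])
        have "1 * real M \<le> \<beta> * real M" using \<beta> by (intro mult_right_mono) auto
        thus "x\<^sup>2 \<le> real (\<beta> * M)" using M_ge by simp
      qed (use \<mu>0 in auto)
      finally show ?thesis .
    qed
    hence "(1 - \<mu>) ^ (\<beta> * M) \<le> exp (- (x powr (4 / 5) / 10))"
    proof -
      have "(1 - \<mu>) ^ (\<beta> * M) \<le> exp (- \<mu>) ^ (\<beta> * M)"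
        using \<mu>0 exp_ge_add_one_self[of "- \<mu>"] by (intro power_mono) auto
      also have "\<dots> = exp (- (\<mu> * (\<beta> * M)))" by (simp add: exp_of_nat_mult[symmetric] mult_ac)
      also have "\<dots> \<le> exp (- (x powr (4 / 5) / 10))"
        using \<open>x powr (4 / 5) / 10 \<le> \<mu> * (\<beta> * M)\<close> by simp
      finally show ?thesis .
    qed
    hence "1 - 2 * exp (- (x powr (4 / 5) / 10)) \<le> 1 - 2 * (1 - \<mu>) ^ (\<beta> * M)" by simp
    also have "\<dots> \<le> perc p B.V (\<lambda>W. of_bool (\<exists>u\<in>W. \<exists>w\<in>W. reach B.E {u} W \<noteq> reach B.E {w} W \<and>
       s \<le> card (reach B.E {u} W) \<and> s \<le> card (reach B.E {w} W)))"
      using p \<mu>0 iso by (intro B.perc_two_components_ge) (auto simp: q_def)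
    also have "\<dots> \<le> perc p B.V (\<lambda>W. of_bool (f ` W \<in> ?S))"
    proof (rule perc_mono)
      fix W assume W: "W \<subseteq> B.V"
      have "f ` W \<in> ?S" if ev: "\<exists>u\<in>W. \<exists>w\<in>W. reach B.E {u} W \<noteq> reach B.E {w} W \<and>
         s \<le> card (reach B.E {u} W) \<and> s \<le> card (reach B.E {w} W)"
      proof -
        obtain u w where uw: "u \<in> W" "w \<in> W" "reach B.E {u} W \<noteq> reach B.E {w} W"
          "s \<le> card (reach B.E {u} W)" "s \<le> card (reach B.E {w} W)" using ev by blast
        define C where "C v = with_proj G \<restriction> reach E {f v} (f ` W)" for v
        have sub: "reach B.E {v} W \<subseteq> B.V" if "v \<in> W" for v
          using reach_subset[of B.E "{v}" W] W that by auto
        have vC: "verts (C v) = f ` reach B.E {v} W" if "v \<in> W" for v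
          using reach_image[OF inj B.E_sub _ W, of "{v}"] that W by (auto simp: C_def E_def)
        have cC: "card (verts (C v)) = card (reach B.E {v} W)" if "v \<in> W" for v
          unfolding vC[OF that] using sub[OF that] inj by (intro card_image) (auto intro: inj_on_subset)
        have gc: "C v \<in> graph_components (with_proj G \<restriction> (f ` W))" if "v \<in> W" for v
          unfolding C_def G_def using that by (intro reach_in_graph_components EV) auto
        have "C u \<noteq> C w"
        proof
          assume "C u = C w"
          hence "f ` reach B.E {u} W = f ` reach B.E {w} W" using vC uw by metis
          thus False using inj_on_image_eq_iff[OF inj sub sub] uw by blast
        qed
        moreover have "\<epsilon> * d * ln n \<le> card (verts (C u))" "\<epsilon> * d * ln n \<le> card (verts (C w))"
          using s(3) uw cC by (auto simp: x_def)
        ultimately show ?thesis using gc uw by blast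
      qed
      thus "of_bool (\<exists>u\<in>W. \<exists>w\<in>W. reach B.E {u} W \<noteq> reach B.E {w} W \<and>
         s \<le> card (reach B.E {u} W) \<and> s \<le> card (reach B.E {w} W)) \<le> (of_bool (f ` W \<in> ?S) :: real)" 
        by (simp only: of_bool_def split: if_splits) auto
    qed (use p in auto)
    also have "\<dots> = perc p V (\<lambda>W. of_bool (W \<in> ?S))"
      unfolding V_def by (rule perc_image[OF inj, symmetric])
    also have "\<dots> = measure_pmf.prob (random_subset_pmf (pverts G) p) ?S"
      using prob_random_subset_pmf[OF EV(3), of p ?S] p by (simp add: G_def)
    finally show ?thesis .
  qed
  have "separating_graph \<beta> \<alpha> \<epsilon> d n G"
    unfolding separating_graph_def
    by (intro conjI allI impI F1 F2 F3 F4 F5 F6[unfolded p_def x_def]) assumption+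
  thus ?thesis by blast
qed

section \<open>Asymptotics in the degree and assembly\<close>

lemma separating_graph_mono:
  assumes "separating_graph b \<alpha> \<epsilon> d n G" "b' \<le> b"
  shows "separating_graph b' \<alpha> \<epsilon> d n G"
proof -
  have "b' * real (card U) \<le> b * real (card U)" for U :: "nat set"
    using assms(2) by (intro mult_right_mono) auto
  thus ?thesis using assms(1) unfolding separating_graph_def by (meson order_trans)
qed

text \<open>As (1 + c/d)^d tends to e^c, the hypotheses \<open>e1\<close>, \<open>e2\<close> and
  \<open>e3\<close> are the limits of \<open>gs\<close>, \<open>gr\<close> and \<open>super\<close>;
  being strict, they pass to all large d.\<close>

lemma eventually_suitable_degree:
  fixes \<alpha> \<epsilon> \<kappa> \<theta> \<eta>\<^sub>0 :: real and \<beta> :: nat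
  assumes \<alpha>: "0 < \<alpha>" and \<epsilon>: "0 < \<epsilon>" "\<epsilon> \<le> 1 / 5000"
    and \<eta>0: "0 < \<eta>\<^sub>0" and \<theta>: "0 < \<theta>" "\<theta> < 1" and \<kappa>: "0 < \<kappa>"
    and e1: "1 - 3 * \<epsilon> < exp (- (3 * \<epsilon> * (1 + \<epsilon>)))"
    and e2: "exp (- (\<epsilon> * (1 + \<epsilon>))) < \<theta> * (1 - \<epsilon>)"
    and e3: "1 < (1 - \<epsilon> / 20) * (1 + \<epsilon>) * (1 - 4 / 5 * \<epsilon>)"
  shows "\<forall>\<^sub>F d in sequentially. suitable_degree \<alpha> \<epsilon> \<kappa> \<theta> \<eta>\<^sub>0 \<beta> d"
  unfolding suitable_degree_def
proof (intro eventually_conj)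
  show "\<forall>\<^sub>F d in sequentially. 31 + 29 * \<beta> \<le> d" by (rule eventually_ge_at_top)
  show "\<forall>\<^sub>F d in sequentially. real (4 * \<beta> + 1) \<le> \<alpha> / 5 * real d" using \<alpha> by real_asymp
  have "(\<lambda>d::nat. 12 * (exp (2 * real d * (16 * real d * ln (real d) + 1) * exp (- (\<eta>\<^sub>0 * real d / 60))) - 1)) \<longlonglongrightarrow> 0"
    using \<eta>0 by real_asymp
  thus "\<forall>\<^sub>F d in sequentially. 12 * (exp (2 * real d * (16 * real d * ln (real d) + 1) * exp (- (\<eta>\<^sub>0 * real d / 60))) - 1) < 1"
    by (rule order_tendstoD(2)) simp
  have "\<forall>\<^sub>F d::nat in sequentially. c + 3 * ln (2 * real d * (16 * real d * ln (real d) + 1)) \<le> 13 / 2 * ln (real d)" for c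
    by real_asymp
  thus "\<forall>\<^sub>F d in sequentially. ln (9 * real \<beta> ^ 2) + 3 * ln (2 * real d * (16 * real d * ln (real d) + 1)) \<le> 13 / 2 * ln (real d)" .
  show "\<forall>\<^sub>F d in sequentially. 100 \<le> \<epsilon> * real d * ln (real d)" using \<epsilon>(1) by real_asymp
  have "(\<lambda>d::nat. c * ((real d - 4 * real \<beta>) / real d)) \<longlonglongrightarrow> c" for c :: real by real_asymp
  thus "\<forall>\<^sub>F d in sequentially. 1 < (1 - \<epsilon> / 20) * (1 + \<epsilon>) * (1 - 4 / 5 * \<epsilon>) * ((real d - 4 * real \<beta>) / real d)"
    using e3 by (rule order_tendstoD(1))
  have "(\<lambda>d::nat. (2 * real d * (16 * real d * ln (real d) + 1) + 1) * exp (- (c * (real d * ln (real d))))) \<longlonglongrightarrow> 0"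
    if "0 < c" for c :: real using that by real_asymp
  from this[of "\<kappa> * \<epsilon> / 50"] have "(\<lambda>d::nat. (2 * real d * (16 * real d * ln (real d) + 1) + 1) * exp (- (\<kappa> * (\<epsilon> * real d * ln (real d) / 50)))) \<longlonglongrightarrow> 0"
    using \<kappa> \<epsilon> by (simp add: mult_ac)
  hence "\<forall>\<^sub>F d::nat in sequentially. (2 * real d * (16 * real d * ln (real d) + 1) + 1) * exp (- (\<kappa> * (\<epsilon> * real d * ln (real d) / 50))) < 1 / 10"
    by (rule order_tendstoD(2)) simp
  thus "\<forall>\<^sub>F d::nat in sequentially. (2 * real d * (16 * real d * ln (real d) + 1) + 1) * exp (- (\<kappa> * (\<epsilon> * real d * ln (real d) / 50))) \<le> 1 / 10"
    by (rule eventually_mono) simp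
  have "\<forall>\<^sub>F d in sequentially. 1 - 3 * \<epsilon> < (1 + (- (3 * \<epsilon> * (1 + \<epsilon>))) / real d) ^ d"
    using tendsto_exp_limit_sequentially e1 by (rule order_tendstoD(1))
  thus "\<forall>\<^sub>F d in sequentially. 1 - 3 * \<epsilon> \<le> (1 - (1 + \<epsilon>) / real d + (1 + \<epsilon>) / real d * (1 - 3 * \<epsilon>)) ^ d"
  proof (rule eventually_mono)
    fix d :: nat
    have "1 + (- (3 * \<epsilon> * (1 + \<epsilon>))) / real d = 1 - (1 + \<epsilon>) / real d + (1 + \<epsilon>) / real d * (1 - 3 * \<epsilon>)"
      by (simp add: algebra_simps add_divide_distrib diff_divide_distrib)
    thus "1 - 3 * \<epsilon> < (1 + (- (3 * \<epsilon> * (1 + \<epsilon>))) / real d) ^ d \<Longrightarrow>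
      1 - 3 * \<epsilon> \<le> (1 - (1 + \<epsilon>) / real d + (1 + \<epsilon>) / real d * (1 - 3 * \<epsilon>)) ^ d" by (simp only: less_imp_le)
  qed
  have "\<forall>\<^sub>F d in sequentially. (1 + (- (\<epsilon> * (1 + \<epsilon>))) / real d) ^ d < \<theta> * (1 - \<epsilon>)"
    using tendsto_exp_limit_sequentially e2 by (rule order_tendstoD(2))
  thus "\<forall>\<^sub>F d in sequentially. (1 - (1 + \<epsilon>) / real d + (1 + \<epsilon>) / real d * (1 - \<epsilon>)) ^ d \<le> \<theta> * (1 - \<epsilon>)"
  proof (rule eventually_mono)
    fix d :: nat
    have "1 + (- (\<epsilon> * (1 + \<epsilon>))) / real d = 1 - (1 + \<epsilon>) / real d + (1 + \<epsilon>) / real d * (1 - \<epsilon>)"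
      by (simp add: algebra_simps add_divide_distrib diff_divide_distrib)
    thus "(1 + (- (\<epsilon> * (1 + \<epsilon>))) / real d) ^ d < \<theta> * (1 - \<epsilon>) \<Longrightarrow>
      (1 - (1 + \<epsilon>) / real d + (1 + \<epsilon>) / real d * (1 - \<epsilon>)) ^ d \<le> \<theta> * (1 - \<epsilon>)" by (simp only: less_imp_le)
  qed
  have "(\<lambda>d::nat. C * exp (- (c * (real d * ln (real d))))) \<longlonglongrightarrow> 0" if "0 < c" for c C :: real
    using that by real_asymp
  from this[of "6 * \<epsilon> * (- ln \<theta>)" "(1 + \<epsilon>) / (4 * \<epsilon>)"]
  have "(\<lambda>d::nat. (1 + \<epsilon>) / (4 * \<epsilon>) * \<theta> powr (6 * \<epsilon> * real d * ln (real d))) \<longlonglongrightarrow> 0"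
    using \<theta> \<epsilon> mult_pos_neg[OF \<epsilon>(1), of "ln \<theta>"] by (simp add: powr_def mult_ac)
  hence "\<forall>\<^sub>F d::nat in sequentially. (1 + \<epsilon>) / (4 * \<epsilon>) * \<theta> powr (6 * \<epsilon> * real d * ln (real d)) < 1 / 25"
    by (rule order_tendstoD(2)) simp
  thus "\<forall>\<^sub>F d::nat in sequentially. (1 + \<epsilon>) / (4 * \<epsilon>) * \<theta> powr (6 * \<epsilon> * real d * ln (real d)) \<le> 1 / 25"
    by (rule eventually_mono) simp
  \<comment> \<open>The left side increases with \<epsilon>, so the extreme value 1/5000 is tested:
    16 * 11/5000 * 32 = 1.1264 times 5001/5000 is below 6/5.\<close>
  have "\<forall>\<^sub>F d::nat in sequentially. (5001 / 5000 / real d + 2 * (5001 / 5000 / real d)\<^sup>2) *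
      (16 * (1 / 500 + 1 / 5000) * (2 * (16 * real d * ln (real d) + 1)) + 1) \<le> 6 / 5 * ln (real d)"
    by real_asymp
  thus "\<forall>\<^sub>F d::nat in sequentially. ((1 + \<epsilon>) / real d + 2 * ((1 + \<epsilon>) / real d)\<^sup>2) *
      (16 * (1 / 500 + \<epsilon>) * (2 * (16 * real d * ln (real d) + 1)) + 1) \<le> 6 / 5 * ln (real d)"
    using eventually_ge_at_top[of 1]
  proof eventually_elim
    case (elim d)
    have p: "(1 + \<epsilon>) / real d \<le> 5001 / 5000 / real d" using \<epsilon> by (intro divide_right_mono) auto
    have "0 \<le> ln (real d)" using elim(2) by simp
    moreover have "((1 + \<epsilon>) / real d)\<^sup>2 \<le> (5001 / 5000 / real d)\<^sup>2" using p \<epsilon> by (intro power_mono) auto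
    ultimately have "((1 + \<epsilon>) / real d + 2 * ((1 + \<epsilon>) / real d)\<^sup>2) *
      (16 * (1 / 500 + \<epsilon>) * (2 * (16 * real d * ln (real d) + 1)) + 1)
      \<le> (5001 / 5000 / real d + 2 * (5001 / 5000 / real d)\<^sup>2) *
      (16 * (1 / 500 + 1 / 5000) * (2 * (16 * real d * ln (real d) + 1)) + 1)"
      using p \<epsilon> by (intro mult_mono add_mono) auto
    thus ?case using elim(1) by linarith
  qed
qed

text \<open>\<open>\<epsilon>\<^sub>0\<close> is uniform in \<alpha>, which only affects how large d
  must be. The conditions on \<epsilon> hold by expansion at 0; for instance (1 - \<epsilon>/20) (1
  + \<epsilon>) (1 - 4/5 \<epsilon>) is 1 + 3/20 \<epsilon> to first order.\<close>

lemma eventually_exists_separating_graph: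
  obtains \<epsilon>\<^sub>0 :: real where "0 < \<epsilon>\<^sub>0"
    "\<And>(\<alpha>::real) (\<epsilon>::real). 0 < \<alpha> \<Longrightarrow> \<alpha> < 1 \<Longrightarrow> 0 < \<epsilon> \<Longrightarrow> \<epsilon> < \<epsilon>\<^sub>0 \<Longrightarrow>
       \<forall>\<^sub>F d in sequentially. \<exists>n G. separating_graph (1 / (500 * \<epsilon>)) \<alpha> \<epsilon> d n G"
proof -
  have "\<forall>\<^sub>F \<epsilon>::real in at_right 0. \<epsilon> \<le> 1 / 5000 \<and> 1 - 3 * \<epsilon> < exp (- (3 * \<epsilon> * (1 + \<epsilon>))) \<and>
      exp (- (\<epsilon> * (1 + \<epsilon>))) < 1 - \<epsilon> \<and> 1 < (1 - \<epsilon> / 20) * (1 + \<epsilon>) * (1 - 4 / 5 * \<epsilon>) \<and>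
      0 < \<epsilon> / 20 + (1 - \<epsilon> / 20) * ln (1 - \<epsilon> / 20)"
    by (intro eventually_conj; real_asymp)
  then obtain \<epsilon>\<^sub>0 where \<epsilon>0: "0 < \<epsilon>\<^sub>0" and small: "\<And>\<epsilon>::real. 0 < \<epsilon> \<Longrightarrow> \<epsilon> < \<epsilon>\<^sub>0 \<Longrightarrow>
      \<epsilon> \<le> 1 / 5000 \<and> 1 - 3 * \<epsilon> < exp (- (3 * \<epsilon> * (1 + \<epsilon>))) \<and>
      exp (- (\<epsilon> * (1 + \<epsilon>))) < 1 - \<epsilon> \<and> 1 < (1 - \<epsilon> / 20) * (1 + \<epsilon>) * (1 - 4 / 5 * \<epsilon>) \<and>
      0 < \<epsilon> / 20 + (1 - \<epsilon> / 20) * ln (1 - \<epsilon> / 20)"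
    unfolding eventually_at_right_field by auto
  show ?thesis
  proof (rule that[OF \<epsilon>0], goal_cases)
    case (1 \<alpha> \<epsilon>)
    note \<alpha> = 1(1,2) and \<epsilon> = 1(3)
    note sm = small[OF 1(3,4)]
    \<comment> \<open>1/(500 \<epsilon>) is the largest b allowed, and rounding it up to an integer
      costs at most 1.\<close>
    define \<beta> where "\<beta> = nat \<lceil>1 / (500 * \<epsilon>)\<rceil>"
    define \<kappa> where "\<kappa> = \<epsilon> / 20 + (1 - \<epsilon> / 20) * ln (1 - \<epsilon> / 20)"
    define r where "r = exp (- (\<epsilon> * (1 + \<epsilon>))) / (1 - \<epsilon>)"
    \<comment> \<open>Midway between r and 1: above r, so that the limit form of \<open>gr\<close>
      is strict, and below 1, so that its powers decay.\<close>
    define \<theta> where "\<theta> = (1 + r) / 2"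
    define \<eta>\<^sub>0 where "\<eta>\<^sub>0 = min (\<alpha> / 3) (\<epsilon> / 2)"
    have r: "0 < r" "r < 1" using sm by (auto simp: r_def field_simps)
    have \<theta>: "0 < \<theta>" "\<theta> < 1" "r < \<theta>" using r by (auto simp: \<theta>_def)
    have e2: "exp (- (\<epsilon> * (1 + \<epsilon>))) < \<theta> * (1 - \<epsilon>)"
      using \<theta>(3) sm unfolding r_def by (simp add: pos_divide_less_eq)
    have pos: "0 < 1 / (500 * \<epsilon>)" using \<epsilon> by simp
    have \<beta>: "0 < \<beta>" "1 / (500 * \<epsilon>) \<le> \<beta>" "\<beta> \<le> 1 / (500 * \<epsilon>) + 1"
      using pos unfolding \<beta>_def by linarith+
    have \<eta>0: "0 < \<eta>\<^sub>0" "\<eta>\<^sub>0 \<le> \<alpha> / 3" "\<eta>\<^sub>0 \<le> \<epsilon> / 2" using \<alpha> \<epsilon> by (auto simp: \<eta>\<^sub>0_def)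
    have \<kappa>: "0 < \<kappa>" using sm by (simp add: \<kappa>_def)
    have e5: "\<epsilon> \<le> 1 / 5000" using sm by simp
    have "\<forall>\<^sub>F d in sequentially. suitable_degree \<alpha> \<epsilon> \<kappa> \<theta> \<eta>\<^sub>0 \<beta> d"
      using sm by (intro eventually_suitable_degree \<alpha> \<epsilon> e5 \<eta>0 \<theta> \<kappa> e2) auto
    thus ?case
    proof (rule eventually_mono)
      fix d assume "suitable_degree \<alpha> \<epsilon> \<kappa> \<theta> \<eta>\<^sub>0 \<beta> d"
      then obtain n G where "separating_graph \<beta> \<alpha> \<epsilon> d n G"
        using suitable_degree.exists_separating_graph[OF _ \<alpha> \<epsilon> e5 \<beta>(1,3) \<eta>0 \<theta>(1) less_imp_le[OF \<theta>(2)] \<kappa>_def \<kappa>]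
        by blast
      thus "\<exists>n G. separating_graph (1 / (500 * \<epsilon>)) \<alpha> \<epsilon> d n G"
        using separating_graph_mono[OF _ \<beta>(2)] by blast
    qed
  qed
qed

theorem theorem1p3:
  fixes \<alpha> :: real
  assumes "0 < \<alpha>"
  shows "\<exists>c::real. 0 < c \<and> (\<exists>\<epsilon>\<^sub>0::real. 0 < \<epsilon>\<^sub>0 \<and>
    (\<forall>\<epsilon> b :: real. 0 < \<epsilon> \<and> \<epsilon> < \<epsilon>\<^sub>0 \<and> 0 < b \<and> b \<le> 1 / (500 * \<epsilon>) \<longrightarrow>
      (\<exists>(S :: (nat \<times> nat) set) (G :: nat \<Rightarrow> nat \<Rightarrow> nat pair_pre_digraph).
        infinite S \<and>
        filterlim fst at_top (along_pairs S) \<and>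
        (\<forall>(d, n) \<in> S.
          real d < real n powr (1 / 5) \<and>
          regular_graph d n (G d n) \<and>
          (\<forall>U \<subseteq> pverts (G d n). real (card U) \<le> real n / 2 \<longrightarrow>
             real (edges_between (G d n) U (pverts (G d n) - U)) \<ge> b * real (card U)) \<and>
          (\<forall>U \<subseteq> pverts (G d n). real (card U) \<le> c * real d * ln (real n) \<longrightarrow>
             real (card (ext_nbhd (G d n) U)) \<ge> (1 - \<alpha>) * real d * real (card U)) \<and>
          (\<forall>U \<subseteq> pverts (G d n). real (card U) \<le> \<alpha> / 2 * real d ^ 2 * ln (real n) \<longrightarrow>
             real (edges_between (G d n) U (pverts (G d n) - U)) \<ge> (1 - \<alpha>) * real d * real (card U))) \<and>
        ((\<lambda>(d, n). measure_pmf.prob (random_subset_pmf (pverts (G d n)) ((1 + \<epsilon>) / real d))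
            {W. \<exists>C\<^sub>1 \<in> graph_components (with_proj (G d n) \<restriction> W).
                \<exists>C\<^sub>2 \<in> graph_components (with_proj (G d n) \<restriction> W).
                  C\<^sub>1 \<noteq> C\<^sub>2 \<and>
                  real (card (verts C\<^sub>1)) \<ge> \<epsilon> * real d * ln (real n) \<and>
                  real (card (verts C\<^sub>2)) \<ge> \<epsilon> * real d * ln (real n)}) \<longlongrightarrow> 1)
          (along_pairs S))))"
proof -
  obtain \<epsilon>\<^sub>0 :: real where \<epsilon>0: "0 < \<epsilon>\<^sub>0"
    and graphs: "\<And>(\<alpha>::real) (\<epsilon>::real). 0 < \<alpha> \<Longrightarrow> \<alpha> < 1 \<Longrightarrow> 0 < \<epsilon> \<Longrightarrow> \<epsilon> < \<epsilon>\<^sub>0 \<Longrightarrow>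
       \<forall>\<^sub>F d in sequentially. \<exists>n G. separating_graph (1 / (500 * \<epsilon>)) \<alpha> \<epsilon> d n G"
    using eventually_exists_separating_graph by blast
  \<comment> \<open>For \<alpha> \<ge> 1 the factor 1 - \<alpha> is nonpositive, and the
    construction runs with 1/2 in its place.\<close>
  define \<alpha>' where "\<alpha>' = (if \<alpha> < 1 then \<alpha> else 1 / 2)"
  have \<alpha>': "0 < \<alpha>'" "\<alpha>' < 1" "\<alpha>' \<le> \<alpha>" using assms by (auto simp: \<alpha>'_def)
  show ?thesis
  proof (rule exI[of _ "\<alpha>' / 2"], rule conjI, goal_cases)
    case 1
    show ?case using \<alpha>' by simp
  next
    case 2
    show ?case
    proof (rule exI[of _ \<epsilon>\<^sub>0], rule conjI[OF \<epsilon>0], intro allI impI, goal_cases)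
      case 2: (1 \<epsilon> b)
      have "\<forall>\<^sub>F d in sequentially. \<exists>n G. separating_graph b \<alpha>' \<epsilon> d n G"
      proof (rule eventually_mono[OF graphs[OF \<alpha>'(1,2), of \<epsilon>]])
        fix d assume "\<exists>n G. separating_graph (1 / (500 * \<epsilon>)) \<alpha>' \<epsilon> d n G"
        then obtain n G where "separating_graph (1 / (500 * \<epsilon>)) \<alpha>' \<epsilon> d n G" by blast
        hence "separating_graph b \<alpha>' \<epsilon> d n G" by (rule separating_graph_mono) (use 2 in simp)
        thus "\<exists>n G. separating_graph b \<alpha>' \<epsilon> d n G" by blast
      qed (use 2 in auto)
      then obtain d0 where "\<And>d. d \<ge> d0 \<Longrightarrow> \<exists>n G. separating_graph b \<alpha>' \<epsilon> d n G" by (auto simp: eventually_sequentially)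
      then obtain N Gr where NG: "\<And>d. d \<ge> d0 \<Longrightarrow> separating_graph b \<alpha>' \<epsilon> d (N d) (Gr d)" by metis
      define S where "S = (\<lambda>d. (d, N d)) ` {d0..}"
      define err where "err d = 2 * exp (- (real d powr (4 / 5) / 10))" for d :: nat
      have ev_along: "eventually P (along_pairs S) \<longleftrightarrow> (\<exists>n0. \<forall>(d, n)\<in>S. n \<ge> n0 \<longrightarrow> P (d, n))" for P
        unfolding along_pairs_def eventually_inf_principal eventually_filtercomap eventually_at_top_linorder
        by (auto simp: S_def)
      have fl: "filterlim fst at_top (along_pairs S)"
        unfolding filterlim_at_top
      proof
        fix Z :: nat
        \<comment> \<open>Only finitely many d lie below Z, so n beyond their \<open>N\<close>
          values forces d \<ge> Z: divergence of n along S entails that of d.\<close>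
        define n0 where "n0 = Suc (Max (insert 0 (N ` {..<Z})))"
        have "N d < n0" if "d < Z" for d unfolding n0_def using that by (intro le_imp_less_Suc Max_ge) auto
        hence "Z \<le> d" if "n0 \<le> N d" for d using that by (meson not_le)
        hence "\<forall>(d, n)\<in>S. n \<ge> n0 \<longrightarrow> Z \<le> fst (d, n)" by (auto simp: S_def)
        thus "\<forall>\<^sub>F x in along_pairs S. Z \<le> fst x" unfolding ev_along by blast
      qed
      have inf: "infinite S"
        unfolding S_def by (subst finite_image_iff) (auto simp: inj_on_def infinite_Ici)
      have props: "case x of (d, n) \<Rightarrow>
            real d < real n powr (1 / 5) \<and>
            regular_graph d n (Gr d) \<and>
            (\<forall>U \<subseteq> pverts (Gr d). real (card U) \<le> real n / 2 \<longrightarrow>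
               real (edges_between (Gr d) U (pverts (Gr d) - U)) \<ge> b * real (card U)) \<and>
            (\<forall>U \<subseteq> pverts (Gr d). real (card U) \<le> \<alpha>' / 2 * real d * ln (real n) \<longrightarrow>
               real (card (ext_nbhd (Gr d) U)) \<ge> (1 - \<alpha>) * real d * real (card U)) \<and>
            (\<forall>U \<subseteq> pverts (Gr d). real (card U) \<le> \<alpha> / 2 * real d ^ 2 * ln (real n) \<longrightarrow>
               real (edges_between (Gr d) U (pverts (Gr d) - U)) \<ge> (1 - \<alpha>) * real d * real (card U))"
        if xS: "x \<in> S" for x
      proof -
        obtain d where d: "d \<ge> d0" "x = (d, N d)" using xS by (auto simp: S_def)
        have g: "separating_graph b \<alpha>' \<epsilon> d (N d) (Gr d)" using NG d by simp
        note Q1 = g[unfolded separating_graph_def, THEN conjunct2, THEN conjunct2, THEN conjunct1, rule_format]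
        note Q2 = g[unfolded separating_graph_def, THEN conjunct2, THEN conjunct2, THEN conjunct2, THEN conjunct1, rule_format]
        note Q3 = g[unfolded separating_graph_def, THEN conjunct2, THEN conjunct2, THEN conjunct2, THEN conjunct2, THEN conjunct1, rule_format]
        have le: "(1 - \<alpha>) * real d * real c \<le> (1 - \<alpha>') * real d * real c" for c :: nat
          using \<alpha>' by (intro mult_right_mono) auto
        have "b * real (card U) \<le> real (edges_between (Gr d) U (pverts (Gr d) - U))"
          if "U \<subseteq> pverts (Gr d)" "real (card U) \<le> real (N d) / 2" for U
          using Q1[OF that] .
        moreover have "(1 - \<alpha>) * real d * real (card U) \<le> real (card (ext_nbhd (Gr d) U))"
          if "U \<subseteq> pverts (Gr d)" "real (card U) \<le> \<alpha>' / 2 * real d * ln (real (N d))" for U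
          using le Q2[OF that] by (rule order_trans)
        moreover have "(1 - \<alpha>) * real d * real (card U) \<le> real (edges_between (Gr d) U (pverts (Gr d) - U))"
          if "U \<subseteq> pverts (Gr d)" "real (card U) \<le> \<alpha> / 2 * real d ^ 2 * ln (real (N d))" for U
        proof (cases "\<alpha> < 1")
          case True
          hence "\<alpha>' = \<alpha>" by (simp add: \<alpha>'_def)
          thus ?thesis using Q3[of U] that by simp
        next
          \<comment> \<open>The size range of (Q3) goes beyond the one for \<open>\<alpha>'\<close>,
            but the required lower bound is nonpositive.\<close>
          case False
          hence "(1 - \<alpha>) * real d * real (card U) \<le> 0"
            by (intro mult_nonpos_nonneg) auto
          thus ?thesis by linarith
        qed
        ultimately show ?thesis using g unfolding d(2) by (simp add: separating_graph_def)
      qed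
      have lim: "((\<lambda>(d, n). measure_pmf.prob (random_subset_pmf (pverts (Gr d)) ((1 + \<epsilon>) / real d))
              {W. \<exists>C\<^sub>1 \<in> graph_components (with_proj (Gr d) \<restriction> W).
                  \<exists>C\<^sub>2 \<in> graph_components (with_proj (Gr d) \<restriction> W).
                    C\<^sub>1 \<noteq> C\<^sub>2 \<and>
                    real (card (verts C\<^sub>1)) \<ge> \<epsilon> * real d * ln (real n) \<and>
                    real (card (verts C\<^sub>2)) \<ge> \<epsilon> * real d * ln (real n)}) \<longlongrightarrow> 1) (along_pairs S)"
        (is "(?pr \<longlongrightarrow> 1) _")
      proof (rule tendsto_sandwich)
        have "err \<longlonglongrightarrow> 0" unfolding err_def by real_asymp
        hence "((\<lambda>x. err (fst x)) \<longlongrightarrow> 0) (along_pairs S)" using fl by (rule filterlim_compose)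
        thus "((\<lambda>x. 1 - err (fst x)) \<longlongrightarrow> 1) (along_pairs S)" by (auto intro!: tendsto_eq_intros)
        show "\<forall>\<^sub>F x in along_pairs S. 1 - err (fst x) \<le> ?pr x"
          unfolding ev_along using NG by (intro exI[of _ 0]) (auto simp: S_def separating_graph_def err_def)
        show "\<forall>\<^sub>F x in along_pairs S. ?pr x \<le> 1"
          by (rule always_eventually) auto
      qed (rule tendsto_const)
      show ?case
        by (intro exI[of _ S] exI[of _ "\<lambda>d n. Gr d"] conjI inf fl ballI) (use props lim in auto)
    qed
  qed
qed

end
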